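(* Let $(X,\xi)$ be a homotopy differential graded non-unital algebra over a commutative ring $R$. Then $(X,\xi)$ gives rise to an $A_4$-algebra whose underlying chain complex is $X(1)$.
   Context: $\mathbf{ChCx}=\mathbf{ChCx}_R$ is the category of $\mathbb{Z}$-graded chain complexes of $R$-modules (differential $d:A_p\to A_{p-1}$) and degree-0 chain maps, with the usual tensor product $\otimes$, unit $R$ (concentrated in degree 0), and chain homotopy equivalences as equivalences. $\Delta_{\mathrm{surj}}$ is the category with objects $n=\{0,\dots,n-1\}$ ($n\ge0$) and surjective order-preserving maps, monoidal under ordinal sum $+$ with unit $0$. A homotopy differential graded non-unital algebra (homotopy semigroup in $\mathbf{ChCx}$) is a colax monoidal functor $(X,\xi):(\Delta_{\mathrm{surj}},+,0)\to(\mathbf{ChCx},\otimes,R)$ — a functor $X$ with chain maps $\xi_{m,n}:X(m+n)\to X(m)\otimes X(n)$ natural in $m,n$ and $\xi_0:X(0)\to R$ satisfying the coassociativity and counit axioms (not necessarily invertible) — such that $\xi_0$ and all $\xi_{m,n}$ are chain homotopy equivalences. An $A_4$-algebra is a chain complex $A$ with: a degree-0 chain map $m_2:A\otimes A\to A$; homomorphisms $m_3:(A^{\otimes3})_p\to A_{p+1}$ such that for $a_i\in A_{p_i}$, $d(m_3(a_1,a_2,a_3))+m_3(da_1,a_2,a_3)+(-1)^{p_1}m_3(a_1,da_2,a_3)+(-1)^{p_1+p_2}m_3(a_1,a_2,da_3)=-m_2(m_2(a_1,a_2),a_3)+m_2(a_1,m_2(a_2,a_3))$; and homomorphisms $m_4:(A^{\otimes4})_p\to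 A_{p+2}$ such that $d(m_4(a_1,a_2,a_3,a_4))-m_4(da_1,a_2,a_3,a_4)-(-1)^{p_1}m_4(a_1,da_2,a_3,a_4)-(-1)^{p_1+p_2}m_4(a_1,a_2,da_3,a_4)-(-1)^{p_1+p_2+p_3}m_4(a_1,a_2,a_3,da_4)$ $=-m_3(m_2(a_1,a_2),a_3,a_4)+m_3(a_1,m_2(a_2,a_3),a_4)-m_3(a_1,a_2,m_2(a_3,a_4))+m_2(m_3(a_1,a_2,a_3),a_4)+(-1)^{p_1}m_2(a_1,m_3(a_2,a_3,a_4))$. *)

theory Defs
  imports Main
begin

text \<open>A Z-graded chain complex: for each degree p a carrier set with its R-module
 operations, and a differential d_p from degree p to degree p-1.\<close>

record ('r, 'a) cx =
  cset   :: "int \<Rightarrow> 'a set"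
  cadd   :: "int \<Rightarrow> 'a \<Rightarrow> 'a \<Rightarrow> 'a"
  czero  :: "int \<Rightarrow> 'a"
  csmult :: "int \<Rightarrow> 'r \<Rightarrow> 'a \<Rightarrow> 'a"
  cd     :: "int \<Rightarrow> 'a \<Rightarrow> 'a"

definition module_at :: "('r::comm_ring_1, 'a) cx \<Rightarrow> int \<Rightarrow> bool" where
  "module_at A p \<longleftrightarrow>
    (let S = cset A p; add = cadd A p; z = czero A p; sm = csmult A p in
     z \<in> S \<and> (\<forall>x\<in>S. \<forall>y\<in>S. add x y \<in> S) \<and> (\<forall>r. \<forall>x\<in>S. sm r x \<in> S) \<and>
     (\<forall>x\<in>S. \<forall>y\<in>S. \<forall>w\<in>S. add (add x y) w = add x (add y w)) \<and>
     (\<forall>x\<in>S. \<forall>y\<in>S. add x y = add y x) \<and> (\<forall>x\<in>S. add z x = x) \<and>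
     (\<forall>r s. \<forall>x\<in>S. sm (r + s) x = add (sm r x) (sm s x)) \<and>
     (\<forall>r. \<forall>x\<in>S. \<forall>y\<in>S. sm r (add x y) = add (sm r x) (sm r y)) \<and>
     (\<forall>r s. \<forall>x\<in>S. sm (r * s) x = sm r (sm s x)) \<and>
     (\<forall>x\<in>S. sm 1 x = x) \<and> (\<forall>x\<in>S. sm 0 x = z))"

definition linmap :: "('r::comm_ring_1, 'a) cx \<Rightarrow> int \<Rightarrow> ('r, 'b) cx \<Rightarrow> int \<Rightarrow> ('a \<Rightarrow> 'b) \<Rightarrow> bool" where
  "linmap A p B q f \<longleftrightarrow>
    (\<forall>x\<in>cset A p. f x \<in> cset B q) \<and>
    (\<forall>x\<in>cset A p. \<forall>y\<in>cset A p. f (cadd A p x y) = cadd B q (f x) (f y)) \<and>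
    (\<forall>r. \<forall>x\<in>cset A p. f (csmult A p r x) = csmult B q r (f x))"

definition chain_complex :: "('r::comm_ring_1, 'a) cx \<Rightarrow> bool" where
  "chain_complex A \<longleftrightarrow>
    (\<forall>p. module_at A p \<and> linmap A p A (p - 1) (cd A p) \<and>
         (\<forall>x\<in>cset A p. cd A (p - 1) (cd A p x) = czero A (p - 2)))"

definition chain_map :: "('r::comm_ring_1, 'a) cx \<Rightarrow> ('r, 'b) cx \<Rightarrow> (int \<Rightarrow> 'a \<Rightarrow> 'b) \<Rightarrow> bool" where
  "chain_map A B f \<longleftrightarrow>
    (\<forall>p. linmap A p B p (f p) \<and> (\<forall>x\<in>cset A p. f (p - 1) (cd A p x) = cd B p (f p x)))"

definition cmap_eq :: "('r, 'a) cx \<Rightarrow> (int \<Rightarrow> 'a \<Rightarrow> 'b) \<Rightarrow> (int \<Rightarrow> 'a \<Rightarrow> 'b) \<Rightarrow> bool" where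
  "cmap_eq A f g \<longleftrightarrow> (\<forall>p. \<forall>x\<in>cset A p. f p x = g p x)"

definition chain_htpic :: "('r::comm_ring_1, 'a) cx \<Rightarrow> ('r, 'b) cx \<Rightarrow> (int \<Rightarrow> 'a \<Rightarrow> 'b) \<Rightarrow> (int \<Rightarrow> 'a \<Rightarrow> 'b) \<Rightarrow> bool" where
  "chain_htpic A B f g \<longleftrightarrow>
    (\<exists>h. (\<forall>p. linmap A p B (p + 1) (h p)) \<and>
         (\<forall>p. \<forall>x\<in>cset A p.
             f p x = cadd B p (cadd B p (g p x) (cd B (p + 1) (h p x))) (h (p - 1) (cd A p x))))"

definition htpy_inverse :: "('r::comm_ring_1, 'a) cx \<Rightarrow> ('r, 'b) cx \<Rightarrow> (int \<Rightarrow> 'a \<Rightarrow> 'b) \<Rightarrow> (int \<Rightarrow> 'b \<Rightarrow> 'a) \<Rightarrow> bool" where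
  "htpy_inverse A B f g \<longleftrightarrow> chain_map A B f \<and> chain_map B A g \<and>
     chain_htpic A A (\<lambda>p x. g p (f p x)) (\<lambda>p x. x) \<and>
     chain_htpic B B (\<lambda>p y. f p (g p y)) (\<lambda>p y. y)"

definition chain_htpy_equiv :: "('r::comm_ring_1, 'a) cx \<Rightarrow> ('r, 'b) cx \<Rightarrow> (int \<Rightarrow> 'a \<Rightarrow> 'b) \<Rightarrow> bool" where
  "chain_htpy_equiv A B f \<longleftrightarrow> (\<exists>g. htpy_inverse A B f g)"

definition delta :: "'i \<Rightarrow> 'i \<Rightarrow> 'r::comm_ring_1" where
  "delta x = (\<lambda>y. if y = x then 1 else 0)"

definition supp :: "('i \<Rightarrow> 'r::zero) \<Rightarrow> 'i set" where
  "supp f = {x. f x \<noteq> 0}"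

definition lext :: "('i \<Rightarrow> 'j \<Rightarrow> 'r::comm_ring_1) \<Rightarrow> ('i \<Rightarrow> 'r) \<Rightarrow> 'j \<Rightarrow> 'r" where
  "lext F h = (\<lambda>y. \<Sum>x\<in>supp h. h x * F x y)"

definition sgnpow :: "int \<Rightarrow> 'r::comm_ring_1" where
  "sgnpow i = (if even i then 1 else - 1)"

text \<open>Basis of the free module F_p on generators a (x) b with a in A_i, b in B_(p-i).\<close>
definition tgens :: "('r, 'a) cx \<Rightarrow> ('r, 'b) cx \<Rightarrow> int \<Rightarrow> (int \<times> 'a \<times> 'b) set" where
  "tgens A B p = {(i, a, b). a \<in> cset A i \<and> b \<in> cset B (p - i)}"

definition tfree :: "('r::comm_ring_1, 'a) cx \<Rightarrow> ('r, 'b) cx \<Rightarrow> int \<Rightarrow> (int \<times> 'a \<times> 'b \<Rightarrow> 'r) set" where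
  "tfree A B p = {f. finite (supp f) \<and> supp f \<subseteq> tgens A B p}"

inductive_set tker :: "('r::comm_ring_1, 'a) cx \<Rightarrow> ('r, 'b) cx \<Rightarrow> int \<Rightarrow> (int \<times> 'a \<times> 'b \<Rightarrow> 'r) set"
  for A B p where
  zero: "(\<lambda>_. 0) \<in> tker A B p"
| add: "f \<in> tker A B p \<Longrightarrow> g \<in> tker A B p \<Longrightarrow> (\<lambda>x. f x + g x) \<in> tker A B p"
| smult: "f \<in> tker A B p \<Longrightarrow> (\<lambda>x. r * f x) \<in> tker A B p"
| ladd: "a \<in> cset A i \<Longrightarrow> a' \<in> cset A i \<Longrightarrow> b \<in> cset B (p - i) \<Longrightarrow>
    (\<lambda>x. delta (i, cadd A i a a', b) x - delta (i, a, b) x - delta (i, a', b) x) \<in> tker A B p"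
| radd: "a \<in> cset A i \<Longrightarrow> b \<in> cset B (p - i) \<Longrightarrow> b' \<in> cset B (p - i) \<Longrightarrow>
    (\<lambda>x. delta (i, a, cadd B (p - i) b b') x - delta (i, a, b) x - delta (i, a, b') x) \<in> tker A B p"
| lsm: "a \<in> cset A i \<Longrightarrow> b \<in> cset B (p - i) \<Longrightarrow>
    (\<lambda>x. delta (i, csmult A i r a, b) x - r * delta (i, a, b) x) \<in> tker A B p"
| rsm: "a \<in> cset A i \<Longrightarrow> b \<in> cset B (p - i) \<Longrightarrow>
    (\<lambda>x. delta (i, a, csmult B (p - i) r b) x - r * delta (i, a, b) x) \<in> tker A B p"

definition tclass :: "('r::comm_ring_1, 'a) cx \<Rightarrow> ('r, 'b) cx \<Rightarrow> int \<Rightarrow> (int \<times> 'a \<times> 'b \<Rightarrow> 'r) \<Rightarrow> (int \<times> 'a \<times> 'b \<Rightarrow> 'r) set" where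
  "tclass A B p f = {g \<in> tfree A B p. (\<lambda>x. g x - f x) \<in> tker A B p}"

definition rep :: "'x set \<Rightarrow> 'x" where
  "rep X = (SOME f. f \<in> X)"

text \<open>Differential on generators (Koszul sign): d(a (x) b) = da (x) b + (-1)^i a (x) db.\<close>
definition tdgen :: "('r::comm_ring_1, 'a) cx \<Rightarrow> ('r, 'b) cx \<Rightarrow> int \<Rightarrow> int \<times> 'a \<times> 'b \<Rightarrow> int \<times> 'a \<times> 'b \<Rightarrow> 'r" where
  "tdgen A B p = (\<lambda>(i, a, b). (\<lambda>y. delta (i - 1, cd A i a, b) y + sgnpow i * delta (i, a, cd B (p - i) b) y))"

definition tensor :: "('r::comm_ring_1, 'a) cx \<Rightarrow> ('r, 'b) cx \<Rightarrow> ('r, (int \<times> 'a \<times> 'b \<Rightarrow> 'r) set) cx" where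
  "tensor A B =
    \<lparr> cset = (\<lambda>p. tclass A B p ` tfree A B p),
      cadd = (\<lambda>p X Y. tclass A B p (\<lambda>x. rep X x + rep Y x)),
      czero = (\<lambda>p. tclass A B p (\<lambda>_. 0)),
      csmult = (\<lambda>p r X. tclass A B p (\<lambda>x. r * rep X x)),
      cd = (\<lambda>p X. tclass A B (p - 1) (lext (tdgen A B p) (rep X))) \<rparr>"

definition tens :: "('r::comm_ring_1, 'a) cx \<Rightarrow> ('r, 'b) cx \<Rightarrow> int \<Rightarrow> int \<Rightarrow> 'a \<Rightarrow> 'b \<Rightarrow> (int \<times> 'a \<times> 'b \<Rightarrow> 'r) set" where
  "tens A B i j a b = tclass A B (i + j) (delta (i, a, b))"

definition tmap :: "('r::comm_ring_1, 'c) cx \<Rightarrow> ('r, 'd) cx \<Rightarrow> (int \<Rightarrow> 'a \<Rightarrow> 'c) \<Rightarrow> (int \<Rightarrow> 'b \<Rightarrow> 'd)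
    \<Rightarrow> int \<Rightarrow> (int \<times> 'a \<times> 'b \<Rightarrow> 'r) set \<Rightarrow> (int \<times> 'c \<times> 'd \<Rightarrow> 'r) set" where
  "tmap A' B' f g = (\<lambda>p X. tclass A' B' p (lext (\<lambda>(i, a, b). delta (i, f i a, g (p - i) b)) (rep X)))"

definition tassoc :: "('r::comm_ring_1, 'a) cx \<Rightarrow> ('r, 'b) cx \<Rightarrow> ('r, 'c) cx \<Rightarrow> int
    \<Rightarrow> (int \<times> 'a \<times> (int \<times> 'b \<times> 'c \<Rightarrow> 'r) set \<Rightarrow> 'r) set
    \<Rightarrow> (int \<times> (int \<times> 'a \<times> 'b \<Rightarrow> 'r) set \<times> 'c \<Rightarrow> 'r) set" where
  "tassoc A B C = (\<lambda>p X. tclass (tensor A B) C p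
     (lext (\<lambda>(i, a, Y). lext (\<lambda>(j, b, c). delta (i + j, tens A B i j a b, c)) (rep Y)) (rep X)))"

definition unitcx :: "('r::comm_ring_1, 'r) cx" where
  "unitcx = \<lparr> cset = (\<lambda>p. if p = 0 then UNIV else {0}), cadd = (\<lambda>_. (+)), czero = (\<lambda>_. 0),
              csmult = (\<lambda>_. (*)), cd = (\<lambda>_ _. 0) \<rparr>"

text \<open>Surjective order-preserving maps {0..<m} -> {0..<n} (only values below m matter).\<close>
definition surjmono :: "nat \<Rightarrow> nat \<Rightarrow> (nat \<Rightarrow> nat) \<Rightarrow> bool" where
  "surjmono m n f \<longleftrightarrow> (\<forall>i<m. f i < n) \<and> (\<forall>i j. i \<le> j \<and> j < m \<longrightarrow> f i \<le> f j) \<and>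
                        (\<forall>k<n. \<exists>i<m. f i = k)"

definition osum :: "nat \<Rightarrow> nat \<Rightarrow> (nat \<Rightarrow> nat) \<Rightarrow> (nat \<Rightarrow> nat) \<Rightarrow> nat \<Rightarrow> nat" where
  "osum m m' f g = (\<lambda>i. if i < m then f i else m' + g (i - m))"

text \<open>A homotopy semigroup in ChCx: a functor X (objects X n, morphism action Xm m n f)
 with colax monoidal structure xi, xi0 whose components are chain homotopy equivalences.\<close>
definition hsemigroup ::
  "(nat \<Rightarrow> ('r::comm_ring_1, 'a) cx) \<Rightarrow> (nat \<Rightarrow> nat \<Rightarrow> (nat \<Rightarrow> nat) \<Rightarrow> int \<Rightarrow> 'a \<Rightarrow> 'a)
   \<Rightarrow> (nat \<Rightarrow> nat \<Rightarrow> int \<Rightarrow> 'a \<Rightarrow> (int \<times> 'a \<times> 'a \<Rightarrow> 'r) set) \<Rightarrow> (int \<Rightarrow> 'a \<Rightarrow> 'r) \<Rightarrow> bool" where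
  "hsemigroup X Xm xi xi0 \<longleftrightarrow>
    \<comment> \<open>X is a functor Delta_surj -> ChCx\<close>
    (\<forall>n. chain_complex (X n)) \<and>
    (\<forall>m n f. surjmono m n f \<longrightarrow> chain_map (X m) (X n) (Xm m n f)) \<and>
    (\<forall>m n f g. surjmono m n f \<and> (\<forall>i<m. f i = g i) \<longrightarrow> cmap_eq (X m) (Xm m n f) (Xm m n g)) \<and>
    (\<forall>n. cmap_eq (X n) (Xm n n id) (\<lambda>p x. x)) \<and>
    (\<forall>m n k f g. surjmono m n f \<and> surjmono n k g \<longrightarrow>
        cmap_eq (X m) (Xm m k (g \<circ> f)) (\<lambda>p x. Xm n k g p (Xm m n f p x))) \<and>
    \<comment> \<open>structure maps are chain maps\<close>
    (\<forall>m n. chain_map (X (m + n)) (tensor (X m) (X n)) (xi m n)) \<and>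
    chain_map (X 0) unitcx xi0 \<and>
    \<comment> \<open>naturality of xi\<close>
    (\<forall>m m' n n' f g. surjmono m m' f \<and> surjmono n n' g \<longrightarrow>
       (\<forall>p. \<forall>x\<in>cset (X (m + n)) p.
          xi m' n' p (Xm (m + n) (m' + n') (osum m m' f g) p x) =
          tmap (X m') (X n') (Xm m m' f) (Xm n n' g) p (xi m n p x))) \<and>
    \<comment> \<open>coassociativity\<close>
    (\<forall>l m n p. \<forall>x\<in>cset (X (l + m + n)) p.
       tmap (tensor (X l) (X m)) (X n) (xi l m) (\<lambda>q y. y) p (xi (l + m) n p x) =
       tassoc (X l) (X m) (X n) p (tmap (X l) (tensor (X m) (X n)) (\<lambda>q y. y) (xi m n) p (xi l (m + n) p x))) \<and>
    \<comment> \<open>counit (compared with the inverse unitors x |-> 1 (x) x, x |-> x (x) 1)\<close>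
    (\<forall>n p. \<forall>x\<in>cset (X n) p.
       tmap unitcx (X n) xi0 (\<lambda>q y. y) p (xi 0 n p x) = tens unitcx (X n) 0 p 1 x \<and>
       tmap (X n) unitcx (\<lambda>q y. y) xi0 p (xi n 0 p x) = tens (X n) unitcx p 0 x 1) \<and>
    \<comment> \<open>homotopy condition\<close>
    (\<forall>m n. chain_htpy_equiv (X (m + n)) (tensor (X m) (X n)) (xi m n)) \<and>
    chain_htpy_equiv (X 0) unitcx xi0"

definition lcomb :: "('r::comm_ring_1, 'a) cx \<Rightarrow> int \<Rightarrow> ('r \<times> 'a) list \<Rightarrow> 'a" where
  "lcomb A q xs = foldr (\<lambda>(c, x) acc. cadd A q (csmult A q c x) acc) xs (czero A q)"

definition A4_algebra ::
  "('r::comm_ring_1, 'a) cx \<Rightarrow> (int \<Rightarrow> (int \<times> 'a \<times> 'a \<Rightarrow> 'r) set \<Rightarrow> 'a)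
   \<Rightarrow> (int \<Rightarrow> (int \<times> (int \<times> 'a \<times> 'a \<Rightarrow> 'r) set \<times> 'a \<Rightarrow> 'r) set \<Rightarrow> 'a)
   \<Rightarrow> (int \<Rightarrow> (int \<times> (int \<times> (int \<times> 'a \<times> 'a \<Rightarrow> 'r) set \<times> 'a \<Rightarrow> 'r) set \<times> 'a \<Rightarrow> 'r) set \<Rightarrow> 'a) \<Rightarrow> bool" where
  "A4_algebra A m2 m3 m4 \<longleftrightarrow>
    (let A2 = tensor A A; A3 = tensor A2 A; A4 = tensor A3 A;
         t2 = (\<lambda>p1 p2 a1 a2. tens A A p1 p2 a1 a2);
         t3 = (\<lambda>p1 p2 p3 a1 a2 a3. tens A2 A (p1 + p2) p3 (t2 p1 p2 a1 a2) a3);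
         t4 = (\<lambda>p1 p2 p3 p4 a1 a2 a3 a4. tens A3 A (p1 + p2 + p3) p4 (t3 p1 p2 p3 a1 a2 a3) a4);
         d = cd A
     in chain_complex A \<and>
        chain_map A2 A m2 \<and>
        (\<forall>p. linmap A3 p A (p + 1) (m3 p)) \<and>
        (\<forall>p. linmap A4 p A (p + 2) (m4 p)) \<and>
        (\<forall>p1 p2 p3 a1 a2 a3. a1 \<in> cset A p1 \<and> a2 \<in> cset A p2 \<and> a3 \<in> cset A p3 \<longrightarrow>
          (let p = p1 + p2 + p3 in
           lcomb A p
             [(1, d (p + 1) (m3 p (t3 p1 p2 p3 a1 a2 a3))),
              (1, m3 (p - 1) (t3 (p1 - 1) p2 p3 (d p1 a1) a2 a3)),
              (sgnpow p1, m3 (p - 1) (t3 p1 (p2 - 1) p3 a1 (d p2 a2) a3)),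
              (sgnpow (p1 + p2), m3 (p - 1) (t3 p1 p2 (p3 - 1) a1 a2 (d p3 a3)))]
           = lcomb A p
             [(- 1, m2 p (t2 (p1 + p2) p3 (m2 (p1 + p2) (t2 p1 p2 a1 a2)) a3)),
              (1, m2 p (t2 p1 (p2 + p3) a1 (m2 (p2 + p3) (t2 p2 p3 a2 a3))))])) \<and>
        (\<forall>p1 p2 p3 p4 a1 a2 a3 a4.
          a1 \<in> cset A p1 \<and> a2 \<in> cset A p2 \<and> a3 \<in> cset A p3 \<and> a4 \<in> cset A p4 \<longrightarrow>
          (let p = p1 + p2 + p3 + p4 in
           lcomb A (p + 1)
             [(1, d (p + 2) (m4 p (t4 p1 p2 p3 p4 a1 a2 a3 a4))),
              (- 1, m4 (p - 1) (t4 (p1 - 1) p2 p3 p4 (d p1 a1) a2 a3 a4)),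
              (- sgnpow p1, m4 (p - 1) (t4 p1 (p2 - 1) p3 p4 a1 (d p2 a2) a3 a4)),
              (- sgnpow (p1 + p2), m4 (p - 1) (t4 p1 p2 (p3 - 1) p4 a1 a2 (d p3 a3) a4)),
              (- sgnpow (p1 + p2 + p3), m4 (p - 1) (t4 p1 p2 p3 (p4 - 1) a1 a2 a3 (d p4 a4)))]
           = lcomb A (p + 1)
             [(- 1, m3 p (t3 (p1 + p2) p3 p4 (m2 (p1 + p2) (t2 p1 p2 a1 a2)) a3 a4)),
              (1, m3 p (t3 p1 (p2 + p3) p4 a1 (m2 (p2 + p3) (t2 p2 p3 a2 a3)) a4)),
              (- 1, m3 p (t3 p1 p2 (p3 + p4) a1 a2 (m2 (p3 + p4) (t2 p3 p4 a3 a4)))),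
              (1, m2 (p + 1) (t2 (p1 + p2 + p3 + 1) p4 (m3 (p1 + p2 + p3) (t3 p1 p2 p3 a1 a2 a3)) a4)),
              (sgnpow p1, m2 (p + 1) (t2 p1 (p2 + p3 + p4 + 1) a1 (m3 (p2 + p3 + p4) (t3 p2 p3 p4 a2 a3 a4))))])))"

end

theory Submission
  imports Defs
begin

text \<open>Write \<open>A = X 1\<close>, let \<open>\<mu> : X 2 \<rightarrow> A\<close> be induced by \<open>2 \<rightarrow> 1\<close> and \<open>s\<^sub>i, t\<^sub>i\<close> by the maps merging
  \<open>i\<close> and \<open>i + 1\<close>. Put \<open>m\<^sub>2 = \<mu> \<psi>\<close> for a homotopy inverse \<open>\<psi>\<close> of \<open>\<xi>\<^sub>1\<^sub>1\<close>; then \<open>m\<^sub>2 \<xi>\<^sub>1\<^sub>1 = \<mu> + \<partial>h\<close>.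
  Precomposition with a homotopy equivalence is a quasi-isomorphism of hom complexes, so equations
  \<open>\<partial>m = r\<close> for a map \<open>m\<close> out of a tensor power of \<open>A\<close> can be solved after pulling back along the iterated
  structure map \<open>X n \<rightarrow> A \<otimes> \<dots> \<otimes> A\<close>, where naturality and coassociativity make all the maps concerned
  explicit. The pulled-back associativity defect is the boundary of
  \<open>k = h s\<^sub>1 + m\<^sub>2(1 \<otimes> h)\<xi>\<^sub>1\<^sub>2 - h s\<^sub>0 - m\<^sub>2(h \<otimes> 1)\<xi>\<^sub>2\<^sub>1\<close>, hence there are \<open>m\<^sub>3\<close> bounding the defect and \<open>l\<close> such
  that \<open>m\<^sub>3\<close> pulls back to \<open>k + \<partial>l\<close>. With this choice the right-hand side of the relation for \<open>m\<^sub>4\<close> is a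
  cycle whose pullback is again an explicit boundary, the only term not coming from \<open>l\<close> or from \<open>m\<^sub>3\<close>
  being \<open>m\<^sub>2(h \<otimes> h)\<xi>\<^sub>2\<^sub>2\<close>.\<close>

section \<open>Linear combinations in a module given by a carrier\<close>

text \<open>Solving the relation for \<open>m3\<close> alone would not suffice: its solutions differ
  by cycles, and a badly chosen cycle may leave an obstruction to \<open>m4\<close> that bounds
  nothing. Prescribing the pullback of \<open>m3\<close> up to a boundary removes this freedom;
  hence \<open>m3\<close> and \<open>l\<close> are produced together and \<open>h\<close> is carried
  along as data. Two further obstacles shape the development. Modules are carriers inside records
  and tensors are classes with chosen representatives, so no type class provides their arithmetic;
  graded maps therefore become values of one type with true equality, Koszul signs are built into
  the tensor product and the boundary, and cancellations are reduced to identities in the ring.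
  Ordinal sum is strictly associative whereas the tensor product is not, so associators accompany
  every comparison of iterated structure maps. Coassociativity converts them into changes between
  the splittings 3 + 1, 2 + 2 and 1 + 3 of 4; the pentagon identity enters in showing that the
  obstruction is a cycle.\<close>

lemma module_atD:
  assumes "module_at A p"
  shows module_zero: "czero A p \<in> cset A p"
    and module_add: "x \<in> cset A p \<Longrightarrow> y \<in> cset A p \<Longrightarrow> cadd A p x y \<in> cset A p"
    and module_smult: "x \<in> cset A p \<Longrightarrow> csmult A p r x \<in> cset A p"
    and module_add_assoc: "x \<in> cset A p \<Longrightarrow> y \<in> cset A p \<Longrightarrow> w \<in> cset A p \<Longrightarrow>
           cadd A p (cadd A p x y) w = cadd A p x (cadd A p y w)"
    and module_add_commute: "x \<in> cset A p \<Longrightarrow> y \<in> cset A p \<Longrightarrow> cadd A p x y = cadd A p y x"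
    and module_add_zero_left: "x \<in> cset A p \<Longrightarrow> cadd A p (czero A p) x = x"
    and module_smult_add_left: "x \<in> cset A p \<Longrightarrow> csmult A p (r + s) x = cadd A p (csmult A p r x) (csmult A p s x)"
    and module_smult_add_right: "x \<in> cset A p \<Longrightarrow> y \<in> cset A p \<Longrightarrow>
           csmult A p r (cadd A p x y) = cadd A p (csmult A p r x) (csmult A p r y)"
    and module_smult_mult: "x \<in> cset A p \<Longrightarrow> csmult A p (r * s) x = csmult A p r (csmult A p s x)"
    and module_smult_one: "x \<in> cset A p \<Longrightarrow> csmult A p 1 x = x"
    and module_smult_zero: "x \<in> cset A p \<Longrightarrow> csmult A p 0 x = czero A p"
  using assms by - (unfold module_at_def Let_def, (metis (no_types))+)

lemma module_add_zero_right:
  "module_at A p \<Longrightarrow> x \<in> cset A p \<Longrightarrow> cadd A p x (czero A p) = x"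
  by (metis module_add_commute module_add_zero_left module_zero)

lemma module_smult_czero:
  "module_at A p \<Longrightarrow> csmult A p r (czero A p) = czero A p"
  by (metis module_smult_mult module_smult_zero module_zero mult_zero_right)

lemma module_add_left_commute:
  assumes "module_at A p" "x \<in> cset A p" "y \<in> cset A p" "w \<in> cset A p"
  shows "cadd A p x (cadd A p y w) = cadd A p y (cadd A p x w)"
  using assms by (metis module_add_assoc module_add_commute)

lemma lcomb_Nil [simp]: "lcomb A p [] = czero A p"
  and lcomb_Cons [simp]: "lcomb A p ((c, x) # xs) = cadd A p (csmult A p c x) (lcomb A p xs)"
  by (simp_all add: lcomb_def)

lemma lcomb_closed:
  "module_at A p \<Longrightarrow> snd ` set xs \<subseteq> cset A p \<Longrightarrow> lcomb A p xs \<in> cset A p"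
  by (induction xs) (auto simp: module_zero module_add module_smult)

lemma lcomb_append:
  assumes "module_at A p" "snd ` set xs \<subseteq> cset A p" "snd ` set ys \<subseteq> cset A p"
  shows "lcomb A p (xs @ ys) = cadd A p (lcomb A p xs) (lcomb A p ys)"
  using assms(2)
  by (induction xs)
     (use assms(1,3) in \<open>auto simp: module_add_zero_left module_add_assoc module_smult lcomb_closed\<close>)

lemma lcomb_scale:
  assumes "module_at A p" "snd ` set xs \<subseteq> cset A p"
  shows "lcomb A p (map (\<lambda>(c, x). (r * c, x)) xs) = csmult A p r (lcomb A p xs)"
  using assms(2)
  by (induction xs)
     (use assms(1) in \<open>auto simp: module_smult_czero module_smult_mult module_smult_add_right module_smult lcomb_closed\<close>)

text \<open>Image of the list in the free module on \<open>'a\<close>: order and repetition of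
  entries are forgotten, while \<open>lcomb\<close> evaluates in the actual module.\<close>

definition formal :: "('r::comm_ring_1 \<times> 'a) list \<Rightarrow> 'a \<Rightarrow> 'r" where
  "formal xs y = (\<Sum>(c, x)\<leftarrow>xs. c * delta x y)"

lemma formal_simps [simp]:
  "formal [] y = 0" "formal ((c, x) # xs) y = c * delta x y + formal xs y"
  "formal (xs @ ys) y = formal xs y + formal ys y"
  by (simp_all add: formal_def)

lemma formal_scale: "formal (map (\<lambda>(c, x). (r * c, x)) xs) y = r * formal xs y"
  by (induction xs) (auto simp: algebra_simps)

lemma formal_filter: "formal (filter (\<lambda>(c, x). x \<noteq> a) xs) y = (if y = a then 0 else formal xs y)"
  by (induction xs) (auto simp: delta_def)

text \<open>When \<open>a\<close> occurs in the list, gathering all its occurrences leaves a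
  strictly shorter rest; this drives the induction in \<open>lcomb_eq_zero\<close>, where only total
  coefficients are known.\<close>

lemma lcomb_split:
  assumes "module_at A p" "snd ` set xs \<subseteq> cset A p" "a \<in> cset A p"
  shows "lcomb A p xs =
    cadd A p (csmult A p (formal xs a) a) (lcomb A p (filter (\<lambda>(c, x). x \<noteq> a) xs))"
  using assms(2)
proof (induction xs)
  case Nil
  then show ?case
    using assms by (simp add: module_smult_zero module_add_zero_left module_zero)
next
  case (Cons cx xs)
  obtain c x where [simp]: "cx = (c, x)" by (cases cx)
  have xs: "snd ` set (filter (\<lambda>(c, x). x \<noteq> a) xs) \<subseteq> cset A p" "snd ` set xs \<subseteq> cset A p" "x \<in> cset A p"
    using Cons.prems by auto
  note cl = lcomb_closed[OF assms(1) xs(1)] module_smult[OF assms(1)] module_add[OF assms(1)] assms(3) xs(3)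
  show ?case
  proof (cases "x = a")
    case True
    then show ?thesis
      using Cons.IH[OF xs(2)] cl
      by (simp add: delta_def module_smult_add_left[OF assms(1)] module_add_assoc[OF assms(1)])
  next
    case False
    then show ?thesis
      using Cons.IH[OF xs(2)] cl
      by (simp add: delta_def module_add_left_commute[OF assms(1)])
  qed
qed

text \<open>Induction on length: the occurrences of the head vector have total coefficient zero, so
  they drop out together and a shorter list with vanishing formal sum remains.\<close>

lemma lcomb_eq_zero:
  assumes "module_at A p"
  shows "snd ` set xs \<subseteq> cset A p \<Longrightarrow> (\<And>y. formal xs y = 0) \<Longrightarrow> lcomb A p xs = czero A p"
proof (induction xs rule: length_induct)
  case (1 xs)
  show ?case
  proof (cases xs)
    case Nil
    then show ?thesis by simp
  next
    case (Cons cx xs')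
    obtain c a where [simp]: "cx = (c, a)" by (cases cx)
    let ?ys = "filter (\<lambda>(c, x). x \<noteq> a) xs"
    have a: "a \<in> cset A p" using 1 Cons by auto
    have "length ?ys < length xs"
      using Cons by (auto simp: less_Suc_eq_le)
    moreover have "snd ` set ?ys \<subseteq> cset A p" using 1 by auto
    moreover have "formal ?ys y = 0" for y
      using 1 by (auto simp: formal_filter)
    ultimately have "lcomb A p ?ys = czero A p" using "1.IH" by blast
    then show ?thesis
      using lcomb_split[OF assms(1) "1.prems"(1) a] 1 a assms
      by (simp add: module_smult_zero module_add_zero_left module_zero)
  qed
qed

text \<open>Proof by reflection: via \<open>fval\<close>, equality of two linear combinations becomes an identity between
  their formal sums, which takes values in the ring \<^typ>\<open>'r\<close> and is thus open to the simplifier.\<close>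

inductive fval :: "('r::comm_ring_1, 'a) cx \<Rightarrow> int \<Rightarrow> ('a \<Rightarrow> 'r) \<Rightarrow> 'a \<Rightarrow> bool" for A p where
  fval_zero: "fval A p (\<lambda>_. 0) (czero A p)"
| fval_add: "fval A p f x \<Longrightarrow> fval A p g y \<Longrightarrow> fval A p (\<lambda>z. f z + g z) (cadd A p x y)"
| fval_smult: "fval A p f x \<Longrightarrow> fval A p (\<lambda>z. r * f z) (csmult A p r x)"
| fval_atom: "x \<in> cset A p \<Longrightarrow> fval A p (delta x) x"

lemma fval_lcomb:
  assumes "module_at A p" "fval A p f x"
  shows "\<exists>xs. snd ` set xs \<subseteq> cset A p \<and> x = lcomb A p xs \<and> f = formal xs"
  using assms(2)
proof induction
  case fval_zero
  show ?case by (intro exI[of _ "[]"]) auto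
next
  case (fval_add f x g y)
  then obtain xs ys where "snd ` set xs \<subseteq> cset A p" "x = lcomb A p xs" "f = formal xs"
    "snd ` set ys \<subseteq> cset A p" "y = lcomb A p ys" "g = formal ys" by blast
  then show ?case
    by (intro exI[of _ "xs @ ys"]) (auto simp: lcomb_append[OF assms(1)] fun_eq_iff)
next
  case (fval_smult f x r)
  then obtain xs where "snd ` set xs \<subseteq> cset A p" "x = lcomb A p xs" "f = formal xs" by blast
  then show ?case
    by (intro exI[of _ "map (\<lambda>(c, x). (r * c, x)) xs"])
       (force simp: lcomb_scale[OF assms(1)] formal_scale)
next
  case (fval_atom x)
  then show ?case
    by (intro exI[of _ "[(1, x)]"])
       (auto simp: fun_eq_iff module_smult_one[OF assms(1)] module_add_zero_right[OF assms(1)])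
qed

text \<open>The records offer no subtraction, so the difference is formed with the scalar -1:
  joining one list to the negated other gives formal sum zero, hence value zero.\<close>

lemma fval_unique:
  assumes "module_at A p" "fval A p f x" "fval A p g y" "\<And>z. f z = g z"
  shows "x = y"
proof -
  note m = assms(1)
  obtain xs ys where xs: "snd ` set xs \<subseteq> cset A p" "x = lcomb A p xs" "f = formal xs"
    and ys: "snd ` set ys \<subseteq> cset A p" "y = lcomb A p ys" "g = formal ys"
    using fval_lcomb assms by metis
  have x: "x \<in> cset A p" and y: "y \<in> cset A p" using xs ys lcomb_closed m by auto
  let ?zs = "xs @ map (\<lambda>(c, x). (-1 * c, x)) ys"
  have ys': "snd ` set (map (\<lambda>(c, x). (-1 * c, x)) ys) \<subseteq> cset A p" using ys by force
  have "lcomb A p ?zs = czero A p"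
  proof (rule lcomb_eq_zero[OF m])
    show "snd ` set ?zs \<subseteq> cset A p"
      using xs(1) ys' unfolding set_append image_Un by blast
    show "formal ?zs z = 0" for z
      unfolding formal_simps formal_scale using xs(3) ys(3) assms(4)[of z] by simp
  qed
  then have "cadd A p x (csmult A p (-1) y) = czero A p"
    unfolding lcomb_append[OF m xs(1) ys'] lcomb_scale[OF m ys(1)] xs(2) ys(2) .
  moreover have "cadd A p (csmult A p (-1) y) y = czero A p"
    using module_smult_add_left[OF m y, of "-1" 1] y m by (simp add: module_smult_one module_smult_zero)
  ultimately show ?thesis
    using module_add_assoc[OF m x _ y, of "csmult A p (-1) y"] m x y
    by (simp add: module_smult module_add_zero_left module_add_zero_right)
qed

section \<open>Linear maps\<close>

lemma linmap_closed: "linmap A p B q f \<Longrightarrow> x \<in> cset A p \<Longrightarrow> f x \<in> cset B q"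
  and linmap_add: "linmap A p B q f \<Longrightarrow> x \<in> cset A p \<Longrightarrow> y \<in> cset A p \<Longrightarrow>
        f (cadd A p x y) = cadd B q (f x) (f y)"
  and linmap_smult: "linmap A p B q f \<Longrightarrow> x \<in> cset A p \<Longrightarrow> f (csmult A p r x) = csmult B q r (f x)"
  by (auto simp: linmap_def)

lemma linmap_zero:
  assumes "module_at A p" "module_at B q" "linmap A p B q f"
  shows "f (czero A p) = czero B q"
  by (metis assms linmap_closed linmap_smult module_smult_zero module_zero)

lemma linmap_comp: "linmap A p B q f \<Longrightarrow> linmap B q C r g \<Longrightarrow> linmap A p C r (\<lambda>x. g (f x))"
  by (simp add: linmap_def)

lemma linmap_plus:
  assumes "module_at A p" "module_at B q" "linmap A p B q f" "linmap A p B q g"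
  shows "linmap A p B q (\<lambda>x. cadd B q (f x) (g x))"
proof -
  note m = assms(2)
  note cl = linmap_closed[OF assms(3)] linmap_closed[OF assms(4)] 
  show ?thesis
    unfolding linmap_def using assms(3,4) cl
    by (auto simp: linmap_add linmap_smult module_add[OF m] module_smult[OF m]
        module_smult_add_right[OF m] module_add_assoc[OF m] module_add_left_commute[OF m])
qed

lemma linmap_scale:
  assumes "module_at A p" "module_at B q" "linmap A p B q f"
  shows "linmap A p B q (\<lambda>x. csmult B q r (f x))"
proof -
  note m = assms(2)
  note cl = linmap_closed[OF assms(3)]
  show ?thesis
    unfolding linmap_def using assms(3) cl
    by (auto simp: linmap_add linmap_smult module_smult[OF m] module_smult_add_right[OF m]
        simp flip: module_smult_mult[OF m]) (simp add: mult.commute)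
qed

lemma linmap_const_zero:
  "module_at A p \<Longrightarrow> module_at B q \<Longrightarrow> linmap A p B q (\<lambda>_. czero B q)"
  by (simp add: linmap_def module_zero module_add_zero_left module_smult_czero)

lemma linmap_ident: "linmap A p A p (\<lambda>x. x)"
  by (simp add: linmap_def)

lemma chain_complex_module: "chain_complex A \<Longrightarrow> module_at A p"
  and chain_complex_linmap: "chain_complex A \<Longrightarrow> linmap A p A (p - 1) (cd A p)"
  and chain_complex_dd: "chain_complex A \<Longrightarrow> x \<in> cset A p \<Longrightarrow> cd A (p - 1) (cd A p x) = czero A (p - 2)"
  by (simp_all add: chain_complex_def)

section \<open>Finitely supported functions\<close>

lemma supp_zero [simp]: "supp (\<lambda>_. 0) = {}"
  by (simp add: supp_def)

lemma supp_delta [simp]: "supp (delta x :: 'i \<Rightarrow> 'r::comm_ring_1) = {x}"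
  by (auto simp: supp_def delta_def)

lemma supp_add_subset: "supp (\<lambda>x. f x + g x :: 'r::comm_ring_1) \<subseteq> supp f \<union> supp g"
  by (auto simp: supp_def)

lemma finite_supp_add: "finite (supp f) \<Longrightarrow> finite (supp g) \<Longrightarrow> finite (supp (\<lambda>x. f x + g x :: 'r::comm_ring_1))"
  by (rule finite_subset[of _ "supp f \<union> supp g"]) (auto simp: supp_def)

lemma finite_supp_diff: "finite (supp f) \<Longrightarrow> finite (supp g) \<Longrightarrow> finite (supp (\<lambda>x. f x - g x :: 'r::comm_ring_1))"
  by (rule finite_subset[of _ "supp f \<union> supp g"]) (auto simp: supp_def)

lemma finite_supp_mult: "finite (supp f) \<Longrightarrow> finite (supp (\<lambda>x. r * f x :: 'r::comm_ring_1))"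
  by (rule finite_subset[of _ "supp f"]) (auto simp: supp_def)

text \<open>The support changes under addition and scaling; summing over a common finite superset
  makes the values of \<open>lext\<close> comparable.\<close>

lemma lext_superset:
  assumes "finite S" "supp h \<subseteq> S"
  shows "lext F h y = (\<Sum>x\<in>S. h x * F x y)"
  unfolding lext_def using assms by (intro sum.mono_neutral_left) (auto simp: supp_def)

lemma lext_zero [simp]: "lext F (\<lambda>_. 0) = (\<lambda>_. 0)"
  by (simp add: lext_def)

lemma lext_delta [simp]: "lext F (delta x) = F x"
  by (simp add: lext_def) (simp add: delta_def)

lemma lext_add:
  assumes "finite (supp f)" "finite (supp g)"
  shows "lext F (\<lambda>x. f x + g x) = (\<lambda>y. lext F f y + lext F g y)"
proof
  fix y
  let ?S = "supp f \<union> supp g"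
  have "supp (\<lambda>x. f x + g x) \<subseteq> ?S" by (auto simp: supp_def)
  then show "lext F (\<lambda>x. f x + g x) y = lext F f y + lext F g y"
    using assms
    by (simp add: lext_superset[of ?S] sum.distrib algebra_simps)
qed

lemma lext_mult:
  assumes "finite (supp f)"
  shows "lext F (\<lambda>x. r * f x) = (\<lambda>y. r * lext F f y)"
proof
  fix y
  have "supp (\<lambda>x. r * f x) \<subseteq> supp f" by (auto simp: supp_def)
  then show "lext F (\<lambda>x. r * f x) y = r * lext F f y"
    using assms
    by (simp add: lext_superset[of "supp f"] sum_distrib_left mult.assoc)
qed

lemma lext_diff:
  assumes "finite (supp f)" "finite (supp g)"
  shows "lext F (\<lambda>x. f x - g x) = (\<lambda>y. lext F f y - lext F g y)"
  using lext_add[OF assms(1) finite_supp_mult[OF assms(2), of "-1"], of F] lext_mult[OF assms(2), of F "-1"]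
  by simp

section \<open>The tensor product\<close>

lemma tfree_zero: "(\<lambda>_. 0) \<in> tfree A B p"
  by (simp add: tfree_def)

lemma tfree_add: "f \<in> tfree A B p \<Longrightarrow> g \<in> tfree A B p \<Longrightarrow> (\<lambda>x. f x + g x) \<in> tfree A B p"
  using supp_add_subset[of f g] by (auto simp: tfree_def finite_supp_add)

lemma tfree_mult: "f \<in> tfree A B p \<Longrightarrow> (\<lambda>x. r * f x) \<in> tfree A B p"
  by (auto simp: tfree_def finite_supp_mult) (auto simp: supp_def)

lemma tfree_diff: "f \<in> tfree A B p \<Longrightarrow> g \<in> tfree A B p \<Longrightarrow> (\<lambda>x. f x - g x) \<in> tfree A B p"
  using tfree_add[OF _ tfree_mult, of f A B p g "-1"] by simp

lemma tfree_delta: "a \<in> cset A i \<Longrightarrow> b \<in> cset B (p - i) \<Longrightarrow> delta (i, a, b) \<in> tfree A B p"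
  by (simp add: tfree_def tgens_def)

lemma tfree_finite: "f \<in> tfree A B p \<Longrightarrow> finite (supp f)"
  by (simp add: tfree_def)

text \<open>Separates the module axioms from the differential, since the tensor product must be
  understood as a module before its differential is known to be well defined.\<close>

definition modules :: "('r::comm_ring_1, 'a) cx \<Rightarrow> bool" where
  "modules A \<longleftrightarrow> (\<forall>p. module_at A p)"

lemma chain_complex_modules: "chain_complex A \<Longrightarrow> modules A"
  by (simp add: chain_complex_def modules_def)

lemma modulesD: "modules A \<Longrightarrow> module_at A p"
  by (simp add: modules_def)

lemma tker_tfree:
  assumes "modules A" "modules B"
  shows "f \<in> tker A B p \<Longrightarrow> f \<in> tfree A B p"
  by (induction rule: tker.induct)
     (auto intro!: tfree_zero tfree_add tfree_mult tfree_diff tfree_delta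
        module_add module_smult modulesD assms)

lemma tker_uminus: "f \<in> tker A B p \<Longrightarrow> (\<lambda>x. - f x) \<in> tker A B p"
  using tker.smult[of f A B p "-1"] by simp

lemma tker_diff_trans:
  assumes "(\<lambda>x. f x - g x) \<in> tker A B p" "(\<lambda>x. g x - h x) \<in> tker A B p"
  shows "(\<lambda>x. f x - h x) \<in> tker A B p"
  using tker.add[OF assms] by simp

lemma tker_diff_commute:
  "(\<lambda>x. f x - g x) \<in> tker A B p \<Longrightarrow> (\<lambda>x. g x - f x) \<in> tker A B p"
  using tker_uminus by fastforce

lemma tclass_eq_iff:
  assumes "f \<in> tfree A B p" "g \<in> tfree A B p"
  shows "tclass A B p f = tclass A B p g \<longleftrightarrow> (\<lambda>x. f x - g x) \<in> tker A B p"
proof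
  assume "tclass A B p f = tclass A B p g"
  moreover have "f \<in> tclass A B p f" using assms by (simp add: tclass_def tker.zero)
  ultimately show "(\<lambda>x. f x - g x) \<in> tker A B p" by (simp add: tclass_def)
next
  assume *: "(\<lambda>x. f x - g x) \<in> tker A B p"
  show "tclass A B p f = tclass A B p g"
    unfolding tclass_def using tker_diff_trans * tker_diff_commute by blast
qed

lemma rep_tclass:
  assumes "f \<in> tfree A B p"
  shows "rep (tclass A B p f) \<in> tfree A B p"
    and "(\<lambda>x. rep (tclass A B p f) x - f x) \<in> tker A B p"
proof -
  have "f \<in> tclass A B p f" using assms by (simp add: tclass_def tker.zero)
  then have "rep (tclass A B p f) \<in> tclass A B p f" unfolding rep_def by (rule someI[of "\<lambda>g. g \<in> tclass A B p f"])
  then show "rep (tclass A B p f) \<in> tfree A B p"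
    and "(\<lambda>x. rep (tclass A B p f) x - f x) \<in> tker A B p" by (auto simp: tclass_def)
qed

lemma tclass_rep:
  assumes "X \<in> cset (tensor A B) p"
  shows "rep X \<in> tfree A B p" "tclass A B p (rep X) = X"
proof -
  obtain f where f: "f \<in> tfree A B p" "X = tclass A B p f" using assms by (auto simp: tensor_def)
  then show "rep X \<in> tfree A B p" "tclass A B p (rep X) = X"
    using rep_tclass[OF f(1)] by (auto simp: tclass_eq_iff)
qed

lemma tclass_in_tensor: "f \<in> tfree A B p \<Longrightarrow> tclass A B p f \<in> cset (tensor A B) p"
  by (simp add: tensor_def)

lemma tensor_zero: "czero (tensor A B) p = tclass A B p (\<lambda>_. 0)"
  by (simp add: tensor_def)

lemma tensor_add:
  assumes "f \<in> tfree A B p" "g \<in> tfree A B p"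
  shows "cadd (tensor A B) p (tclass A B p f) (tclass A B p g) = tclass A B p (\<lambda>x. f x + g x)"
proof -
  have "(\<lambda>x. (rep (tclass A B p f) x - f x) + (rep (tclass A B p g) x - g x)) \<in> tker A B p"
    using assms by (intro tker.add rep_tclass)
  then show ?thesis
    using assms by (simp add: tensor_def tclass_eq_iff tfree_add rep_tclass algebra_simps)
qed

lemma tensor_smult:
  assumes "f \<in> tfree A B p"
  shows "csmult (tensor A B) p r (tclass A B p f) = tclass A B p (\<lambda>x. r * f x)"
proof -
  have "(\<lambda>x. r * (rep (tclass A B p f) x - f x)) \<in> tker A B p"
    using assms by (intro tker.smult rep_tclass)
  then show ?thesis
    using assms by (simp add: tensor_def tclass_eq_iff tfree_mult rep_tclass algebra_simps)
qed

lemma tensor_elim: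
  assumes "X \<in> cset (tensor A B) p"
  obtains f where "f \<in> tfree A B p" "X = tclass A B p f"
  using assms by (auto simp: tensor_def)

lemma modules_tensor: "modules (tensor A B)"
  unfolding modules_def module_at_def Let_def
  by (intro allI conjI ballI; (elim tensor_elim)?)
     (auto simp: tensor_add tensor_smult tensor_zero tfree_add tfree_mult tfree_zero tclass_in_tensor
        algebra_simps)

lemma tens_in_tensor:
  "a \<in> cset A i \<Longrightarrow> b \<in> cset B j \<Longrightarrow> tens A B i j a b \<in> cset (tensor A B) (i + j)"
  by (simp add: tens_def tclass_in_tensor tfree_delta)

lemma tens_add_left:
  assumes "modules A" "modules B" "a \<in> cset A i" "a' \<in> cset A i" "b \<in> cset B j"
  shows "tens A B i j (cadd A i a a') b = cadd (tensor A B) (i + j) (tens A B i j a b) (tens A B i j a' b)"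
  using tker.ladd[of a A i a' b B "i + j"] assms
  by (simp add: tens_def tensor_add tclass_eq_iff tfree_delta tfree_add modulesD module_add algebra_simps)

lemma tens_add_right:
  assumes "modules A" "modules B" "a \<in> cset A i" "b' \<in> cset B j" "b \<in> cset B j"
  shows "tens A B i j a (cadd B j b b') = cadd (tensor A B) (i + j) (tens A B i j a b) (tens A B i j a b')"
  using tker.radd[of a A i b B "i + j" b'] assms
  by (simp add: tens_def tensor_add tclass_eq_iff tfree_delta tfree_add modulesD module_add algebra_simps)

lemma tens_smult_left:
  assumes "modules A" "modules B" "a \<in> cset A i" "b \<in> cset B j"
  shows "tens A B i j (csmult A i r a) b = csmult (tensor A B) (i + j) r (tens A B i j a b)"
  using tker.lsm[of a A i b B "i + j"] assms
  by (simp add: tens_def tensor_smult tclass_eq_iff tfree_delta tfree_mult modulesD module_smult)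

lemma tens_smult_right:
  assumes "modules A" "modules B" "a \<in> cset A i" "b \<in> cset B j"
  shows "tens A B i j a (csmult B j r b) = csmult (tensor A B) (i + j) r (tens A B i j a b)"
  using tker.rsm[of a A i b B "i + j"] assms
  by (simp add: tens_def tensor_smult tclass_eq_iff tfree_delta tfree_mult modulesD module_smult)

lemma linmap_tens_left:
  "modules A \<Longrightarrow> modules B \<Longrightarrow> b \<in> cset B j \<Longrightarrow> linmap A i (tensor A B) (i + j) (\<lambda>a. tens A B i j a b)"
  by (simp add: linmap_def tens_in_tensor tens_add_left tens_smult_left)

lemma linmap_tens_right:
  "modules A \<Longrightarrow> modules B \<Longrightarrow> a \<in> cset A i \<Longrightarrow> linmap B j (tensor A B) (i + j) (\<lambda>b. tens A B i j a b)"
  by (simp add: linmap_def tens_in_tensor tens_add_right tens_smult_right)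

text \<open>Every class has a finitely supported representative, and induction on the support peels
  off one generator with its coefficient. The generator case offers degrees with
  \<open>i + j = p\<close> instead of \<open>i\<close> and \<open>p - i\<close>, the form in which
  \<open>tens\<close> is used later.\<close>

lemma tensor_induct [consumes 1, case_names zero add smult tens]:
  fixes A :: "('r::comm_ring_1, 'a) cx" and B :: "('r, 'b) cx"
  assumes X: "X \<in> cset (tensor A B) p"
    and zero: "P (czero (tensor A B) p)"
    and add: "\<And>X Y. X \<in> cset (tensor A B) p \<Longrightarrow> Y \<in> cset (tensor A B) p \<Longrightarrow> P X \<Longrightarrow> P Y
       \<Longrightarrow> P (cadd (tensor A B) p X Y)"
    and smult: "\<And>r X. X \<in> cset (tensor A B) p \<Longrightarrow> P X \<Longrightarrow> P (csmult (tensor A B) p r X)"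
    and tens: "\<And>i j a b. i + j = p \<Longrightarrow> a \<in> cset A i \<Longrightarrow> b \<in> cset B j \<Longrightarrow> P (tens A B i j a b)"
  shows "P X"
proof -
  have "\<forall>f. f \<in> tfree A B p \<longrightarrow> supp f = S \<longrightarrow> P (tclass A B p f)" if "finite S" for S
    using that
  proof (induction S)
    case empty
    have "f = (\<lambda>_. 0)" if "supp f = {}" for f :: "int \<times> 'a \<times> 'b \<Rightarrow> 'r"
      using that by (auto simp: supp_def)
    then show ?case using zero by (metis tensor_zero)
  next
    case (insert x S)
    show ?case
    proof (intro allI impI)
      fix f assume f: "f \<in> tfree A B p" "supp f = insert x S"
      obtain i a b where x: "x = (i, a, b)" by (cases x)
      have ab: "a \<in> cset A i" "b \<in> cset B (p - i)" using f x by (auto simp: tfree_def tgens_def)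
      let ?g = "\<lambda>y. if y = x then 0 else f y"
      have "supp ?g = S" using f(2) insert.hyps by (auto simp: supp_def)
      moreover have g: "?g \<in> tfree A B p" using f calculation insert.hyps by (auto simp: tfree_def)
      ultimately have Pg: "P (tclass A B p ?g)" using insert.IH by blast
      have d: "delta x \<in> tfree A B p" using ab x by (simp add: tfree_delta)
      have "P (tclass A B p (delta x))" using tens[of i "p - i" a b] ab x by (simp add: tens_def)
      then have "P (csmult (tensor A B) p (f x) (tclass A B p (delta x)))"
        by (intro smult tclass_in_tensor d)
      then have "P (tclass A B p (\<lambda>y. f x * delta x y))" by (simp add: tensor_smult d)
      then have "P (cadd (tensor A B) p (tclass A B p (\<lambda>y. f x * delta x y)) (tclass A B p ?g))"
        by (intro add tclass_in_tensor tfree_mult d g Pg)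
      then have "P (tclass A B p (\<lambda>y. f x * delta x y + ?g y))" by (simp add: tensor_add tfree_mult d g)
      moreover have "(\<lambda>y. f x * delta x y + ?g y) = f" by (auto simp: delta_def)
      ultimately show "P (tclass A B p f)" by simp
    qed
  qed
  then show ?thesis using X by (metis tensor_elim tfree_finite)
qed

lemma linmap_tensor_eqI:
  assumes "X \<in> cset (tensor A B) p" "module_at C q"
    and F: "linmap (tensor A B) p C q F" and G: "linmap (tensor A B) p C q G"
    and tens: "\<And>i j a b. i + j = p \<Longrightarrow> a \<in> cset A i \<Longrightarrow> b \<in> cset B j \<Longrightarrow>
      F (tens A B i j a b) = G (tens A B i j a b)"
  shows "F X = G X"
  using assms(1)
proof (induction rule: tensor_induct)
  case zero
  show ?case using linmap_zero[OF modulesD[OF modules_tensor] assms(2)] F G by metis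
qed (use tens F G in \<open>auto simp: linmap_add linmap_smult\<close>)

text \<open>Bilinearity, required of representatives modulo \<open>tker\<close> rather than of
  classes, because \<open>cd\<close> of a tensor product, \<open>tmap\<close> and
  \<open>tassoc\<close> all extend a function on generators by \<open>lext\<close> and only then
  take a class.\<close>

definition balanced where
  "balanced A B p A' B' q F \<longleftrightarrow>
     (\<forall>i a b. a \<in> cset A i \<longrightarrow> b \<in> cset B (p - i) \<longrightarrow> F (i, a, b) \<in> tfree A' B' q) \<and>
     (\<forall>i a a' b. a \<in> cset A i \<longrightarrow> a' \<in> cset A i \<longrightarrow> b \<in> cset B (p - i) \<longrightarrow>
        (\<lambda>x. F (i, cadd A i a a', b) x - F (i, a, b) x - F (i, a', b) x) \<in> tker A' B' q) \<and>
     (\<forall>i a b b'. a \<in> cset A i \<longrightarrow> b \<in> cset B (p - i) \<longrightarrow> b' \<in> cset B (p - i) \<longrightarrow>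
        (\<lambda>x. F (i, a, cadd B (p - i) b b') x - F (i, a, b) x - F (i, a, b') x) \<in> tker A' B' q) \<and>
     (\<forall>i r a b. a \<in> cset A i \<longrightarrow> b \<in> cset B (p - i) \<longrightarrow>
        (\<lambda>x. F (i, csmult A i r a, b) x - r * F (i, a, b) x) \<in> tker A' B' q) \<and>
     (\<forall>i r a b. a \<in> cset A i \<longrightarrow> b \<in> cset B (p - i) \<longrightarrow>
        (\<lambda>x. F (i, a, csmult B (p - i) r b) x - r * F (i, a, b) x) \<in> tker A' B' q)"

lemma lext_tfree:
  assumes "balanced A B p A' B' q F" "f \<in> tfree A B p"
  shows "lext F f \<in> tfree A' B' q"
proof -
  have "(\<lambda>y. \<Sum>x\<in>S. f x * F x y) \<in> tfree A' B' q" if "finite S" "S \<subseteq> tgens A B p" for S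
    using that
  proof (induction S)
    case empty
    then show ?case by (simp add: tfree_zero)
  next
    case (insert x S)
    then have "F x \<in> tfree A' B' q" using assms(1) by (auto simp: balanced_def tgens_def)
    then show ?case using insert by (auto intro!: tfree_add tfree_mult)
  qed
  then show ?thesis using assms(2) by (simp add: lext_def[abs_def] tfree_def)
qed

lemma lext_tker:
  assumes bal: "balanced A B p A' B' q F" and "modules A" "modules B" "f \<in> tker A B p"
  shows "lext F f \<in> tker A' B' q"
  using assms(4)
proof induction
  case zero
  then show ?case by (simp add: tker.zero)
next
  case (add f g)
  then show ?case using assms by (simp add: lext_add tfree_finite[OF tker_tfree] tker.add)
next
  case (smult f r)
  then show ?case using assms by (simp add: lext_mult tfree_finite[OF tker_tfree] tker.smult)
next
  case (ladd a i a' b)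
  then show ?case using bal by (simp add: lext_diff finite_supp_diff balanced_def)
next
  case (radd a i b b')
  then show ?case using bal by (simp add: lext_diff finite_supp_diff balanced_def)
next
  case (lsm a i b r)
  then show ?case using bal by (simp add: lext_diff lext_mult finite_supp_mult balanced_def)
next
  case (rsm a i b r)
  then show ?case using bal by (simp add: lext_diff lext_mult finite_supp_mult balanced_def)
qed

definition tlift where
  "tlift A' B' q F X = tclass A' B' q (lext F (rep X))"

text \<open>Independence of the choice made by \<open>rep\<close>: the chosen representative differs
  from \<open>f\<close> by an element of \<open>tker\<close>, which \<open>lext\<close> sends into
  the kernel again.\<close>

lemma tlift_tclass:
  assumes "balanced A B p A' B' q F" "modules A" "modules B" "f \<in> tfree A B p"
  shows "tlift A' B' q F (tclass A B p f) = tclass A' B' q (lext F f)"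
proof -
  note r = rep_tclass[OF assms(4)]
  have "lext F (\<lambda>x. rep (tclass A B p f) x - f x) \<in> tker A' B' q"
    by (rule lext_tker[OF assms(1-3) r(2)])
  then show ?thesis
    using assms r(1)
    by (simp add: tlift_def tclass_eq_iff lext_tfree lext_diff tfree_finite)
qed

lemma tlift_tens:
  assumes "balanced A B (i + j) A' B' q F" "modules A" "modules B" "a \<in> cset A i" "b \<in> cset B j"
  shows "tlift A' B' q F (tens A B i j a b) = tclass A' B' q (F (i, a, b))"
  using assms by (simp add: tens_def tlift_tclass tfree_delta)

lemma tlift_linmap:
  assumes "balanced A B p A' B' q F" "modules A" "modules B"
  shows "linmap (tensor A B) p (tensor A' B') q (tlift A' B' q F)"
  unfolding linmap_def
  by (intro conjI ballI allI; elim tensor_elim)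
     (simp_all add: tlift_tclass[OF assms] tclass_in_tensor lext_tfree[OF assms(1)] tensor_add
       tensor_smult tfree_add tfree_mult lext_add lext_mult tfree_finite)

text \<open>In terms of classes the relations modulo \<open>tker\<close> say that each argument
  enters linearly; this can be proved compositionally from the bilinearity of
  \<open>tens\<close>.\<close>

lemma balancedI:
  assumes free: "\<And>i a b. a \<in> cset A i \<Longrightarrow> b \<in> cset B (p - i) \<Longrightarrow> F (i, a, b) \<in> tfree A' B' q"
    and A: "modules A" and B: "modules B"
    and left: "\<And>i b. b \<in> cset B (p - i) \<Longrightarrow> linmap A i (tensor A' B') q (\<lambda>a. tclass A' B' q (F (i, a, b)))"
    and right: "\<And>i a. a \<in> cset A i \<Longrightarrow> linmap B (p - i) (tensor A' B') q (\<lambda>b. tclass A' B' q (F (i, a, b)))"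
  shows "balanced A B p A' B' q F"
  unfolding balanced_def
proof (intro conjI allI impI)
  note [simp] = modulesD[OF A] modulesD[OF B] free module_add module_smult tensor_add tensor_smult
    tclass_eq_iff tfree_add tfree_mult
  show "F (i, a, b) \<in> tfree A' B' q" if "a \<in> cset A i" "b \<in> cset B (p - i)" for i a b
    using that by simp
  show "(\<lambda>x. F (i, cadd A i a a', b) x - F (i, a, b) x - F (i, a', b) x) \<in> tker A' B' q"
    if "a \<in> cset A i" "a' \<in> cset A i" "b \<in> cset B (p - i)" for i a a' b
    using linmap_add[OF left, OF that(3,1,2)] that by (simp add: diff_diff_eq)
  show "(\<lambda>x. F (i, a, cadd B (p - i) b b') x - F (i, a, b) x - F (i, a, b') x) \<in> tker A' B' q"
    if "a \<in> cset A i" "b \<in> cset B (p - i)" "b' \<in> cset B (p - i)" for i a b b'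
    using linmap_add[OF right, OF that] that by (simp add: diff_diff_eq)
  show "(\<lambda>x. F (i, csmult A i r a, b) x - r * F (i, a, b) x) \<in> tker A' B' q"
    if "a \<in> cset A i" "b \<in> cset B (p - i)" for i r a b
    using linmap_smult[OF left, OF that(2,1), of r] that by simp
  show "(\<lambda>x. F (i, a, csmult B (p - i) r b) x - r * F (i, a, b) x) \<in> tker A' B' q"
    if "a \<in> cset A i" "b \<in> cset B (p - i)" for i r a b
    using linmap_smult[OF right, OF that, of r] that by simp
qed

section \<open>The tensor product complex\<close>

lemma sgnpow_simps [simp]:
  "sgnpow 0 = 1" "sgnpow 1 = - 1" "sgnpow (- i) = sgnpow i" "sgnpow (2 * i) = 1" "sgnpow (i * 2) = 1"
  "sgnpow (numeral (Num.Bit0 k)) = 1" "sgnpow (numeral (Num.Bit1 k)) = - 1"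
  by (simp_all add: sgnpow_def)

lemma sgnpow_add: "sgnpow (i + j) = sgnpow i * sgnpow j"
  by (simp add: sgnpow_def)

lemma sgnpow_diff: "sgnpow (i - j) = sgnpow i * sgnpow j"
  by (simp add: sgnpow_def)

lemma sgnpow_square [simp]: "sgnpow i * sgnpow i = 1" "sgnpow i * (sgnpow i * r) = r"
  by (simp_all add: sgnpow_def)

lemma tclass_delta: "tclass A B p (delta (i, a, b)) = tens A B i (p - i) a b"
  by (simp add: tens_def)

lemma linmap_cong:
  "(\<And>x. x \<in> cset A p \<Longrightarrow> f x = g x) \<Longrightarrow> module_at A p \<Longrightarrow> linmap A p B q f \<longleftrightarrow> linmap A p B q g"
  by (simp add: linmap_def module_add module_smult)

lemma linmap_tens_left':
  "modules A \<Longrightarrow> modules B \<Longrightarrow> b \<in> cset B j \<Longrightarrow> i + j = p \<Longrightarrow> linmap A i (tensor A B) p (\<lambda>a. tens A B i j a b)"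
  by (metis linmap_tens_left)

lemma linmap_tens_right':
  "modules A \<Longrightarrow> modules B \<Longrightarrow> a \<in> cset A i \<Longrightarrow> i + j = p \<Longrightarrow> linmap B j (tensor A B) p (\<lambda>b. tens A B i j a b)"
  by (metis linmap_tens_right)

lemma tens_in_tensor':
  "a \<in> cset A i \<Longrightarrow> b \<in> cset B j \<Longrightarrow> i + j = p \<Longrightarrow> tens A B i j a b \<in> cset (tensor A B) p"
  by (metis tens_in_tensor)

lemma tens_zero_left:
  "modules A \<Longrightarrow> modules B \<Longrightarrow> b \<in> cset B j \<Longrightarrow> i + j = p \<Longrightarrow> tens A B i j (czero A i) b = czero (tensor A B) p"
  by (rule linmap_zero[OF modulesD modulesD linmap_tens_left']) (auto simp: modules_tensor)

lemma tens_zero_right: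
  "modules A \<Longrightarrow> modules B \<Longrightarrow> a \<in> cset A i \<Longrightarrow> i + j = p \<Longrightarrow> tens A B i j a (czero B j) = czero (tensor A B) p"
  by (rule linmap_zero[OF modulesD modulesD linmap_tens_right']) (auto simp: modules_tensor)

lemma cd_closed: "chain_complex A \<Longrightarrow> a \<in> cset A p \<Longrightarrow> cd A p a \<in> cset A (p - 1)"
  by (rule linmap_closed[OF chain_complex_linmap])

lemma tclass_tdgen:
  assumes "chain_complex A" "chain_complex B" "a \<in> cset A i" "b \<in> cset B (p - i)"
  shows "tclass A B (p - 1) (tdgen A B p (i, a, b)) =
    cadd (tensor A B) (p - 1) (tens A B (i - 1) (p - i) (cd A i a) b)
      (csmult (tensor A B) (p - 1) (sgnpow i) (tens A B i (p - i - 1) a (cd B (p - i) b)))"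
proof -
  have "cd A i a \<in> cset A (i - 1)" "cd B (p - i) b \<in> cset B (p - 1 - i)"
    using cd_closed[OF assms(1,3)] cd_closed[OF assms(2,4)] by (simp_all add: algebra_simps)
  then have "delta (i - 1, cd A i a, b) \<in> tfree A B (p - 1)" "delta (i, a, cd B (p - i) b) \<in> tfree A B (p - 1)"
    using assms by (auto intro!: tfree_delta simp: algebra_simps)
  then show ?thesis
    unfolding tdgen_def prod.case
    by (subst tensor_add[symmetric])
       (simp_all add: tfree_mult tensor_smult[symmetric] tclass_delta algebra_simps)
qed

lemma balanced_tdgen:
  assumes A: "chain_complex A" and B: "chain_complex B"
  shows "balanced A B p A B (p - 1) (tdgen A B p)"
proof (rule balancedI)
  note m = chain_complex_modules[OF A] chain_complex_modules[OF B]
  show "modules A" "modules B" by fact+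
  note mt = modulesD[OF modules_tensor] modulesD[OF m(1)] modulesD[OF m(2)]
  fix i
  have eq: "p - 1 - i = p - i - 1" by simp
  show "tdgen A B p (i, a, b) \<in> tfree A B (p - 1)" if "a \<in> cset A i" "b \<in> cset B (p - i)" for a b
    using that cd_closed[OF A] cd_closed[OF B] unfolding tdgen_def prod.case
    by (intro tfree_add tfree_mult tfree_delta) (auto simp: eq)
  show "linmap A i (tensor A B) (p - 1) (\<lambda>a. tclass A B (p - 1) (tdgen A B p (i, a, b)))"
    if "b \<in> cset B (p - i)" for b
  proof (subst linmap_cong[OF tclass_tdgen[OF A B]])
    show "linmap A i (tensor A B) (p - 1) (\<lambda>x. cadd (tensor A B) (p - 1) (tens A B (i - 1) (p - i) (cd A i x) b)
         (csmult (tensor A B) (p - 1) (sgnpow i) (tens A B i (p - i - 1) x (cd B (p - i) b))))"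
      using that cd_closed[OF B]
      by (intro linmap_plus linmap_scale linmap_comp[OF chain_complex_linmap[OF A] linmap_tens_left']
           linmap_tens_left' m mt) auto
  qed (use that mt in auto)
  show "linmap B (p - i) (tensor A B) (p - 1) (\<lambda>b. tclass A B (p - 1) (tdgen A B p (i, a, b)))"
    if "a \<in> cset A i" for a
  proof (subst linmap_cong[OF tclass_tdgen[OF A B]])
    show "linmap B (p - i) (tensor A B) (p - 1) (\<lambda>b. cadd (tensor A B) (p - 1) (tens A B (i - 1) (p - i) (cd A i a) b)
         (csmult (tensor A B) (p - 1) (sgnpow i) (tens A B i (p - i - 1) a (cd B (p - i) b))))"
      using that cd_closed[OF A]
      by (intro linmap_plus linmap_scale linmap_comp[OF chain_complex_linmap[OF B] linmap_tens_right']
           linmap_tens_right' m mt) auto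
  qed (use that mt in auto)
qed

lemma cd_tensor: "cd (tensor A B) p = tlift A B (p - 1) (tdgen A B p)"
  by (simp add: tensor_def tlift_def fun_eq_iff)

lemma cd_tens:
  assumes "chain_complex A" "chain_complex B" "a \<in> cset A i" "b \<in> cset B j"
  shows "cd (tensor A B) (i + j) (tens A B i j a b) =
    cadd (tensor A B) (i + j - 1) (tens A B (i - 1) j (cd A i a) b)
      (csmult (tensor A B) (i + j - 1) (sgnpow i) (tens A B i (j - 1) a (cd B j b)))"
  using tclass_tdgen[of A B a i b "i + j"] assms balanced_tdgen[OF assms(1,2)]
  by (simp add: cd_tensor tlift_tens chain_complex_modules)

lemma chain_complex_tensor [simp]:
  assumes A: "chain_complex A" and B: "chain_complex B"
  shows "chain_complex (tensor A B)"
  unfolding chain_complex_def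
proof (intro allI conjI ballI)
  note m = chain_complex_modules[OF A] chain_complex_modules[OF B]
  note mt = modulesD[OF modules_tensor] modulesD[OF m(1)] modulesD[OF m(2)]
  let ?T = "tensor A B"
  show "module_at ?T p" for p by (rule mt)
  show lin: "linmap ?T p ?T (p - 1) (cd ?T p)" for p
    unfolding cd_tensor by (intro tlift_linmap balanced_tdgen assms m)
  show "cd ?T (p - 1) (cd ?T p X) = czero ?T (p - 2)" if "X \<in> cset ?T p" for p X
    using that
  proof (rule linmap_tensor_eqI[where F = "\<lambda>X. cd ?T (p - 1) (cd ?T p X)"])
    show "linmap ?T p ?T (p - 2) (\<lambda>X. cd ?T (p - 1) (cd ?T p X))"
      using linmap_comp[OF lin lin, of p] by (simp add: algebra_simps)
    show "linmap ?T p ?T (p - 2) (\<lambda>X. czero ?T (p - 2))" by (intro linmap_const_zero mt)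
    fix i j a b assume p: "i + j = p" and a: "a \<in> cset A i" and b: "b \<in> cset B j"
    note da = cd_closed[OF A a] and db = cd_closed[OF B b]
    have p': "i - 1 + j = p - 1" "i + (j - 1) = p - 1" "i - 1 + (j - 1) = p - 2" 
      "i - 1 - 1 + j = p - 2" "i - 2 + j = p - 2" "i + (j - 1 - 1) = p - 2" "i + (j - 2) = p - 2" 
      "p - 1 - 1 = p - 2" using p by simp_all
    \<comment> \<open>\<open>cd A i a\<close> has degree \<open>i - 1\<close>, so the sign here is
      opposite to the one in the differential of \<open>tens A B i j a b\<close>; this makes the two
      mixed terms cancel.\<close>
    have "cd ?T (p - 1) (tens A B (i - 1) j (cd A i a) b) =
      csmult ?T (p - 2) (- sgnpow i) (tens A B (i - 1) (j - 1) (cd A i a) (cd B j b))"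
      using cd_tens[OF A B da b] a b da db
      by (simp add: p' chain_complex_dd[OF A] tens_zero_left m sgnpow_diff
          module_add_zero_left[OF mt(1)] module_smult[OF mt(1)] tens_in_tensor')
    moreover have "cd ?T (p - 1) (tens A B i (j - 1) a (cd B j b)) =
      tens A B (i - 1) (j - 1) (cd A i a) (cd B j b)"
      using cd_tens[OF A B a db] a b da db
      by (simp add: p' chain_complex_dd[OF B] tens_zero_right m module_smult_czero[OF mt(1)]
          module_add_zero_right[OF mt(1)] tens_in_tensor')
    moreover have "cd ?T p (tens A B i j a b) = cadd ?T (p - 1) (tens A B (i - 1) j (cd A i a) b)
      (csmult ?T (p - 1) (sgnpow i) (tens A B i (j - 1) a (cd B j b)))"
      using cd_tens[OF A B a b] p by simp
    ultimately show "cd ?T (p - 1) (cd ?T p (tens A B i j a b)) = czero ?T (p - 2)"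
      using a b da db
      by (simp add: linmap_add[OF lin] linmap_smult[OF lin] module_smult[OF mt(1)] tens_in_tensor' p' p
        module_smult_zero[OF mt(1)] flip: module_smult_add_left[OF mt(1)])
  qed (rule mt)
qed

section \<open>Graded maps\<close>

datatype ('r, 'a, 'b) arrow =
  Arrow (src: "('r, 'a) cx") (tgt: "('r, 'b) cx") (deg: int) (app: "int \<Rightarrow> 'a \<Rightarrow> 'b")

text \<open>Graded maps are normalised to \<^const>\<open>undefined\<close> outside the carriers, so that extensional equality
  of maps is equality in the logic.\<close>

definition mk where
  "mk A B n f = Arrow A B n (\<lambda>p x. if x \<in> cset A p then f p x else undefined)"

text \<open>Both complexes are part of the condition, so that the side conditions met in the
  calculus follow from \<open>arr\<close> of the maps involved.\<close>

definition arr :: "('r::comm_ring_1, 'a, 'b) arrow \<Rightarrow> bool" where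
  "arr f \<longleftrightarrow> chain_complex (src f) \<and> chain_complex (tgt f) \<and>
     (\<forall>p. linmap (src f) p (tgt f) (p + deg f) (app f p)) \<and>
     (\<forall>p x. x \<notin> cset (src f) p \<longrightarrow> app f p x = undefined)"

lemma mk_sel [simp]:
  "src (mk A B n f) = A" "tgt (mk A B n f) = B" "deg (mk A B n f) = n"
  by (simp_all add: mk_def)

lemma app_mk: "x \<in> cset A p \<Longrightarrow> app (mk A B n f) p x = f p x"
  by (simp add: mk_def)

lemma arr_mk:
  "chain_complex A \<Longrightarrow> chain_complex B \<Longrightarrow> (\<And>p. linmap A p B (p + n) (f p)) \<Longrightarrow> arr (mk A B n f)"
  by (auto simp: arr_def mk_def linmap_def module_add module_smult chain_complex_module)

lemma arr_complex [simp]: "arr f \<Longrightarrow> chain_complex (src f)" "arr f \<Longrightarrow> chain_complex (tgt f)"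
  by (simp_all add: arr_def)

lemma arr_linmap: "arr f \<Longrightarrow> src f = A \<Longrightarrow> tgt f = B \<Longrightarrow> p + deg f = q \<Longrightarrow> linmap A p B q (app f p)"
  by (auto simp: arr_def)

lemma app_closed: "arr f \<Longrightarrow> x \<in> cset (src f) p \<Longrightarrow> app f p x \<in> cset (tgt f) (p + deg f)"
  by (rule linmap_closed[OF arr_linmap]) auto

lemma arrow_eqI:
  assumes "arr f" "arr g" "src f = src g" "tgt f = tgt g" "deg f = deg g"
    and "\<And>p x. x \<in> cset (src g) p \<Longrightarrow> app f p x = app g p x"
  shows "f = g"
proof -
  have "app f p x = app g p x" for p x
  proof (cases "x \<in> cset (src g) p")
    case False
    then show ?thesis using assms(1-3) unfolding arr_def by metis
  qed (rule assms)
  then show ?thesis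
    using assms(3-5) by (intro arrow.expand conjI ext)
qed

definition cmp :: "('r::comm_ring_1, 'b, 'c) arrow \<Rightarrow> ('r, 'a, 'b) arrow \<Rightarrow> ('r, 'a, 'c) arrow"
    (infixr "\<odot>" 75) where
  "g \<odot> f = mk (src f) (tgt g) (deg f + deg g) (\<lambda>p x. app g (p + deg f) (app f p x))"

definition plus_arrow :: "('r::comm_ring_1, 'a, 'b) arrow \<Rightarrow> ('r, 'a, 'b) arrow \<Rightarrow> ('r, 'a, 'b) arrow"
    (infixl "\<oplus>" 65) where
  "f \<oplus> g = mk (src f) (tgt f) (deg f) (\<lambda>p x. cadd (tgt f) (p + deg f) (app f p x) (app g p x))"

definition scale :: "'r \<Rightarrow> ('r::comm_ring_1, 'a, 'b) arrow \<Rightarrow> ('r, 'a, 'b) arrow" (infixr "\<star>" 70) where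
  "r \<star> f = mk (src f) (tgt f) (deg f) (\<lambda>p x. csmult (tgt f) (p + deg f) r (app f p x))"

definition null :: "('r::comm_ring_1, 'a) cx \<Rightarrow> ('r, 'b) cx \<Rightarrow> int \<Rightarrow> ('r, 'a, 'b) arrow" where
  "null A B n = mk A B n (\<lambda>p x. czero B (p + n))"

definition idt :: "('r::comm_ring_1, 'a) cx \<Rightarrow> ('r, 'a, 'a) arrow" where
  "idt A = mk A A 0 (\<lambda>p x. x)"

definition dif :: "('r::comm_ring_1, 'a) cx \<Rightarrow> ('r, 'a, 'a) arrow" where
  "dif A = mk A A (- 1) (cd A)"

text \<open>Differential of the internal hom complex. Its sign gives \<open>d f + f d\<close> in
  degree 1 and \<open>d f - f d\<close> in degree 2, the left-hand sides of the relations for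
  \<open>m3\<close> and \<open>m4\<close>; chain homotopies are the degree 1 case.\<close>

definition bdry :: "('r::comm_ring_1, 'a, 'b) arrow \<Rightarrow> ('r, 'a, 'b) arrow" where
  "bdry f = dif (tgt f) \<odot> f \<oplus> (- sgnpow (deg f)) \<star> (f \<odot> dif (src f))"

lemma arrow_ops_sel [simp]:
  "src (g \<odot> f) = src f" "tgt (g \<odot> f) = tgt g" "deg (g \<odot> f) = deg f + deg g"
  "src (f \<oplus> f') = src f" "tgt (f \<oplus> f') = tgt f" "deg (f \<oplus> f') = deg f"
  "src (r \<star> f) = src f" "tgt (r \<star> f) = tgt f" "deg (r \<star> f) = deg f"
  "src (null A B n) = A" "tgt (null A B n) = B" "deg (null A B n) = n"
  "src (idt A) = A" "tgt (idt A) = A" "deg (idt A) = 0"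
  "src (dif A) = A" "tgt (dif A) = A" "deg (dif A) = - 1"
  by (simp_all add: cmp_def plus_arrow_def scale_def null_def idt_def dif_def)

lemma bdry_sel [simp]: "src (bdry f) = src f" "tgt (bdry f) = tgt f" "deg (bdry f) = deg f - 1"
  by (simp_all add: bdry_def)

lemma app_ops:
  "x \<in> cset (src f) p \<Longrightarrow> app (g \<odot> f) p x = app g (p + deg f) (app f p x)"
  "x \<in> cset (src f) p \<Longrightarrow> app (f \<oplus> f') p x = cadd (tgt f) (p + deg f) (app f p x) (app f' p x)"
  "x \<in> cset (src f) p \<Longrightarrow> app (r \<star> f) p x = csmult (tgt f) (p + deg f) r (app f p x)"
  "x \<in> cset A p \<Longrightarrow> app (null A B n) p x = czero B (p + n)"
  "y \<in> cset C p \<Longrightarrow> app (idt C) p y = y"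
  "y \<in> cset C p \<Longrightarrow> app (dif C) p y = cd C p y"
  by (simp_all add: cmp_def plus_arrow_def scale_def null_def idt_def dif_def app_mk)

lemma arr_cmp [simp]: "arr f \<Longrightarrow> arr g \<Longrightarrow> src g = tgt f \<Longrightarrow> arr (g \<odot> f)"
  unfolding cmp_def
  by (intro arr_mk)
     (simp_all add: linmap_comp[OF arr_linmap[OF _ refl refl refl] arr_linmap] add.assoc)

lemma arr_plus [simp]:
  "arr f \<Longrightarrow> arr g \<Longrightarrow> src g = src f \<Longrightarrow> tgt g = tgt f \<Longrightarrow> deg g = deg f \<Longrightarrow> arr (f \<oplus> g)"
  unfolding plus_arrow_def
  by (intro arr_mk linmap_plus arr_linmap chain_complex_module) auto

lemma arr_scale [simp]: "arr f \<Longrightarrow> arr (r \<star> f)"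
  unfolding scale_def
  by (intro arr_mk linmap_scale arr_linmap chain_complex_module) auto

lemma arr_null [simp]: "chain_complex A \<Longrightarrow> chain_complex B \<Longrightarrow> arr (null A B n)"
  unfolding null_def by (intro arr_mk linmap_const_zero chain_complex_module)

lemma arr_idt [simp]: "chain_complex A \<Longrightarrow> arr (idt A)"
  unfolding idt_def by (intro arr_mk) (simp_all add: linmap_ident)

lemma arr_dif [simp]: "chain_complex A \<Longrightarrow> arr (dif A)"
  unfolding dif_def by (intro arr_mk) (simp_all add: chain_complex_linmap)

lemma arr_bdry [simp]: "arr f \<Longrightarrow> arr (bdry f)"
  unfolding bdry_def by simp

lemma app_bdry:
  assumes "arr f" "x \<in> cset (src f) p"
  shows "app (bdry f) p x = cadd (tgt f) (p + deg f - 1) (cd (tgt f) (p + deg f) (app f p x))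
     (csmult (tgt f) (p + deg f - 1) (- sgnpow (deg f)) (app f (p - 1) (cd (src f) p x)))"
  using assms app_closed[OF assms] cd_closed[of "src f" x p]
  by (simp add: bdry_def app_ops algebra_simps)

lemma cmp_assoc:
  "arr f \<Longrightarrow> arr g \<Longrightarrow> arr h \<Longrightarrow> src g = tgt f \<Longrightarrow> src h = tgt g \<Longrightarrow> (h \<odot> g) \<odot> f = h \<odot> g \<odot> f"
  by (rule arrow_eqI) (use app_closed[of f] in \<open>simp_all add: app_ops add.assoc\<close>)

lemma cmp_idt [simp]:
  "arr f \<Longrightarrow> src f = A \<Longrightarrow> f \<odot> idt A = f" "arr f \<Longrightarrow> tgt f = B \<Longrightarrow> idt B \<odot> f = f"
  by (rule arrow_eqI; use app_closed[of f] in \<open>force simp: app_ops\<close>)+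

lemma dif_dif: "chain_complex A \<Longrightarrow> dif A \<odot> dif A = null A A (- 2)"
  by (rule arrow_eqI) (simp_all add: app_ops cd_closed chain_complex_dd)

lemma arr_module: "arr f \<Longrightarrow> module_at (src f) p" "arr f \<Longrightarrow> module_at (tgt f) p"
  by (simp_all add: chain_complex_module)

lemma cmp_linear_left:
  "arr f \<Longrightarrow> arr g \<Longrightarrow> arr h \<Longrightarrow> src g = tgt f \<Longrightarrow> src h = src g \<Longrightarrow> tgt h = tgt g \<Longrightarrow> deg h = deg g \<Longrightarrow>
     (g \<oplus> h) \<odot> f = g \<odot> f \<oplus> h \<odot> f"
  "arr f \<Longrightarrow> arr g \<Longrightarrow> src g = tgt f \<Longrightarrow> (r \<star> g) \<odot> f = r \<star> (g \<odot> f)"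
  "arr f \<Longrightarrow> chain_complex B \<Longrightarrow> tgt f = A \<Longrightarrow> null A B n \<odot> f = null (src f) B (deg f + n)"
  by (rule arrow_eqI; use app_closed[of f] in \<open>force simp: app_ops add.assoc\<close>)+

lemma cmp_linear_right:
  "arr f \<Longrightarrow> arr g \<Longrightarrow> arr h \<Longrightarrow> src g = tgt f \<Longrightarrow> src h = src f \<Longrightarrow> tgt h = tgt f \<Longrightarrow> deg h = deg f \<Longrightarrow>
     g \<odot> (f \<oplus> h) = g \<odot> f \<oplus> g \<odot> h"
  "arr f \<Longrightarrow> arr g \<Longrightarrow> src g = tgt f \<Longrightarrow> g \<odot> (r \<star> f) = r \<star> (g \<odot> f)"
  "arr g \<Longrightarrow> chain_complex A \<Longrightarrow> src g = B \<Longrightarrow> g \<odot> null A B n = null A (tgt g) (n + deg g)"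
    apply (rule arrow_eqI; use app_closed[of f] app_closed[of h] in \<open>simp add: app_ops add.assoc linmap_add[OF arr_linmap]\<close>)
   apply (rule arrow_eqI; use app_closed[of f] in \<open>simp add: app_ops add.assoc linmap_smult[OF arr_linmap]\<close>)
  apply (rule arrow_eqI; force simp: app_ops add.assoc linmap_zero[OF _ _ arr_linmap] chain_complex_module module_zero)
  done

section \<open>Sums of graded maps\<close>

text \<open>Presenting graded maps in the record format of complexes makes the reflection by
  \<open>fval\<close> available for sums of maps.\<close>

definition hom_complex :: "('r::comm_ring_1, 'a) cx \<Rightarrow> ('r, 'b) cx \<Rightarrow> ('r, ('r, 'a, 'b) arrow) cx" where
  "hom_complex A B = \<lparr>cset = (\<lambda>n. {f. arr f \<and> src f = A \<and> tgt f = B \<and> deg f = n}),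
     cadd = (\<lambda>_. (\<oplus>)), czero = null A B, csmult = (\<lambda>_. (\<star>)), cd = (\<lambda>_. bdry)\<rparr>"

lemma hom_complex_module:
  assumes "chain_complex A" "chain_complex B"
  shows "module_at (hom_complex A B) n"
proof -
  let ?H = "hom_complex A B"
  have mem: "f \<in> cset ?H n \<longleftrightarrow> arr f \<and> src f = A \<and> tgt f = B \<and> deg f = n" for f
    by (simp add: hom_complex_def)
  have ops: "cadd ?H n = (\<oplus>)" "csmult ?H n = (\<star>)" "czero ?H n = null A B n"
    by (simp_all add: hom_complex_def)
  note B = chain_complex_module[OF assms(2)]
  note cl = app_closed
  show ?thesis
    unfolding module_at_def Let_def ops
  proof (intro conjI ballI allI)
    fix f g h r s
    assume *: "f \<in> cset ?H n"
    show "(r + s) \<star> f = r \<star> f \<oplus> s \<star> f"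
      by (rule arrow_eqI) (use * cl[of f] in \<open>auto simp: mem app_ops module_smult_add_left[OF B]\<close>)
    show "(r * s) \<star> f = r \<star> s \<star> f"
      by (rule arrow_eqI) (use * cl[of f] in \<open>auto simp: mem app_ops module_smult_mult[OF B]\<close>)
    show "1 \<star> f = f"
      by (rule arrow_eqI) (use * cl[of f] in \<open>auto simp: mem app_ops module_smult_one[OF B]\<close>)
    show "0 \<star> f = null A B n"
      by (rule arrow_eqI) (use * cl[of f] assms in \<open>auto simp: mem app_ops module_smult_zero[OF B]\<close>)
    show "null A B n \<oplus> f = f"
      by (rule arrow_eqI) (use * cl[of f] assms in \<open>auto simp: mem app_ops module_add_zero_left[OF B]\<close>)
    show "r \<star> f \<in> cset ?H n" using * by (simp add: mem)
    assume **: "g \<in> cset ?H n"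
    show "f \<oplus> g \<in> cset ?H n" using * ** by (simp add: mem)
    show "f \<oplus> g = g \<oplus> f"
      by (rule arrow_eqI) (use * ** cl[of f] cl[of g] in \<open>auto simp: mem app_ops intro!: module_add_commute arr_module\<close>)
    show "r \<star> (f \<oplus> g) = r \<star> f \<oplus> r \<star> g"
      by (rule arrow_eqI)
         (use * ** cl[of f] cl[of g] in \<open>auto simp: mem app_ops intro!: module_smult_add_right arr_module\<close>)
    assume ***: "h \<in> cset ?H n"
    show "f \<oplus> g \<oplus> h = f \<oplus> (g \<oplus> h)"
      by (rule arrow_eqI)
         (use * ** *** cl[of f] cl[of g] cl[of h] in \<open>auto simp: mem app_ops intro!: module_add_assoc arr_module\<close>)
  qed (simp add: mem assms)
qed

abbreviation hval where "hval A B n \<equiv> fval (hom_complex A B) n"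

lemma hval_add: "hval A B n \<phi> f \<Longrightarrow> hval A B n \<psi> g \<Longrightarrow> hval A B n (\<lambda>z. \<phi> z + \<psi> z) (f \<oplus> g)"
  using fval_add[of "hom_complex A B" n \<phi> f \<psi> g] by (simp add: hom_complex_def)

lemma hval_scale: "hval A B n \<phi> f \<Longrightarrow> hval A B n (\<lambda>z. r * \<phi> z) (r \<star> f)"
  using fval_smult[of "hom_complex A B" n \<phi> f r] by (simp add: hom_complex_def)

text \<open>The equations are premises because the degree of a null map produced by the calculus
  agrees with \<open>n\<close> only after arithmetic.\<close>

lemma hval_null: "A' = A \<Longrightarrow> B' = B \<Longrightarrow> m = n \<Longrightarrow> hval A B n (\<lambda>z. 0) (null A' B' m)"
  using fval_zero[of "hom_complex A B" n] by (simp add: hom_complex_def)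

lemma hval_atom: "arr f \<Longrightarrow> src f = A \<Longrightarrow> tgt f = B \<Longrightarrow> deg f = n \<Longrightarrow> hval A B n (delta f) f"
  by (rule fval_atom) (simp add: hom_complex_def)

text \<open>The left-hand map fixes source, target and degree, while the formal sums stay schematic
  and are synthesised by the introduction rules. Atoms are tried last, so that only maps which are
  no longer sums or multiples become basis elements.\<close>

lemma hval_unique:
  assumes "arr f" "hval (src f) (tgt f) (deg f) \<phi> f" "hval (src f) (tgt f) (deg f) \<psi> g" "\<And>z. \<phi> z = \<psi> z"
  shows "f = g"
  using fval_unique[OF hom_complex_module assms(2-4)] assms(1) by simp

lemmas hval_ops = hval_add hval_scale

lemma bdry_cmp:
  assumes "arr f" "arr g" "src g = tgt f"
  shows "bdry (g \<odot> f) = bdry g \<odot> f \<oplus> sgnpow (deg g) \<star> (g \<odot> bdry f)"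
  using assms
  \<comment> \<open>Once everything is distributed and associated to the right, equal composites are
    syntactically equal, and the two terms through the differential of the middle complex
    cancel.\<close>
  apply (simp add: bdry_def cmp_linear_left cmp_linear_right cmp_assoc)
  apply (rule hval_unique, simp)
  apply ((rule hval_ops | (rule hval_null; simp) | (rule hval_atom; simp))+)
  apply (simp add: algebra_simps sgnpow_add)
  done

lemma bdry_linear:
  "arr f \<Longrightarrow> arr g \<Longrightarrow> src g = src f \<Longrightarrow> tgt g = tgt f \<Longrightarrow> deg g = deg f \<Longrightarrow> bdry (f \<oplus> g) = bdry f \<oplus> bdry g"
  "arr f \<Longrightarrow> bdry (r \<star> f) = r \<star> bdry f"
  "chain_complex A \<Longrightarrow> chain_complex B \<Longrightarrow> bdry (null A B n) = null A B (n - 1)"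
    apply (simp add: bdry_def cmp_linear_left cmp_linear_right)
    apply (rule hval_unique, simp, (rule hval_ops | (rule hval_null; simp) | (rule hval_atom; simp))+, simp add: algebra_simps)
   apply (simp add: bdry_def cmp_linear_left cmp_linear_right)
   apply (rule hval_unique, simp, (rule hval_ops | (rule hval_null; simp) | (rule hval_atom; simp))+, simp add: algebra_simps)
  apply (simp add: bdry_def cmp_linear_left cmp_linear_right)
  apply (rule hval_unique, simp, (rule hval_ops | (rule hval_null; simp) | (rule hval_atom; simp))+)
  apply (simp add: algebra_simps)
  done

lemma bdry_idt: "chain_complex A \<Longrightarrow> bdry (idt A) = null A A (- 1)"
  apply (simp add: bdry_def)
  apply (rule hval_unique, simp, (rule hval_ops | (rule hval_null; simp) | (rule hval_atom; simp))+)
  apply (simp add: algebra_simps)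
  done

lemma bdry_bdry: "arr f \<Longrightarrow> bdry (bdry f) = null (src f) (tgt f) (deg f - 2)"
  apply (simp add: bdry_def cmp_linear_left cmp_linear_right cmp_assoc dif_dif)
  \<comment> \<open>Association to the left exposes \<open>dif \<odot> dif\<close> in front of
    \<open>f\<close>; with association to the right only the pair behind \<open>f\<close> is
    visible.\<close>
  apply (simp add: dif_dif cmp_linear_left cmp_linear_right flip: cmp_assoc)
  apply (simp add: dif_dif cmp_linear_left cmp_linear_right cmp_assoc)
  apply (rule hval_unique, simp, (rule hval_ops | (rule hval_null; simp) | (rule hval_atom; simp))+)
  apply (simp add: algebra_simps sgnpow_diff)
  done

section \<open>Tensor products of graded maps\<close>

lemma ten_arrow_eqI:
  assumes "arr F" "arr G" "src F = tensor A B" "src G = src F" "tgt F = tgt G" "deg F = deg G"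
    and eq: "\<And>i j a b. a \<in> cset A i \<Longrightarrow> b \<in> cset B j \<Longrightarrow>
      app F (i + j) (tens A B i j a b) = app G (i + j) (tens A B i j a b)"
  shows "F = G"
proof (rule arrow_eqI)
  fix p X assume "X \<in> cset (src G) p"
  then have "X \<in> cset (tensor A B) p" using assms by simp
  then show "app F p X = app G p X"
  proof (rule linmap_tensor_eqI)
    show "module_at (tgt G) (p + deg G)" using assms by (simp add: arr_module)
    show "linmap (tensor A B) p (tgt G) (p + deg G) (app F p)"
      "linmap (tensor A B) p (tgt G) (p + deg G) (app G p)"
      using assms by (auto intro!: arr_linmap)
  qed (use eq in auto)
qed (use assms in auto)

text \<open>The Koszul rule: \<open>g\<close> has to pass a vector of degree \<open>i\<close>.
  Putting the sign here makes the signs of later identities come out of \<open>ten_cmp\<close>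
  automatically.\<close>

definition tenF where
  "tenF f g p = (\<lambda>(i, a, b) y. sgnpow (deg g * i) * delta (i + deg f, app f i a, app g (p - i) b) y)"

definition ten :: "('r::comm_ring_1, 'a, 'c) arrow \<Rightarrow> ('r, 'b, 'd) arrow
    \<Rightarrow> ('r, (int \<times> 'a \<times> 'b \<Rightarrow> 'r) set, (int \<times> 'c \<times> 'd \<Rightarrow> 'r) set) arrow" (infixr "\<otimes>" 80) where
  "f \<otimes> g = mk (tensor (src f) (src g)) (tensor (tgt f) (tgt g)) (deg f + deg g)
     (\<lambda>p. tlift (tgt f) (tgt g) (p + (deg f + deg g)) (tenF f g p))"

lemma ten_sel [simp]:
  "src (f \<otimes> g) = tensor (src f) (src g)" "tgt (f \<otimes> g) = tensor (tgt f) (tgt g)" "deg (f \<otimes> g) = deg f + deg g"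
  by (simp_all add: ten_def)

lemma tenF_tfree:
  assumes "arr f" "arr g" "a \<in> cset (src f) i" "b \<in> cset (src g) (p - i)"
  shows "tenF f g p (i, a, b) \<in> tfree (tgt f) (tgt g) (p + (deg f + deg g))"
  unfolding tenF_def prod.case
  by (intro tfree_mult tfree_delta)
     (use app_closed[OF assms(1,3)] app_closed[OF assms(2,4)] in \<open>simp_all add: algebra_simps\<close>)

lemma tclass_tenF:
  assumes "arr f" "arr g" "a \<in> cset (src f) i" "b \<in> cset (src g) (p - i)"
  shows "tclass (tgt f) (tgt g) (p + (deg f + deg g)) (tenF f g p (i, a, b)) =
    csmult (tensor (tgt f) (tgt g)) (p + (deg f + deg g)) (sgnpow (deg g * i))
      (tens (tgt f) (tgt g) (i + deg f) (p - i + deg g) (app f i a) (app g (p - i) b))"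
proof -
  have "delta (i + deg f, app f i a, app g (p - i) b) \<in> tfree (tgt f) (tgt g) (p + (deg f + deg g))"
    by (intro tfree_delta)
       (use app_closed[OF assms(1,3)] app_closed[OF assms(2,4)] in \<open>simp_all add: algebra_simps\<close>)
  then show ?thesis
    unfolding tenF_def prod.case
    by (subst tensor_smult[symmetric]) (simp_all add: tclass_delta algebra_simps)
qed

lemma balanced_tenF:
  assumes f: "arr f" and g: "arr g"
  shows "balanced (src f) (src g) p (tgt f) (tgt g) (p + (deg f + deg g)) (tenF f g p)"
proof (rule balancedI)
  show m: "modules (src f)" "modules (src g)" using assms by (auto intro: chain_complex_modules)
  have m': "modules (tgt f)" "modules (tgt g)" using assms by (auto intro: chain_complex_modules)
  note mt = modulesD[OF modules_tensor] modulesD[OF m(1)] modulesD[OF m(2)]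
  fix i
  show "tenF f g p (i, a, b) \<in> tfree (tgt f) (tgt g) (p + (deg f + deg g))"
    if "a \<in> cset (src f) i" "b \<in> cset (src g) (p - i)" for a b
    by (rule tenF_tfree) fact+
  let ?T = "tensor (tgt f) (tgt g)" and ?q = "p + (deg f + deg g)"
  show "linmap (src f) i ?T ?q (\<lambda>a. tclass (tgt f) (tgt g) ?q (tenF f g p (i, a, b)))"
    if "b \<in> cset (src g) (p - i)" for b
    by (subst linmap_cong[OF tclass_tenF[OF f g]])
       (use that app_closed[OF g that] in
         \<open>auto intro!: mt m' linmap_scale linmap_comp[OF arr_linmap[OF f refl refl refl] linmap_tens_left']\<close>)
  show "linmap (src g) (p - i) ?T ?q (\<lambda>b. tclass (tgt f) (tgt g) ?q (tenF f g p (i, a, b)))"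
    if "a \<in> cset (src f) i" for a
    by (subst linmap_cong[OF tclass_tenF[OF f g]])
       (use that app_closed[OF f that] in
         \<open>auto intro!: mt m' linmap_scale linmap_comp[OF arr_linmap[OF g refl refl refl] linmap_tens_right']\<close>)
qed

lemma arr_ten [simp]: "arr f \<Longrightarrow> arr g \<Longrightarrow> arr (f \<otimes> g)"
  unfolding ten_def by (intro arr_mk tlift_linmap balanced_tenF) (auto intro: chain_complex_modules)

lemma app_ten:
  assumes "arr f" "arr g" "a \<in> cset (src f) i" "b \<in> cset (src g) j" "i + j = p"
  shows "app (f \<otimes> g) p (tens (src f) (src g) i j a b) =
    csmult (tensor (tgt f) (tgt g)) (p + (deg f + deg g)) (sgnpow (deg g * i))
      (tens (tgt f) (tgt g) (i + deg f) (j + deg g) (app f i a) (app g j b))"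
proof -
  have "app (f \<otimes> g) p (tens (src f) (src g) i j a b) =
    tlift (tgt f) (tgt g) (p + (deg f + deg g)) (tenF f g p) (tens (src f) (src g) i j a b)"
    unfolding ten_def using assms by (intro app_mk tens_in_tensor')
  also have "\<dots> = tclass (tgt f) (tgt g) (p + (deg f + deg g)) (tenF f g p (i, a, b))"
    by (rule tlift_tens)
       (simp_all add: assms balanced_tenF chain_complex_modules)
  finally show ?thesis
    using tclass_tenF[OF assms(1-3), of b p] assms(4) assms(5)[symmetric] by simp
qed

lemma tensor_smult_tens:
  assumes "chain_complex A" "chain_complex B" "a \<in> cset A i" "b \<in> cset B j" "i + j = p"
  shows "csmult (tensor A B) p r (csmult (tensor A B) p s (tens A B i j a b)) =
     csmult (tensor A B) p (r * s) (tens A B i j a b)"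
  using module_smult_mult[OF modulesD[OF modules_tensor] tens_in_tensor'[OF assms(3-5)]] by simp

text \<open>The interchange law; its sign arises as \<open>g'\<close> passes \<open>f\<close>. On a
  generator the exponents are \<open>deg g * i\<close> and \<open>deg g' * (i + deg f)\<close>,
  whose surplus over \<open>(deg g + deg g') * i\<close> is \<open>deg g' * deg f\<close>.\<close>

lemma ten_cmp:
  assumes "arr f" "arr g" "arr f'" "arr g'" "src f' = tgt f" "src g' = tgt g"
  shows "(f' \<otimes> g') \<odot> (f \<otimes> g) = sgnpow (deg g' * deg f) \<star> ((f' \<odot> f) \<otimes> (g' \<odot> g))"
proof (rule ten_arrow_eqI[of _ _ "src f" "src g"])
  fix i j a b assume a: "a \<in> cset (src f) i" and b: "b \<in> cset (src g) j"
  note fa = app_closed[OF assms(1) a] and gb = app_closed[OF assms(2) b]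
  have f'fa: "app f' (i + deg f) (app f i a) \<in> cset (tgt f') (i + deg f + deg f')"
    and g'gb: "app g' (j + deg g) (app g j b) \<in> cset (tgt g') (j + deg g + deg g')"
    using app_closed[OF assms(3)] app_closed[OF assms(4)] fa gb assms by simp_all
  have 1: "app (f' \<otimes> g') (i + j + (deg f + deg g)) (tens (tgt f) (tgt g) (i + deg f) (j + deg g) (app f i a) (app g j b))
    = csmult (tensor (tgt f') (tgt g')) (i + j + (deg f + deg g) + (deg f' + deg g')) (sgnpow (deg g' * (i + deg f)))
      (tens (tgt f') (tgt g') (i + deg f + deg f') (j + deg g + deg g') (app f' (i + deg f) (app f i a)) (app g' (j + deg g) (app g j b)))"
    using app_ten[OF assms(3,4), of "app f i a" "i + deg f" "app g j b" "j + deg g" "i + j + (deg f + deg g)"]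
    fa gb assms by simp
  have 2: "app (f' \<otimes> g') (i + j + (deg f + deg g)) (csmult (tensor (tgt f) (tgt g)) (i + j + (deg f + deg g)) r X) =
    csmult (tensor (tgt f') (tgt g')) (i + j + (deg f + deg g) + (deg f' + deg g')) r
      (app (f' \<otimes> g') (i + j + (deg f + deg g)) X)"
    if "X \<in> cset (tensor (tgt f) (tgt g)) (i + j + (deg f + deg g))" for r X
    using linmap_smult[OF arr_linmap[OF arr_ten[OF assms(3,4)] refl refl refl], of X "i + j + (deg f + deg g)" r] that assms
    by simp
  show "app ((f' \<otimes> g') \<odot> (f \<otimes> g)) (i + j) (tens (src f) (src g) i j a b) =
    app (sgnpow (deg g' * deg f) \<star> ((f' \<odot> f) \<otimes> (g' \<odot> g))) (i + j) (tens (src f) (src g) i j a b)"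
    using app_ten[of "f' \<odot> f" "g' \<odot> g" a i b j] app_ten[of f g a i b j] assms a b fa gb f'fa g'gb
    apply (simp add: app_ops tens_in_tensor 2 tens_in_tensor' 1)
    apply (simp add: add.assoc add.left_commute tensor_smult_tens)
    apply (simp add: tensor_smult_tens tens_in_tensor sgnpow_add algebra_simps)
    done
qed (use assms in auto)

lemma ten_idt: "chain_complex A \<Longrightarrow> chain_complex B \<Longrightarrow> idt A \<otimes> idt B = idt (tensor A B)"
proof (rule ten_arrow_eqI[of _ _ A B])
  fix i j a b assume "chain_complex A" "chain_complex B" "a \<in> cset A i" "b \<in> cset B j"
  then show "app (idt A \<otimes> idt B) (i + j) (tens A B i j a b) = app (idt (tensor A B)) (i + j) (tens A B i j a b)"
    using app_ten[of "idt A" "idt B" a i b j] module_smult_one[OF modulesD[OF modules_tensor] tens_in_tensor]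
    by (simp add: app_ops tens_in_tensor)
qed auto

text \<open>The sign of the tensor differential is the Koszul sign of
  \<open>idt A \<otimes> dif B\<close>, as \<open>dif B\<close> has degree -1. With the differential
  inside the calculus, the Leibniz rule for \<open>\<otimes>\<close> follows from the interchange
  law.\<close>

lemma dif_tensor:
  assumes "chain_complex A" "chain_complex B"
  shows "dif (tensor A B) = dif A \<otimes> idt B \<oplus> idt A \<otimes> dif B"
proof (rule ten_arrow_eqI[of _ _ A B])
  fix i j a b assume *: "a \<in> cset A i" "b \<in> cset B j"
  have m: "csmult (tensor A B) p 1 X = X" if "X \<in> cset (tensor A B) p" for p X
    using that module_smult_one[OF modulesD[OF modules_tensor]] by blast
  show "app (dif (tensor A B)) (i + j) (tens A B i j a b) =
    app (dif A \<otimes> idt B \<oplus> idt A \<otimes> dif B) (i + j) (tens A B i j a b)"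
    using app_ten[of "dif A" "idt B" a i b j] app_ten[of "idt A" "dif B" a i b j] cd_tens[OF assms *] assms *
    by (simp add: app_ops tens_in_tensor m tens_in_tensor' cd_closed)
qed (use assms in auto)

lemma ten_linear_left:
  "arr f \<Longrightarrow> arr f' \<Longrightarrow> arr g \<Longrightarrow> src f' = src f \<Longrightarrow> tgt f' = tgt f \<Longrightarrow> deg f' = deg f \<Longrightarrow>
     (f \<oplus> f') \<otimes> g = f \<otimes> g \<oplus> f' \<otimes> g"
  "arr f \<Longrightarrow> arr g \<Longrightarrow> (r \<star> f) \<otimes> g = r \<star> (f \<otimes> g)"
  "chain_complex A \<Longrightarrow> chain_complex B \<Longrightarrow> arr g \<Longrightarrow>
     null A B n \<otimes> g = null (tensor A (src g)) (tensor B (tgt g)) (n + deg g)"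
proof -
  note mt = modulesD[OF modules_tensor]
  show "(f \<oplus> f') \<otimes> g = f \<otimes> g \<oplus> f' \<otimes> g"
    if *: "arr f" "arr f'" "arr g" "src f' = src f" "tgt f' = tgt f" "deg f' = deg f"
  proof (rule ten_arrow_eqI[of _ _ "src f" "src g"])
    fix i j a b assume ab: "a \<in> cset (src f) i" "b \<in> cset (src g) j"
    then show "app ((f \<oplus> f') \<otimes> g) (i + j) (tens (src f) (src g) i j a b) =
       app (f \<otimes> g \<oplus> f' \<otimes> g) (i + j) (tens (src f) (src g) i j a b)"
      using app_ten[of "f \<oplus> f'" g a i b j] app_ten[of f g a i b j] app_ten[of f' g a i b j] *
        app_closed[of f a i] app_closed[of f' a i] app_closed[of g b j]
        tens_add_left[of "tgt f" "tgt g" "app f i a" "i + deg f" "app f' i a" "app g j b" "j + deg g"]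
      by (simp add: module_smult_add_right[OF mt] app_ops tens_in_tensor tens_in_tensor' chain_complex_modules algebra_simps)
  qed (use * in auto)
  show "(r \<star> f) \<otimes> g = r \<star> (f \<otimes> g)" if *: "arr f" "arr g"
  proof (rule ten_arrow_eqI[of _ _ "src f" "src g"])
    fix i j a b assume ab: "a \<in> cset (src f) i" "b \<in> cset (src g) j"
    then show "app ((r \<star> f) \<otimes> g) (i + j) (tens (src f) (src g) i j a b) =
       app (r \<star> (f \<otimes> g)) (i + j) (tens (src f) (src g) i j a b)"
      using app_ten[of "r \<star> f" g a i b j] app_ten[of f g a i b j] *
        app_closed[of f a i] app_closed[of g b j]
        tens_smult_left[of "tgt f" "tgt g" "app f i a" "i + deg f" "app g j b" "j + deg g" r]
      by (simp add: app_ops tens_in_tensor tens_in_tensor' chain_complex_modules algebra_simps tensor_smult_tens)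
  qed (use * in auto)
  show "null A B n \<otimes> g = null (tensor A (src g)) (tensor B (tgt g)) (n + deg g)"
    if *: "chain_complex A" "chain_complex B" "arr g"
  proof (rule ten_arrow_eqI[of _ _ A "src g"])
    fix i j a b assume ab: "a \<in> cset A i" "b \<in> cset (src g) j"
    then show "app (null A B n \<otimes> g) (i + j) (tens A (src g) i j a b) =
       app (null (tensor A (src g)) (tensor B (tgt g)) (n + deg g)) (i + j) (tens A (src g) i j a b)"
      using app_ten[of "null A B n" g a i b j] * app_closed[of g b j]
      by (simp add: app_ops tens_in_tensor tens_zero_left[where p = "i + j + (n + deg g)"]
            chain_complex_modules module_smult_czero[OF mt])
  qed (use * in auto)
qed

lemma ten_linear_right:
  "arr f \<Longrightarrow> arr f' \<Longrightarrow> arr g \<Longrightarrow> src f' = src f \<Longrightarrow> tgt f' = tgt f \<Longrightarrow> deg f' = deg f \<Longrightarrow>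
     g \<otimes> (f \<oplus> f') = g \<otimes> f \<oplus> g \<otimes> f'"
  "arr f \<Longrightarrow> arr g \<Longrightarrow> g \<otimes> (r \<star> f) = r \<star> (g \<otimes> f)"
  "chain_complex A \<Longrightarrow> chain_complex B \<Longrightarrow> arr g \<Longrightarrow>
     g \<otimes> null A B n = null (tensor (src g) A) (tensor (tgt g) B) (deg g + n)"
proof -
  note mt = modulesD[OF modules_tensor]
  show "g \<otimes> (f \<oplus> f') = g \<otimes> f \<oplus> g \<otimes> f'"
    if *: "arr f" "arr f'" "arr g" "src f' = src f" "tgt f' = tgt f" "deg f' = deg f"
  proof (rule ten_arrow_eqI[of _ _ "src g" "src f"])
    fix i j a b assume ab: "a \<in> cset (src g) i" "b \<in> cset (src f) j"
    then show "app (g \<otimes> (f \<oplus> f')) (i + j) (tens (src g) (src f) i j a b) =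
       app (g \<otimes> f \<oplus> g \<otimes> f') (i + j) (tens (src g) (src f) i j a b)"
      using app_ten[of g "f \<oplus> f'" a i b j] app_ten[of g f a i b j] app_ten[of g f' a i b j] *
        app_closed[of f b j] app_closed[of f' b j] app_closed[of g a i]
        tens_add_right[of "tgt g" "tgt f" "app g i a" "i + deg g" "app f' j b" "j + deg f" "app f j b"]
      by (simp add: module_smult_add_right[OF mt] app_ops tens_in_tensor tens_in_tensor' chain_complex_modules algebra_simps)
  qed (use * in auto)
  show "g \<otimes> (r \<star> f) = r \<star> (g \<otimes> f)" if *: "arr f" "arr g"
  proof (rule ten_arrow_eqI[of _ _ "src g" "src f"])
    fix i j a b assume ab: "a \<in> cset (src g) i" "b \<in> cset (src f) j"
    then show "app (g \<otimes> (r \<star> f)) (i + j) (tens (src g) (src f) i j a b) =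
       app (r \<star> (g \<otimes> f)) (i + j) (tens (src g) (src f) i j a b)"
      using app_ten[of g "r \<star> f" a i b j] app_ten[of g f a i b j] *
        app_closed[of f b j] app_closed[of g a i]
        tens_smult_right[of "tgt g" "tgt f" "app g i a" "i + deg g" "app f j b" "j + deg f" r]
      by (simp add: app_ops tens_in_tensor tens_in_tensor' chain_complex_modules algebra_simps tensor_smult_tens)
  qed (use * in auto)
  show "g \<otimes> null A B n = null (tensor (src g) A) (tensor (tgt g) B) (deg g + n)"
    if *: "chain_complex A" "chain_complex B" "arr g"
  proof (rule ten_arrow_eqI[of _ _ "src g" A])
    fix i j a b assume ab: "a \<in> cset (src g) i" "b \<in> cset A j"
    then show "app (g \<otimes> null A B n) (i + j) (tens (src g) A i j a b) =
       app (null (tensor (src g) A) (tensor (tgt g) B) (deg g + n)) (i + j) (tens (src g) A i j a b)"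
      using app_ten[of g "null A B n" a i b j] * app_closed[of g a i]
      by (simp add: app_ops tens_in_tensor tens_zero_right[where p = "i + j + (deg g + n)"]
            chain_complex_modules module_smult_czero[OF mt])
  qed (use * in auto)
qed

lemma bdry_ten:
  assumes "arr f" "arr g"
  shows "bdry (f \<otimes> g) = bdry f \<otimes> g \<oplus> sgnpow (deg f) \<star> (f \<otimes> bdry g)"
  using assms
  apply (simp add: bdry_def dif_tensor cmp_linear_left cmp_linear_right ten_cmp ten_linear_left ten_linear_right)
  apply (rule hval_unique, simp)
   apply (rule hval_ops | (rule hval_null; simp) | (rule hval_atom; simp))+
  apply (simp add: algebra_simps sgnpow_add)
  done

section \<open>The associator\<close>

text \<open>The generator principle applied twice: with the outer vector fixed, both sides are
  linear in the inner tensor.\<close>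

lemma ten3_right_eqI:
  assumes F: "arr F" and G: "arr G" and *: "src F = tensor A (tensor B C)" "src G = src F" "tgt F = tgt G" "deg F = deg G"
    and cx: "chain_complex A" "chain_complex B" "chain_complex C"
    and eq: "\<And>i j k a b c. a \<in> cset A i \<Longrightarrow> b \<in> cset B j \<Longrightarrow> c \<in> cset C k \<Longrightarrow>
      app F (i + (j + k)) (tens A (tensor B C) i (j + k) a (tens B C j k b c)) =
      app G (i + (j + k)) (tens A (tensor B C) i (j + k) a (tens B C j k b c))"
  shows "F = G"
proof (rule ten_arrow_eqI[OF F G *])
  note m = chain_complex_modules[OF cx(1)] modules_tensor
  fix i p a Y assume a: "a \<in> cset A i" and Y: "Y \<in> cset (tensor B C) p"
  from Y show "app F (i + p) (tens A (tensor B C) i p a Y) = app G (i + p) (tens A (tensor B C) i p a Y)"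
  proof (rule linmap_tensor_eqI[where F = "\<lambda>Y. app F (i + p) (tens A (tensor B C) i p a Y)"])
    show "module_at (tgt F) (i + p + deg F)" using F by (simp add: arr_module)
    show "linmap (tensor B C) p (tgt F) (i + p + deg F) (\<lambda>Y. app F (i + p) (tens A (tensor B C) i p a Y))"
      by (rule linmap_comp[OF linmap_tens_right[OF m a] arr_linmap[OF F]]) (use * in auto)
    show "linmap (tensor B C) p (tgt F) (i + p + deg F) (\<lambda>Y. app G (i + p) (tens A (tensor B C) i p a Y))"
      by (rule linmap_comp[OF linmap_tens_right[OF m a] arr_linmap[OF G]]) (use * in auto)
  qed (use a eq in auto)
qed

lemma ten3_left_eqI:
  assumes F: "arr F" and G: "arr G" and *: "src F = tensor (tensor A B) C" "src G = src F" "tgt F = tgt G" "deg F = deg G"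
    and cx: "chain_complex A" "chain_complex B" "chain_complex C"
    and eq: "\<And>i j k a b c. a \<in> cset A i \<Longrightarrow> b \<in> cset B j \<Longrightarrow> c \<in> cset C k \<Longrightarrow>
      app F (i + j + k) (tens (tensor A B) C (i + j) k (tens A B i j a b) c) =
      app G (i + j + k) (tens (tensor A B) C (i + j) k (tens A B i j a b) c)"
  shows "F = G"
proof (rule ten_arrow_eqI[OF F G *])
  note m = modules_tensor chain_complex_modules[OF cx(3)] 
  fix p k X c assume X: "X \<in> cset (tensor A B) p" and c: "c \<in> cset C k"
  from X show "app F (p + k) (tens (tensor A B) C p k X c) = app G (p + k) (tens (tensor A B) C p k X c)"
  proof (rule linmap_tensor_eqI[where F = "\<lambda>X. app F (p + k) (tens (tensor A B) C p k X c)"])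
    show "module_at (tgt F) (p + k + deg F)" using F by (simp add: arr_module)
    show "linmap (tensor A B) p (tgt F) (p + k + deg F) (\<lambda>X. app F (p + k) (tens (tensor A B) C p k X c))"
      by (rule linmap_comp[OF linmap_tens_left[OF m c] arr_linmap[OF F]]) (use * in auto)
    show "linmap (tensor A B) p (tgt F) (p + k + deg F) (\<lambda>X. app G (p + k) (tens (tensor A B) C p k X c))"
      by (rule linmap_comp[OF linmap_tens_left[OF m c] arr_linmap[OF G]]) (use * in auto)
  qed (use c eq in auto)
qed

lemma ten4_left_eqI:
  assumes F: "arr F" and G: "arr G" and *: "src F = tensor (tensor (tensor A B) C) D" "src G = src F" "tgt F = tgt G" "deg F = deg G"
    and cx: "chain_complex A" "chain_complex B" "chain_complex C" "chain_complex D"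
    and eq: "\<And>i j k l a b c d. a \<in> cset A i \<Longrightarrow> b \<in> cset B j \<Longrightarrow> c \<in> cset C k \<Longrightarrow> d \<in> cset D l \<Longrightarrow>
      app F (i + j + k + l) (tens (tensor (tensor A B) C) D (i + j + k) l (tens (tensor A B) C (i + j) k (tens A B i j a b) c) d) =
      app G (i + j + k + l) (tens (tensor (tensor A B) C) D (i + j + k) l (tens (tensor A B) C (i + j) k (tens A B i j a b) c) d)"
  shows "F = G"
proof (rule ten3_left_eqI[OF F G *])
  note m = chain_complex_modules[OF cx(3)] chain_complex_modules[OF cx(4)] modules_tensor
  fix p k l X c d assume X: "X \<in> cset (tensor A B) p" and c: "c \<in> cset C k" and d: "d \<in> cset D l"
  let ?t = "\<lambda>X. tens (tensor (tensor A B) C) D (p + k) l (tens (tensor A B) C p k X c) d"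
  have t: "linmap (tensor A B) p (tensor (tensor (tensor A B) C) D) (p + k + l) ?t"
    using c d by (intro linmap_comp[OF linmap_tens_left linmap_tens_left] m)
  from X show "app F (p + k + l) (?t X) = app G (p + k + l) (?t X)"
  proof (rule linmap_tensor_eqI[where F = "\<lambda>X. app F (p + k + l) (?t X)"])
    show "module_at (tgt F) (p + k + l + deg F)" using F by (simp add: arr_module)
    show "linmap (tensor A B) p (tgt F) (p + k + l + deg F) (\<lambda>X. app F (p + k + l) (?t X))"
      by (rule linmap_comp[OF t arr_linmap[OF F]]) (use * in auto)
    show "linmap (tensor A B) p (tgt F) (p + k + l + deg F) (\<lambda>X. app G (p + k + l) (?t X))"
      by (rule linmap_comp[OF t arr_linmap[OF G]]) (use * in auto)
  qed (use c d eq in auto)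
qed (use cx in auto)

section \<open>The associator and its inverse as lifts of lifts\<close>

definition ascF where
  "ascF A B i a = (\<lambda>(j, b, c). delta (i + j, tens A B i j a b, c))"

lemma tassoc_tlift:
  "tassoc A B C p X = tlift (tensor A B) C p (\<lambda>(i, a, Y). lext (ascF A B i a) (rep Y)) X"
  by (simp add: tassoc_def tlift_def ascF_def)

text \<open>Inner stage of the inverse: \<open>c\<close> is held fixed while a class of degree
  \<open>i\<close> in the left factor is resolved into generators.\<close>

definition asc_invF where
  "asc_invF B C p i c = (\<lambda>(j, a, b). delta (j, a, tens B C (i - j) (p - i) b c))"

text \<open>The associator lifts a function that is itself a lift depending on the outer vector.
  Linearity in that vector survives forming sums and multiples of \<open>Y\<close>, so it needs
  checking only when \<open>Y\<close> is a generator.\<close>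

lemma linmap_tlift_parameter:
  assumes P: "module_at P i" and bal: "\<And>x. x \<in> cset P i \<Longrightarrow> balanced A B p A' B' q (F x)"
    and AB: "modules A" "modules B" and Y: "Y \<in> cset (tensor A B) p"
    and gen: "\<And>j k a b. j + k = p \<Longrightarrow> a \<in> cset A j \<Longrightarrow> b \<in> cset B k \<Longrightarrow>
      linmap P i (tensor A' B') q (\<lambda>x. tclass A' B' q (F x (j, a, b)))"
  shows "linmap P i (tensor A' B') q (\<lambda>x. tlift A' B' q (F x) Y)"
proof -
  note mt = modulesD[OF modules_tensor]
  note lin = tlift_linmap[OF bal AB]
  from Y show ?thesis
  proof (induction rule: tensor_induct)
    case zero
    show ?case
      by (subst linmap_cong[OF linmap_zero[OF mt mt lin]]) (use P in \<open>auto intro!: linmap_const_zero mt\<close>)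
  next
    case (add X Y)
    then show ?case
      by (subst linmap_cong[OF linmap_add[OF lin]]) (use P in \<open>auto intro!: linmap_plus mt\<close>)
  next
    case (smult r X)
    then show ?case
      by (subst linmap_cong[OF linmap_smult[OF lin]]) (use P in \<open>auto intro!: linmap_scale mt\<close>)
  next
    case (tens j k a b)
    show ?case
      by (subst linmap_cong[OF tlift_tens[of A B j k]]) (use P tens bal AB gen in auto)
  qed
qed

lemma balanced_ascF:
  assumes m: "modules A" "modules B" "modules C" and a: "a \<in> cset A i"
  shows "balanced B C (p - i) (tensor A B) C p (ascF A B i a)"
proof (rule balancedI)
  show "ascF A B i a (j, b, c) \<in> tfree (tensor A B) C p" if "b \<in> cset B j" "c \<in> cset C (p - i - j)" for j b c
    using that a tens_in_tensor[of a A i b B j] by (simp add: ascF_def tfree_delta algebra_simps)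
  fix j
  show "linmap B j (tensor (tensor A B) C) p (\<lambda>b. tclass (tensor A B) C p (ascF A B i a (j, b, c)))"
    if "c \<in> cset C (p - i - j)" for c
    unfolding ascF_def prod.case tclass_delta
    using that a by (intro linmap_comp[OF linmap_tens_right linmap_tens_left'] m modules_tensor) (auto simp: algebra_simps)
  show "linmap C (p - i - j) (tensor (tensor A B) C) p (\<lambda>c. tclass (tensor A B) C p (ascF A B i a (j, b, c)))"
    if "b \<in> cset B j" for b
    unfolding ascF_def prod.case tclass_delta
    using linmap_tens_right'[OF modules_tensor m(3) tens_in_tensor, of a A i b B j "p - (i + j)" p] that a
    by (simp add: algebra_simps)
qed fact+

lemma balanced_asc_invF:
  assumes m: "modules A" "modules B" "modules C" and c: "c \<in> cset C (p - i)"
  shows "balanced A B i A (tensor B C) p (asc_invF B C p i c)"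
proof (rule balancedI)
  show "asc_invF B C p i c (j, a, b) \<in> tfree A (tensor B C) p" if "a \<in> cset A j" "b \<in> cset B (i - j)" for j a b
    using that c by (simp add: asc_invF_def tfree_delta tens_in_tensor')
  fix j
  show "linmap A j (tensor A (tensor B C)) p (\<lambda>a. tclass A (tensor B C) p (asc_invF B C p i c (j, a, b)))"
    if "b \<in> cset B (i - j)" for b
    unfolding asc_invF_def prod.case tclass_delta
    using that c by (intro linmap_tens_left' m modules_tensor tens_in_tensor') auto
  show "linmap B (i - j) (tensor A (tensor B C)) p (\<lambda>b. tclass A (tensor B C) p (asc_invF B C p i c (j, a, b)))"
    if "a \<in> cset A j" for a
    unfolding asc_invF_def prod.case tclass_delta
    using that c by (intro linmap_comp[OF linmap_tens_left' linmap_tens_right'] m modules_tensor) auto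
qed fact+

lemma tlift_rep: "tclass A B p (lext F (rep Y)) = tlift A B p F Y"
  by (simp add: tlift_def)

lemma balanced_asc:
  assumes m: "modules A" "modules B" "modules C"
  shows "balanced A (tensor B C) p (tensor A B) C p (\<lambda>(i, a, Y). lext (ascF A B i a) (rep Y))"
\<comment> \<open>Rewriting with \<open>tlift_rep\<close> turns the class of an extension from
  \<open>rep Y\<close> into a lift, whose linearity in \<open>Y\<close> is known.\<close>
proof (rule balancedI; (unfold prod.case tlift_rep)?)
  fix i
  show "lext (ascF A B i a) (rep Y) \<in> tfree (tensor A B) C p"
    if "a \<in> cset A i" "Y \<in> cset (tensor B C) (p - i)" for a Y
    by (rule lext_tfree[OF balanced_ascF[OF m] tclass_rep(1)]) fact+
  show "linmap A i (tensor (tensor A B) C) p (\<lambda>a. tlift (tensor A B) C p (ascF A B i a) Y)"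
    if "Y \<in> cset (tensor B C) (p - i)" for Y
  proof (rule linmap_tlift_parameter[OF modulesD[OF m(1)] balanced_ascF[OF m] m(2,3) that])
    fix j k b c assume "j + k = p - i" "b \<in> cset B j" "c \<in> cset C k"
    moreover from this have "k = p - (i + j)" by simp
    ultimately show "linmap A i (tensor (tensor A B) C) p (\<lambda>a. tclass (tensor A B) C p (ascF A B i a (j, b, c)))"
      unfolding ascF_def prod.case tclass_delta
      by (intro linmap_comp[OF linmap_tens_left linmap_tens_left'] m modules_tensor) auto
  qed
  show "linmap (tensor B C) (p - i) (tensor (tensor A B) C) p (tlift (tensor A B) C p (ascF A B i a))"
    if "a \<in> cset A i" for a
    by (rule tlift_linmap[OF balanced_ascF[OF m that] m(2,3)])
qed (rule m modules_tensor)+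

lemma balanced_asc_inv:
  assumes m: "modules A" "modules B" "modules C"
  shows "balanced (tensor A B) C p A (tensor B C) p (\<lambda>(i, Y, c). lext (asc_invF B C p i c) (rep Y))"
proof (rule balancedI; (unfold prod.case tlift_rep)?)
  fix i
  show "lext (asc_invF B C p i c) (rep Y) \<in> tfree A (tensor B C) p"
    if "Y \<in> cset (tensor A B) i" "c \<in> cset C (p - i)" for c Y
    by (rule lext_tfree[OF balanced_asc_invF[OF m] tclass_rep(1)]) fact+
  show "linmap C (p - i) (tensor A (tensor B C)) p (\<lambda>c. tlift A (tensor B C) p (asc_invF B C p i c) Y)"
    if "Y \<in> cset (tensor A B) i" for Y
  proof (rule linmap_tlift_parameter[OF modulesD[OF m(3)] balanced_asc_invF[OF m] m(1,2) that])
    fix j k a b assume *: "j + k = i" "a \<in> cset A j" "b \<in> cset B k"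
    moreover from this have "k = i - j" by simp
    ultimately show "linmap C (p - i) (tensor A (tensor B C)) p (\<lambda>c. tclass A (tensor B C) p (asc_invF B C p i c (j, a, b)))"
      unfolding asc_invF_def prod.case tclass_delta
      by (intro linmap_comp[OF linmap_tens_right' linmap_tens_right'] m modules_tensor) auto
  qed
  show "linmap (tensor A B) i (tensor A (tensor B C)) p (tlift A (tensor B C) p (asc_invF B C p i c))"
    if "c \<in> cset C (p - i)" for c
    by (rule tlift_linmap[OF balanced_asc_invF[OF m that] m(1,2)])
qed (rule m modules_tensor)+

definition asc where
  "asc A B C = mk (tensor A (tensor B C)) (tensor (tensor A B) C) 0 (tassoc A B C)"

text \<open>The given \<open>tassoc\<close> leads from the right to the left bracketing, whereas the
  relations live on left bracketed tensors, where \<open>m2(a1, m2(a2, a3))\<close> requires the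
  opposite direction.\<close>

definition asc_inv where
  "asc_inv A B C = mk (tensor (tensor A B) C) (tensor A (tensor B C)) 0
     (\<lambda>p. tlift A (tensor B C) p (\<lambda>(i, Y, c). lext (asc_invF B C p i c) (rep Y)))"

lemma asc_sel [simp]:
  "src (asc A B C) = tensor A (tensor B C)" "tgt (asc A B C) = tensor (tensor A B) C" "deg (asc A B C) = 0"
  "src (asc_inv A B C) = tensor (tensor A B) C" "tgt (asc_inv A B C) = tensor A (tensor B C)" "deg (asc_inv A B C) = 0"
  by (simp_all add: asc_def asc_inv_def)

lemma arr_asc [simp]:
  assumes "chain_complex A" "chain_complex B" "chain_complex C"
  shows "arr (asc A B C)" "arr (asc_inv A B C)"
proof -
  note m = assms[THEN chain_complex_modules]
  show "arr (asc A B C)" unfolding asc_def tassoc_tlift[abs_def]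
    using assms tlift_linmap[OF balanced_asc[OF m] m(1) modules_tensor] by (intro arr_mk) auto
  show "arr (asc_inv A B C)" unfolding asc_inv_def
    using assms tlift_linmap[OF balanced_asc_inv[OF m] modules_tensor m(3)] by (intro arr_mk) auto
qed

lemma app_asc:
  assumes "chain_complex A" "chain_complex B" "chain_complex C"
    and *: "a \<in> cset A i" "b \<in> cset B j" "c \<in> cset C k" and n: "n = j + k" and p: "p = i + n"
  shows "app (asc A B C) p (tens A (tensor B C) i n a (tens B C j k b c)) =
    tens (tensor A B) C (i + j) k (tens A B i j a b) c"
proof -
  note m = assms(1-3)[THEN chain_complex_modules]
  have "app (asc A B C) p (tens A (tensor B C) i n a (tens B C j k b c)) =
    tassoc A B C p (tens A (tensor B C) i n a (tens B C j k b c))"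
    unfolding asc_def n p using * by (intro app_mk tens_in_tensor)
  also have "\<dots> = tlift (tensor A B) C p (ascF A B i a) (tens B C j k b c)"
    using balanced_asc[OF m, of p] m * n p
    by (simp add: tassoc_tlift tlift_tens modules_tensor tens_in_tensor tlift_rep)
  also have "\<dots> = tclass (tensor A B) C p (ascF A B i a (j, b, c))"
    using balanced_ascF[OF m *(1), of p] n p
    by (intro tlift_tens * m) simp
  also have "\<dots> = tens (tensor A B) C (i + j) k (tens A B i j a b) c"
    by (simp add: ascF_def tclass_delta n p)
  finally show ?thesis .
qed

lemma app_asc_inv:
  assumes "chain_complex A" "chain_complex B" "chain_complex C"
    and *: "a \<in> cset A i" "b \<in> cset B j" "c \<in> cset C k" and n: "n = i + j" and p: "p = n + k"
  shows "app (asc_inv A B C) p (tens (tensor A B) C n k (tens A B i j a b) c) =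
    tens A (tensor B C) i (j + k) a (tens B C j k b c)"
proof -
  note m = assms(1-3)[THEN chain_complex_modules]
  have "app (asc_inv A B C) p (tens (tensor A B) C n k (tens A B i j a b) c) =
    tlift A (tensor B C) p (\<lambda>(i, Y, c). lext (asc_invF B C p i c) (rep Y)) (tens (tensor A B) C n k (tens A B i j a b) c)"
    unfolding asc_inv_def n p using * by (intro app_mk tens_in_tensor)
  also have "\<dots> = tlift A (tensor B C) p (asc_invF B C p n c) (tens A B i j a b)"
    using balanced_asc_inv[OF m, of p] m * n p
    by (simp add: tlift_tens modules_tensor tens_in_tensor tlift_rep)
  also have "\<dots> = tclass A (tensor B C) p (asc_invF B C p n c (i, a, b))"
    using balanced_asc_invF[OF m, of c p n] n p *
    by (intro tlift_tens * m) simp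
  also have "\<dots> = tens A (tensor B C) i (j + k) a (tens B C j k b c)"
    by (simp add: asc_invF_def tclass_delta n p add.assoc)
  finally show ?thesis .
qed

lemma asc_asc_inv [simp]:
  assumes "chain_complex A" "chain_complex B" "chain_complex C"
  shows "asc A B C \<odot> asc_inv A B C = idt (tensor (tensor A B) C)"
    "asc_inv A B C \<odot> asc A B C = idt (tensor A (tensor B C))"
proof -
  show "asc A B C \<odot> asc_inv A B C = idt (tensor (tensor A B) C)"
    by (rule ten3_left_eqI[of _ _ A B C]) (use assms in \<open>simp_all add: app_ops tens_in_tensor' app_asc app_asc_inv\<close>)
  show "asc_inv A B C \<odot> asc A B C = idt (tensor A (tensor B C))"
    by (rule ten3_right_eqI[of _ _ A B C])
       (use assms in \<open>simp_all add: app_ops tens_in_tensor' app_asc app_asc_inv\<close>)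
qed

text \<open>For graded maps the Koszul exponents on both sides have to agree:
  \<open>(deg g + deg h) * i + deg h * j\<close> for the right bracketing,
  \<open>deg h * (i + j) + deg g * i\<close> for the left one.\<close>

lemma asc_natural:
  assumes "arr f" "arr g" "arr h"
  shows "asc (tgt f) (tgt g) (tgt h) \<odot> (f \<otimes> (g \<otimes> h)) = ((f \<otimes> g) \<otimes> h) \<odot> asc (src f) (src g) (src h)"
proof (rule ten3_right_eqI[of _ _ "src f" "src g" "src h"])
  fix i j k a b c assume *: "a \<in> cset (src f) i" "b \<in> cset (src g) j" "c \<in> cset (src h) k"
  note cl = app_closed[OF assms(1) *(1)] app_closed[OF assms(2) *(2)] app_closed[OF assms(3) *(3)]
  let ?a = "app f i a" and ?b = "app g j b" and ?c = "app h k c"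
  let ?A = "tgt f" and ?B = "tgt g" and ?C = "tgt h"
  let ?BC = "tensor ?B ?C"  and ?AB = "tensor ?A ?B"
  let ?i = "i + deg f" and ?j = "j + deg g" and ?k = "k + deg h" and ?q = "i + (j + k) + (deg f + (deg g + deg h))"
  let ?s = "sgnpow ((deg g + deg h) * i) * sgnpow (deg h * j)"
  note tl = tens_smult_right tens_smult_left chain_complex_modules modules_tensor
  have bc: "app (g \<otimes> h) (j + k) (tens (src g) (src h) j k b c) =
    csmult ?BC (j + k + (deg g + deg h)) (sgnpow (deg h * j)) (tens ?B ?C ?j ?k ?b ?c)"
    by (rule app_ten) (use assms * in auto)
  have ab: "app (f \<otimes> g) (i + j) (tens (src f) (src g) i j a b) =
    csmult ?AB (i + j + (deg f + deg g)) (sgnpow (deg g * i)) (tens ?A ?B ?i ?j ?a ?b)"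
    by (rule app_ten) (use assms * in auto)
  have tbc: "tens ?B ?C ?j ?k ?b ?c \<in> cset ?BC (j + k + (deg g + deg h))"
    and tab: "tens ?A ?B ?i ?j ?a ?b \<in> cset ?AB (i + j + (deg f + deg g))"
    using cl by (auto intro!: tens_in_tensor')
  have tabc: "tens ?A ?BC ?i (j + k + (deg g + deg h)) ?a (tens ?B ?C ?j ?k ?b ?c) \<in> cset (tensor ?A ?BC) ?q"
    "tens ?AB ?C (i + j + (deg f + deg g)) ?k (tens ?A ?B ?i ?j ?a ?b) ?c \<in> cset (tensor ?AB ?C) ?q"
    using cl tbc tab by (auto intro!: tens_in_tensor')
  have eqs: "i + deg f + (j + k + (deg g + deg h)) = ?q" "i + j + (deg f + deg g) + (k + deg h) = ?q"
    "i + j + k + (deg f + deg g + deg h) = ?q" by simp_all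
  have "app (f \<otimes> (g \<otimes> h)) (i + (j + k)) (tens (src f) (tensor (src g) (src h)) i (j + k) a (tens (src g) (src h) j k b c))
    = csmult (tensor ?A ?BC) ?q (sgnpow ((deg g + deg h) * i))
       (tens ?A ?BC ?i (j + k + (deg g + deg h)) ?a (app (g \<otimes> h) (j + k) (tens (src g) (src h) j k b c)))"
    using app_ten[of f "g \<otimes> h" a i "tens (src g) (src h) j k b c" "j + k"] assms * by (simp add: tens_in_tensor)
  also have "\<dots> = csmult (tensor ?A ?BC) ?q ?s (tens ?A ?BC ?i (j + k + (deg g + deg h)) ?a (tens ?B ?C ?j ?k ?b ?c))"
    using cl tbc assms by (simp add: bc tl eqs tabc flip: module_smult_mult[OF modulesD[OF modules_tensor]])
  finally have L: "app (f \<otimes> (g \<otimes> h)) (i + (j + k)) (tens (src f) (tensor (src g) (src h)) i (j + k) a (tens (src g) (src h) j k b c)) = \<dots>" .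
  have "app ((f \<otimes> g) \<otimes> h) (i + (j + k)) (tens (tensor (src f) (src g)) (src h) (i + j) k (tens (src f) (src g) i j a b) c)
    = csmult (tensor ?AB ?C) ?q (sgnpow (deg h * (i + j)))
       (tens ?AB ?C (i + j + (deg f + deg g)) ?k (app (f \<otimes> g) (i + j) (tens (src f) (src g) i j a b)) ?c)"
    using app_ten[of "f \<otimes> g" h "tens (src f) (src g) i j a b" "i + j" c k] assms * by (simp add: tens_in_tensor eqs add.assoc)
  also have "\<dots> = csmult (tensor ?AB ?C) ?q (sgnpow (deg h * (i + j)) * sgnpow (deg g * i)) (tens ?AB ?C (i + j + (deg f + deg g)) ?k (tens ?A ?B ?i ?j ?a ?b) ?c)"
    using cl tab assms by (simp add: ab tl eqs tabc flip: module_smult_mult[OF modulesD[OF modules_tensor]])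
  also have "sgnpow (deg h * (i + j)) * sgnpow (deg g * i) = ?s" by (simp add: sgnpow_add algebra_simps)
  finally have R: "app ((f \<otimes> g) \<otimes> h) (i + (j + k)) (tens (tensor (src f) (src g)) (src h) (i + j) k (tens (src f) (src g) i j a b) c) = 
    csmult (tensor ?AB ?C) ?q ?s (tens ?AB ?C (i + j + (deg f + deg g)) ?k (tens ?A ?B ?i ?j ?a ?b) ?c)" .
  have "app (asc ?A ?B ?C) ?q (tens ?A ?BC ?i (j + k + (deg g + deg h)) ?a (tens ?B ?C ?j ?k ?b ?c)) =
    tens ?AB ?C (?i + ?j) ?k (tens ?A ?B ?i ?j ?a ?b) ?c"
    by (rule app_asc) (use assms cl in auto)
  moreover have "?i + ?j = i + j + (deg f + deg g)" by simp
  ultimately have asc1: "app (asc ?A ?B ?C) ?q (csmult (tensor ?A ?BC) ?q ?s (tens ?A ?BC ?i (j + k + (deg g + deg h)) ?a (tens ?B ?C ?j ?k ?b ?c)))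
    = csmult (tensor ?AB ?C) ?q ?s (tens ?AB ?C (i + j + (deg f + deg g)) ?k (tens ?A ?B ?i ?j ?a ?b) ?c)"
    using linmap_smult[OF arr_linmap[of "asc ?A ?B ?C"] tabc(1)] assms by simp
  have asc2: "app (asc (src f) (src g) (src h)) (i + (j + k)) (tens (src f) (tensor (src g) (src h)) i (j + k) a (tens (src g) (src h) j k b c))
    = tens (tensor (src f) (src g)) (src h) (i + j) k (tens (src f) (src g) i j a b) c"
    by (rule app_asc) (use assms * in auto)
  show "app (asc ?A ?B ?C \<odot> (f \<otimes> (g \<otimes> h))) (i + (j + k)) (tens (src f) (tensor (src g) (src h)) i (j + k) a (tens (src g) (src h) j k b c))
    = app (((f \<otimes> g) \<otimes> h) \<odot> asc (src f) (src g) (src h)) (i + (j + k)) (tens (src f) (tensor (src g) (src h)) i (j + k) a (tens (src g) (src h) j k b c))"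
    using * by (simp add: app_ops tens_in_tensor L R asc1 asc2)
qed (use assms in auto)

lemma asc_inv_natural:
  assumes "arr f" "arr g" "arr h"
  shows "asc_inv (tgt f) (tgt g) (tgt h) \<odot> ((f \<otimes> g) \<otimes> h) = (f \<otimes> (g \<otimes> h)) \<odot> asc_inv (src f) (src g) (src h)"
proof -
  let ?l = "asc_inv (tgt f) (tgt g) (tgt h)" and ?m = "(f \<otimes> g) \<otimes> h" and ?r = "asc_inv (src f) (src g) (src h)"
  have "?l \<odot> ?m = ?l \<odot> (?m \<odot> asc (src f) (src g) (src h)) \<odot> ?r"
    using assms by (simp add: cmp_assoc)
  also have "\<dots> = (?l \<odot> asc (tgt f) (tgt g) (tgt h)) \<odot> (f \<otimes> (g \<otimes> h)) \<odot> ?r"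
    using assms by (simp add: cmp_assoc del: asc_asc_inv flip: asc_natural)
  finally show ?thesis using assms by simp
qed

text \<open>The differential of a triple tensor product is a sum of three terms with one
  \<open>dif\<close> each, and naturality carries each of them through the associator.\<close>

lemma bdry_asc_inv:
  assumes "chain_complex A" "chain_complex B" "chain_complex C"
  shows "bdry (asc_inv A B C) = null (tensor (tensor A B) C) (tensor A (tensor B C)) (- 1)"
proof -
  note n = asc_inv_natural[of "dif A" "idt B" "idt C"] asc_inv_natural[of "idt A" "dif B" "idt C"]
    asc_inv_natural[of "idt A" "idt B" "dif C"]
  show ?thesis
    using assms n
    apply (simp add: bdry_def dif_tensor cmp_linear_left cmp_linear_right ten_linear_left ten_linear_right flip: ten_idt)
    apply (rule hval_unique, simp)
    apply (rule hval_ops | (rule hval_null; simp) | (rule hval_atom; simp))+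
    apply (simp add: algebra_simps)
    done
qed

lemma pentagon:
  assumes "chain_complex A" "chain_complex B" "chain_complex C" "chain_complex D"
  shows "(idt A \<otimes> asc_inv B C D) \<odot> asc_inv A (tensor B C) D \<odot> (asc_inv A B C \<otimes> idt D) =
    asc_inv A B (tensor C D) \<odot> asc_inv (tensor A B) C D"
proof (rule ten4_left_eqI[of _ _ A B C D])
  fix i j k l a b c d assume *: "a \<in> cset A i" "b \<in> cset B j" "c \<in> cset C k" "d \<in> cset D l"
  note m1 = module_smult_one[OF modulesD[OF modules_tensor]]
  let ?abc = "tens (tensor A B) C (i + j) k (tens A B i j a b) c"
  let ?abcd = "tens (tensor (tensor A B) C) D (i + j + k) l ?abc d"
  have 1: "app (asc_inv A B C \<otimes> idt D) (i + j + k + l) ?abcd =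
    tens (tensor A (tensor B C)) D (i + j + k) l (tens A (tensor B C) i (j + k) a (tens B C j k b c)) d"
    using app_ten[of "asc_inv A B C" "idt D" ?abc "i + j + k" d l "i + j + k + l"] assms *
    by (simp add: tens_in_tensor' app_asc_inv app_ops m1)
  have 2: "app (idt A \<otimes> asc_inv B C D) (i + j + k + l) (tens A (tensor (tensor B C) D) i (j + k + l) a (tens (tensor B C) D (j + k) l (tens B C j k b c) d)) =
    tens A (tensor B (tensor C D)) i (j + k + l) a (tens B (tensor C D) j (k + l) b (tens C D k l c d))"
    using app_ten[of "idt A" "asc_inv B C D" a i "tens (tensor B C) D (j + k) l (tens B C j k b c) d" "j + k + l" "i + j + k + l"] assms *
    by (simp add: tens_in_tensor' app_asc_inv app_ops m1)
  show "app ((idt A \<otimes> asc_inv B C D) \<odot> asc_inv A (tensor B C) D \<odot> (asc_inv A B C \<otimes> idt D)) (i + j + k + l) ?abcd =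
    app (asc_inv A B (tensor C D) \<odot> asc_inv (tensor A B) C D) (i + j + k + l) ?abcd"
    using assms * by (simp add: app_ops tens_in_tensor' 1 2 app_asc_inv) (simp add: add.assoc)
qed (use assms in auto)

section \<open>Homotopy equivalences\<close>

lemma plus_null [simp]:
  "arr f \<Longrightarrow> src f = A \<Longrightarrow> tgt f = B \<Longrightarrow> deg f = n \<Longrightarrow> null A B n \<oplus> f = f"
  "arr f \<Longrightarrow> src f = A \<Longrightarrow> tgt f = B \<Longrightarrow> deg f = n \<Longrightarrow> f \<oplus> null A B n = f"
  by (hypsubst+, rule hval_unique, simp, (rule hval_ops | (rule hval_null; simp) | (rule hval_atom; simp))+, simp)+

lemma scale_null [simp]: "chain_complex A \<Longrightarrow> chain_complex B \<Longrightarrow> r \<star> null A B n = null A B n"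
  by (rule hval_unique, simp, (rule hval_ops | (rule hval_null; simp) | (rule hval_atom; simp))+, simp)

lemma scale_one [simp]: "arr f \<Longrightarrow> 1 \<star> f = f"
  by (rule hval_unique, simp, (rule hval_ops | (rule hval_null; simp) | (rule hval_atom; simp))+, simp)

lemmas dg_linear = cmp_linear_left cmp_linear_right ten_linear_left ten_linear_right bdry_linear

text \<open>In right-nested composites two adjacent tensor products do not form a subterm when
  another map follows; this version of the interchange law reaches them.\<close>

lemma ten_cmp_assoc:
  assumes "arr f" "arr g" "arr f'" "arr g'" "src f' = tgt f" "src g' = tgt g" "arr z" "tgt z = tensor (src f) (src g)"
  shows "(f' \<otimes> g') \<odot> (f \<otimes> g) \<odot> z = sgnpow (deg g' * deg f) \<star> (((f' \<odot> f) \<otimes> (g' \<odot> g)) \<odot> z)"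
  using assms by (simp add: ten_cmp dg_linear flip: cmp_assoc)

definition chain_arr where
  "chain_arr f A B \<longleftrightarrow> arr f \<and> src f = A \<and> tgt f = B \<and> deg f = 0 \<and> bdry f = null A B (- 1)"

lemma chain_arrD:
  assumes "chain_arr f A B"
  shows "arr f" "src f = A" "tgt f = B" "deg f = 0" "bdry f = null A B (- 1)"
    "chain_complex A" "chain_complex B"
  using assms by (auto simp: chain_arr_def)

lemma chain_arr_cmp:
  assumes "chain_arr f A B" "chain_arr g B C"
  shows "chain_arr (g \<odot> f) A C"
  unfolding chain_arr_def using assms[THEN chain_arrD(1)]
  by (simp add: bdry_cmp dg_linear chain_arrD[OF assms(1)] chain_arrD[OF assms(2)])

lemma chain_arr_ten:
  assumes "chain_arr f A B" "chain_arr g C D"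
  shows "chain_arr (f \<otimes> g) (tensor A C) (tensor B D)"
  unfolding chain_arr_def using assms[THEN chain_arrD(1)]
  by (simp add: bdry_ten dg_linear chain_arrD[OF assms(1)] chain_arrD[OF assms(2)])

lemma chain_arr_idt: "chain_complex A \<Longrightarrow> chain_arr (idt A) A A"
  by (simp add: chain_arr_def bdry_idt)

definition heq where
  "heq f A B \<longleftrightarrow> chain_arr f A B \<and> (\<exists>g s t. chain_arr g B A \<and>
     arr t \<and> src t = A \<and> tgt t = A \<and> deg t = 1 \<and> g \<odot> f = idt A \<oplus> bdry t \<and>
     arr s \<and> src s = B \<and> tgt s = B \<and> deg s = 1 \<and> f \<odot> g = idt B \<oplus> bdry s)"

lemma heqE:
  assumes "heq f A B"
  obtains g s t where "chain_arr f A B" "chain_arr g B A" 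
    "arr t" "src t = A" "tgt t = A" "deg t = 1" "g \<odot> f = idt A \<oplus> bdry t"
    "arr s" "src s = B" "tgt s = B" "deg s = 1" "f \<odot> g = idt B \<oplus> bdry s"
  using assms by (auto simp: heq_def)

lemma heq_cmp:
  assumes "heq f A B" "heq f' B C"
  shows "heq (f' \<odot> f) A C"
proof -
  obtain g s t where f: "chain_arr f A B" "chain_arr g B A" 
    and t: "arr t" "src t = A" "tgt t = A" "deg t = 1" "g \<odot> f = idt A \<oplus> bdry t"
    and s: "arr s" "src s = B" "tgt s = B" "deg s = 1" "f \<odot> g = idt B \<oplus> bdry s"
    using assms(1) by (rule heqE)
  obtain g' s' t' where f': "chain_arr f' B C" "chain_arr g' C B" 
    and t': "arr t'" "src t' = B" "tgt t' = B" "deg t' = 1" "g' \<odot> f' = idt B \<oplus> bdry t'"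
    and s': "arr s'" "src s' = C" "tgt s' = C" "deg s' = 1" "f' \<odot> g' = idt C \<oplus> bdry s'"
    using assms(2) by (rule heqE)
  note [simp] = f[THEN chain_arrD(1)] f[THEN chain_arrD(2)] f[THEN chain_arrD(3)] f[THEN chain_arrD(4)] f[THEN chain_arrD(5)]
    f'[THEN chain_arrD(1)] f'[THEN chain_arrD(2)] f'[THEN chain_arrD(3)] f'[THEN chain_arrD(4)] f'[THEN chain_arrD(5)]
    chain_arrD(6,7)[OF f(1)] chain_arrD(7)[OF f'(1)] s(1-4) t(1-4) s'(1-4) t'(1-4)
  \<comment> \<open>The homotopy of the inner pair is carried to \<open>A\<close> by the chain maps
    \<open>g\<close> and \<open>f\<close>, through which boundaries pass, and added to the homotopy
    of the outer pair.\<close>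
  have 1: "(g \<odot> g') \<odot> (f' \<odot> f) = idt A \<oplus> bdry (t \<oplus> g \<odot> t' \<odot> f)"
  proof -
    have "(g \<odot> g') \<odot> (f' \<odot> f) = g \<odot> (g' \<odot> f') \<odot> f" by (simp add: cmp_assoc)
    also have "\<dots> = g \<odot> f \<oplus> g \<odot> bdry t' \<odot> f" by (simp add: t'(5) dg_linear)
    also have "\<dots> = (idt A \<oplus> bdry t) \<oplus> g \<odot> bdry t' \<odot> f" by (simp add: t(5))
    also have "\<dots> = idt A \<oplus> bdry (t \<oplus> g \<odot> t' \<odot> f)"
      apply (simp add: dg_linear bdry_cmp)
      apply (rule hval_unique, simp)
      apply (rule hval_ops | (rule hval_null; simp) | (rule hval_atom; simp))+
      apply (simp add: algebra_simps)
      done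
    finally show ?thesis .
  qed
  have 2: "(f' \<odot> f) \<odot> (g \<odot> g') = idt C \<oplus> bdry (s' \<oplus> f' \<odot> s \<odot> g')"
  proof -
    have "(f' \<odot> f) \<odot> (g \<odot> g') = f' \<odot> (f \<odot> g) \<odot> g'" by (simp add: cmp_assoc)
    also have "\<dots> = f' \<odot> g' \<oplus> f' \<odot> bdry s \<odot> g'" by (simp add: s(5) dg_linear)
    also have "\<dots> = (idt C \<oplus> bdry s') \<oplus> f' \<odot> bdry s \<odot> g'" by (simp add: s'(5))
    also have "\<dots> = idt C \<oplus> bdry (s' \<oplus> f' \<odot> s \<odot> g')"
      apply (simp add: dg_linear bdry_cmp)
      apply (rule hval_unique, simp)
      apply (rule hval_ops | (rule hval_null; simp) | (rule hval_atom; simp))+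
      apply (simp add: algebra_simps)
      done
    finally show ?thesis .
  qed
  show ?thesis
    unfolding heq_def
    using chain_arr_cmp[OF f(1) f'(1)] chain_arr_cmp[OF f'(2) f(2)]
    by (intro conjI exI[of _ "g \<odot> g'"] exI[of _ "s' \<oplus> f' \<odot> s \<odot> g'"] exI[of _ "t \<oplus> g \<odot> t' \<odot> f"] 1 2) simp_all
qed

lemma heq_ten_idt:
  assumes "heq f A B" and C: "chain_complex C"
  shows "heq (f \<otimes> idt C) (tensor A C) (tensor B C)"
proof -
  obtain g s t where f: "chain_arr f A B" "chain_arr g B A" 
    and t: "arr t" "src t = A" "tgt t = A" "deg t = 1" "g \<odot> f = idt A \<oplus> bdry t"
    and s: "arr s" "src s = B" "tgt s = B" "deg s = 1" "f \<odot> g = idt B \<oplus> bdry s"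
    using assms(1) by (rule heqE)
  note [simp] = f[THEN chain_arrD(1)] f[THEN chain_arrD(2)] f[THEN chain_arrD(3)] f[THEN chain_arrD(4)] f[THEN chain_arrD(5)]
    chain_arrD(6,7)[OF f(1)] s t C
  have 1: "(g \<otimes> idt C) \<odot> (f \<otimes> idt C) = idt (tensor A C) \<oplus> bdry (t \<otimes> idt C)"
    "(f \<otimes> idt C) \<odot> (g \<otimes> idt C) = idt (tensor B C) \<oplus> bdry (s \<otimes> idt C)"
    by (simp_all add: ten_cmp dg_linear bdry_ten bdry_idt ten_idt)
  show ?thesis
    unfolding heq_def
    using chain_arr_ten[OF f(1) chain_arr_idt[OF C]] chain_arr_ten[OF f(2) chain_arr_idt[OF C]]
    by (intro conjI exI[of _ "g \<otimes> idt C"] exI[of _ "s \<otimes> idt C"] exI[of _ "t \<otimes> idt C"] 1) simp_all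
qed

text \<open>Acyclicity of the cone of the map of hom complexes given by precomposition with \<open>\<phi>\<close>.\<close>

lemma heq_lift:
  assumes "heq \<phi> C D" and a: "arr a" "src a = D" "bdry a = null D E (deg a - 1)" "tgt a = E"
    and k: "arr k" "src k = C" "tgt k = E" "deg k = deg a + 1" "bdry k = a \<odot> \<phi>"
  obtains m l where "arr m" "src m = D" "tgt m = E" "deg m = deg a + 1" "bdry m = a"
    "arr l" "src l = C" "tgt l = E" "deg l = deg a + 2" "m \<odot> \<phi> = k \<oplus> bdry l"
proof -
  obtain \<psi> s t where f: "chain_arr \<phi> C D" "chain_arr \<psi> D C" 
    and t: "arr t" "src t = C" "tgt t = C" "deg t = 1" and \<psi>\<phi>: "\<psi> \<odot> \<phi> = idt C \<oplus> bdry t"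
    and s: "arr s" "src s = D" "tgt s = D" "deg s = 1" and \<phi>\<psi>: "\<phi> \<odot> \<psi> = idt D \<oplus> bdry s"
    using assms(1) by (rule heqE)
  have E: "chain_complex E" using a by auto
  note [simp] = f[THEN chain_arrD(1)] f[THEN chain_arrD(2)] f[THEN chain_arrD(3)] f[THEN chain_arrD(4)] f[THEN chain_arrD(5)]
    chain_arrD(6,7)[OF f(1)] s t a k E
  \<comment> \<open>Since \<open>bdry (k \<odot> \<psi>)\<close> is
    \<open>a \<odot> \<phi> \<odot> \<psi>\<close>, that is
    \<open>a \<oplus> a \<odot> bdry s\<close>, the second summand is chosen to remove the excess;
    its sign undoes that of the Leibniz rule for the cycle \<open>a\<close>.\<close>
  define m' where "m' = k \<odot> \<psi> \<oplus> (- sgnpow (deg a)) \<star> (a \<odot> s)"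
  have m' [simp]: "arr m'" "src m' = D" "tgt m' = E" "deg m' = deg a + 1"
    by (simp_all add: m'_def)
  have bm' [simp]: "bdry m' = a"
    unfolding m'_def
    apply (simp add: dg_linear bdry_cmp cmp_assoc \<phi>\<psi>)
    apply (rule hval_unique, simp)
    apply (rule hval_ops | (rule hval_null; simp) | (rule hval_atom; simp))+
    apply (simp add: algebra_simps)
    done
  \<comment> \<open>The deviation of the pullback of \<open>m'\<close> from \<open>k\<close>: a
    cycle, as both have boundary \<open>a \<odot> \<phi>\<close>, but not necessarily a
    boundary.\<close>
  define c where "c = k \<oplus> (- 1) \<star> (m' \<odot> \<phi>)"
  have c [simp]: "arr c" "src c = C" "tgt c = E" "deg c = deg a + 1"
    by (simp_all add: c_def)
  have bc [simp]: "bdry c = null C E (deg a)"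
    unfolding c_def
    apply (simp add: dg_linear bdry_cmp)
    apply (rule hval_unique, simp)
    apply (rule hval_ops | (rule hval_null; simp) | (rule hval_atom; simp))+
    apply (simp add: algebra_simps)
    done
  show thesis
  \<comment> \<open>Adding the cycle \<open>c \<odot> \<psi>\<close> does not affect the boundary of
    \<open>m'\<close>, and its pullback is \<open>c\<close> up to \<open>c \<odot> bdry t\<close>,
    which is the boundary of the second witness.\<close>
  proof (rule that[of "m' \<oplus> c \<odot> \<psi>" "sgnpow (deg a + 1) \<star> (c \<odot> t)"])
    show "bdry (m' \<oplus> c \<odot> \<psi>) = a"
      by (simp add: dg_linear bdry_cmp)
    have "(m' \<oplus> c \<odot> \<psi>) \<odot> \<phi> = m' \<odot> \<phi> \<oplus> (c \<oplus> c \<odot> bdry t)"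
      by (simp add: dg_linear cmp_assoc \<psi>\<phi>)
    also have "\<dots> = k \<oplus> c \<odot> bdry t"
      unfolding c_def
      apply (simp add: dg_linear)
      apply (rule hval_unique, simp)
      apply (rule hval_ops | (rule hval_null; simp) | (rule hval_atom; simp))+
      apply (simp add: algebra_simps)
      done
    also have "\<dots> = k \<oplus> bdry (sgnpow (deg a + 1) \<star> (c \<odot> t))"
      apply (simp add: dg_linear bdry_cmp)
      apply (rule hval_unique, simp)
      apply (rule hval_ops | (rule hval_null; simp) | (rule hval_atom; simp))+
      apply (simp add: algebra_simps)
      done
    finally show "(m' \<oplus> c \<odot> \<psi>) \<odot> \<phi> = k \<oplus> bdry (sgnpow (deg a + 1) \<star> (c \<odot> t))" .
  qed simp_all
qed

section \<open>The obstruction calculus\<close>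

lemma cmp_extend:
  "f \<odot> g = u \<Longrightarrow> arr z \<Longrightarrow> arr g \<Longrightarrow> arr f \<Longrightarrow> src g = tgt z \<Longrightarrow> src f = tgt g \<Longrightarrow>
    f \<odot> g \<odot> z = u \<odot> z"
  by (simp flip: cmp_assoc)

text \<open>A homotopy semigroup on the objects 1 to 4, as equations between graded maps. The
  equations \<open>simplicial\<close> are oriented for rewriting: \<open>s0 \<odot> t0\<close>,
  \<open>s0 \<odot> t2\<close> and \<open>s1 \<odot> t1\<close> remain as normal forms of the three
  surjections from 4 to 2.\<close>

locale low_semigroup =
  fixes X1 X2 X3 X4 :: "('r::comm_ring_1, 'a) cx"
    and \<mu> s0 s1 t0 t1 t2 :: "('r, 'a, 'a) arrow"
    and x11 x21 x12 x31 x22 x13 :: "('r, 'a, (int \<times> 'a \<times> 'a \<Rightarrow> 'r) set) arrow"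
  assumes maps: "chain_arr \<mu> X2 X1" "chain_arr s0 X3 X2" "chain_arr s1 X3 X2"
      "chain_arr t0 X4 X3" "chain_arr t1 X4 X3" "chain_arr t2 X4 X3"
      "chain_arr x11 X2 (tensor X1 X1)" "chain_arr x21 X3 (tensor X2 X1)" "chain_arr x12 X3 (tensor X1 X2)"
      "chain_arr x31 X4 (tensor X3 X1)" "chain_arr x22 X4 (tensor X2 X2)" "chain_arr x13 X4 (tensor X1 X3)"
    and simplicial: "\<mu> \<odot> s1 = \<mu> \<odot> s0" "s0 \<odot> t1 = s0 \<odot> t0" "s1 \<odot> t0 = s0 \<odot> t2" "s1 \<odot> t2 = s1 \<odot> t1"
    and natural: "(\<mu> \<otimes> idt X1) \<odot> x21 = x11 \<odot> s0" "(idt X1 \<otimes> \<mu>) \<odot> x12 = x11 \<odot> s1"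
      "(s0 \<otimes> idt X1) \<odot> x31 = x21 \<odot> t0" "(s1 \<otimes> idt X1) \<odot> x31 = x21 \<odot> t1"
      "(idt X2 \<otimes> \<mu>) \<odot> x22 = x21 \<odot> t2" "(\<mu> \<otimes> idt X2) \<odot> x22 = x12 \<odot> t0"
      "(idt X1 \<otimes> s0) \<odot> x13 = x12 \<odot> t1" "(idt X1 \<otimes> s1) \<odot> x13 = x12 \<odot> t2"
    and coassoc: "(x11 \<otimes> idt X1) \<odot> x21 = asc X1 X1 X1 \<odot> (idt X1 \<otimes> x11) \<odot> x12"
      "(x21 \<otimes> idt X1) \<odot> x31 = asc X2 X1 X1 \<odot> (idt X2 \<otimes> x11) \<odot> x22"
      "(x12 \<otimes> idt X1) \<odot> x31 = asc X1 X2 X1 \<odot> (idt X1 \<otimes> x21) \<odot> x13"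
      "(x11 \<otimes> idt X2) \<odot> x22 = asc X1 X1 X2 \<odot> (idt X1 \<otimes> x12) \<odot> x13"
    and heq: "heq x11 X2 (tensor X1 X1)" "heq x21 X3 (tensor X2 X1)" "heq x31 X4 (tensor X3 X1)"
begin

lemmas maps_simps [simp] = maps[THEN chain_arrD(1)] maps[THEN chain_arrD(2)] maps[THEN chain_arrD(3)]
  maps[THEN chain_arrD(4)] maps[THEN chain_arrD(5)]
lemmas X_complex [simp] = chain_arrD(6)[OF maps(1)] chain_arrD(7)[OF maps(1)] chain_arrD(6)[OF maps(2)]
  chain_arrD(6)[OF maps(4)]

abbreviation "I \<equiv> idt X1"
abbreviation "AA \<equiv> tensor X1 X1"
abbreviation "ai \<equiv> asc_inv X1 X1 X1"
abbreviation "x3 \<equiv> (x11 \<otimes> I) \<odot> x21"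
abbreviation "x4 \<equiv> (x3 \<otimes> I) \<odot> x31"

lemma heq_x3: "heq x3 X3 (tensor AA X1)"
  by (rule heq_cmp[OF heq(2) heq_ten_idt[OF heq(1)]]) simp

lemma heq_x4: "heq x4 X4 (tensor (tensor AA X1) X1)"
  by (rule heq_cmp[OF heq(3) heq_ten_idt[OF heq_x3]]) simp

end

section \<open>The associativity defect\<close>

locale low_semigroup_product = low_semigroup +
  fixes m2 h
  assumes m2: "chain_arr m2 AA X1"
    and h: "arr h" "src h = X2" "tgt h = X1" "deg h = 1"
    and m2_x11: "m2 \<odot> x11 = \<mu> \<oplus> bdry h"
begin

lemmas m2_simps [simp] = chain_arrD(1-5)[OF m2] h

lemmas dg_simps = dg_linear cmp_assoc ten_cmp ten_cmp_assoc bdry_cmp bdry_ten bdry_bdry bdry_idt bdry_asc_inv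

definition "defect = m2 \<odot> (I \<otimes> m2) \<odot> ai \<oplus> (- 1) \<star> (m2 \<odot> (m2 \<otimes> I))"

definition "defect_bound = h \<odot> s1 \<oplus> m2 \<odot> (I \<otimes> h) \<odot> x12 \<oplus> (- 1) \<star> (h \<odot> s0) \<oplus> (- 1) \<star> (m2 \<odot> (h \<otimes> I) \<odot> x21)"

lemma defect_sel [simp]: "arr defect" "src defect = tensor AA X1" "tgt defect = X1" "deg defect = 0"
  by (simp_all add: defect_def)

lemma defect_bound_sel [simp]: "arr defect_bound" "src defect_bound = X3" "tgt defect_bound = X1" "deg defect_bound = 1"
  by (simp_all add: defect_bound_def)

lemma bdry_defect: "bdry defect = null (tensor AA X1) X1 (- 1)"
  by (simp add: defect_def dg_simps)

lemmas m2_x11' = cmp_extend[OF m2_x11]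

lemma ai_coassoc:
  "ai \<odot> (x11 \<otimes> I) \<odot> x21 = (I \<otimes> x11) \<odot> x12"
  by (simp add: coassoc(1) flip: cmp_assoc)

text \<open>Replacing \<open>m2 \<odot> x11\<close> by \<open>\<mu> \<oplus> bdry h\<close> twice
  turns the pullback of the right bracketing into \<open>\<mu> \<odot> s1\<close> plus the boundary
  of the first two summands, and that of the left bracketing into \<open>\<mu> \<odot> s0\<close>
  plus the boundary of the two terms subtracted. The two composites with \<open>\<mu>\<close>
  agree.\<close>

lemma bdry_defect_bound: "bdry defect_bound = defect \<odot> x3"
  unfolding defect_bound_def defect_def
  apply (simp add: dg_simps ai_coassoc m2_x11 m2_x11' natural simplicial)
  apply (rule hval_unique, simp)
   apply (rule hval_ops | (rule hval_null; simp) | (rule hval_atom; simp))+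
  apply (simp add: algebra_simps)
  done

end

section \<open>The obstruction to the quaternary operation\<close>

locale low_semigroup_A3 = low_semigroup_product +
  fixes m3 l
  assumes m3: "arr m3" "src m3 = tensor AA X1" "tgt m3 = X1" "deg m3 = 1" "bdry m3 = defect"
    and l: "arr l" "src l = X3" "tgt l = X1" "deg l = 2"
    and m3_x3: "m3 \<odot> x3 = defect_bound \<oplus> bdry l"
begin

lemmas m3_simps [simp] = m3 l

text \<open>Right-hand side of the relation for \<open>m4\<close>, with associators starting from
  the left bracketing. The sign \<open>(-1)^p1\<close> of the last summand is the Koszul sign of
  \<open>I \<otimes> m3\<close> and hence not written.\<close>

definition "obstruction = (- 1) \<star> (m3 \<odot> ((m2 \<otimes> I) \<otimes> I)) \<oplus> m3 \<odot> (((I \<otimes> m2) \<odot> ai) \<otimes> I)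
   \<oplus> (- 1) \<star> (m3 \<odot> (idt AA \<otimes> m2) \<odot> asc_inv AA X1 X1) \<oplus> m2 \<odot> (m3 \<otimes> I)
   \<oplus> m2 \<odot> (I \<otimes> m3) \<odot> asc_inv X1 AA X1 \<odot> (ai \<otimes> I)"

lemma obstruction_sel [simp]: "arr obstruction" "src obstruction = tensor (tensor AA X1) X1" "tgt obstruction = X1" "deg obstruction = 1"
  by (simp_all add: obstruction_def)

text \<open>Naturality of the associator with \<open>m2\<close> in the first, second and third
  argument. In the third case the pentagon identity changes the route between bracketings, so that
  the result matches the last summand of \<open>obstruction\<close>.\<close>

lemma ai_m2: 
  "ai \<odot> ((m2 \<otimes> I) \<otimes> I) = (m2 \<otimes> idt AA) \<odot> asc_inv AA X1 X1"
  "ai \<odot> (((I \<otimes> m2) \<odot> ai) \<otimes> I) = (I \<otimes> (m2 \<otimes> I)) \<odot> asc_inv X1 AA X1 \<odot> (ai \<otimes> I)"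
  "ai \<odot> (idt AA \<otimes> m2) \<odot> asc_inv AA X1 X1 = (I \<otimes> ((I \<otimes> m2) \<odot> ai)) \<odot> asc_inv X1 AA X1 \<odot> (ai \<otimes> I)"
proof -
  show "ai \<odot> ((m2 \<otimes> I) \<otimes> I) = (m2 \<otimes> idt AA) \<odot> asc_inv AA X1 X1"
    using asc_inv_natural[of m2 I I] by (simp add: ten_idt)
  have "ai \<odot> (((I \<otimes> m2) \<odot> ai) \<otimes> I) = (ai \<odot> ((I \<otimes> m2) \<otimes> I)) \<odot> (ai \<otimes> I)"
    by (simp add: cmp_assoc ten_cmp)
  also have "\<dots> = (I \<otimes> (m2 \<otimes> I)) \<odot> asc_inv X1 AA X1 \<odot> (ai \<otimes> I)"
    using asc_inv_natural[of I m2 I] by (simp add: cmp_assoc)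
  finally show "ai \<odot> (((I \<otimes> m2) \<odot> ai) \<otimes> I) = (I \<otimes> (m2 \<otimes> I)) \<odot> asc_inv X1 AA X1 \<odot> (ai \<otimes> I)" .
  have "ai \<odot> (idt AA \<otimes> m2) \<odot> asc_inv AA X1 X1 = (ai \<odot> ((I \<otimes> I) \<otimes> m2)) \<odot> asc_inv AA X1 X1"
    by (simp add: cmp_assoc ten_idt)
  also have "\<dots> = (I \<otimes> (I \<otimes> m2)) \<odot> asc_inv X1 X1 AA \<odot> asc_inv AA X1 X1"
    using asc_inv_natural[of I I m2] by (simp add: cmp_assoc)
  also have "\<dots> = (I \<otimes> ((I \<otimes> m2) \<odot> ai)) \<odot> asc_inv X1 AA X1 \<odot> (ai \<otimes> I)"
    by (simp add: pentagon[symmetric] ten_cmp_assoc)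
  finally show "ai \<odot> (idt AA \<otimes> m2) \<odot> asc_inv AA X1 X1 = (I \<otimes> ((I \<otimes> m2) \<odot> ai)) \<odot> asc_inv X1 AA X1 \<odot> (ai \<otimes> I)" .
qed

text \<open>Each of the five summands contributes one \<open>defect\<close>, a difference of two
  bracketings, like an edge of the Stasheff pentagon; each of the five bracketings of four factors
  then occurs twice with opposite signs.\<close>

lemma bdry_obstruction: "bdry obstruction = null (tensor (tensor AA X1) X1) X1 0"
  unfolding obstruction_def
  apply (simp add: dg_simps defect_def)
  apply (simp add: dg_simps ai_m2)
  apply (rule hval_unique, simp)
   apply (rule hval_ops | (rule hval_null; simp) | (rule hval_atom; simp))+
  apply (simp add: algebra_simps)
  done

text \<open>Naturality trades a merging map in one tensor factor for \<open>t0\<close>,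
  \<open>t1\<close> or \<open>t2\<close> in front of the splitting, so that contributions from
  different splittings of \<open>X4\<close> become comparable.\<close>

lemma split_ten:
  "((x11 \<odot> s0) \<otimes> I) \<odot> x31 = x3 \<odot> t0"
  "((x11 \<odot> s1) \<otimes> I) \<odot> x31 = x3 \<odot> t1"
  "(x11 \<otimes> \<mu>) \<odot> x22 = x3 \<odot> t2"
  "((h \<odot> s0) \<otimes> I) \<odot> x31 = (h \<otimes> I) \<odot> x21 \<odot> t0"
  "((h \<odot> s1) \<otimes> I) \<odot> x31 = (h \<otimes> I) \<odot> x21 \<odot> t1"
  "(h \<otimes> \<mu>) \<odot> x22 = (h \<otimes> I) \<odot> x21 \<odot> t2"
  "(\<mu> \<otimes> h) \<odot> x22 = (I \<otimes> h) \<odot> x12 \<odot> t0"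
  "(I \<otimes> (h \<odot> s0)) \<odot> x13 = (I \<otimes> h) \<odot> x12 \<odot> t1"
  "(I \<otimes> (h \<odot> s1)) \<odot> x13 = (I \<otimes> h) \<odot> x12 \<odot> t2"
  by (simp_all add: cmp_assoc ten_cmp_assoc flip: natural)

text \<open>Here coassociativity absorbs the associator, at the price of passing to a splitting of
  \<open>X4\<close> with a shorter first block: from 3 + 1 to 2 + 2 or 1 + 3, and from 2 + 2 to 1 +
  3.\<close>

lemma asc_H:
  "ai \<odot> ((((h \<otimes> I) \<odot> x21) \<otimes> I) \<odot> x31) = (h \<otimes> x11) \<odot> x22"
  "ai \<odot> ((((I \<otimes> h) \<odot> x12) \<otimes> I) \<odot> x31) = (I \<otimes> ((h \<otimes> I) \<odot> x21)) \<odot> x13"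
  "ai \<odot> (x11 \<otimes> h) \<odot> x22 = (I \<otimes> ((I \<otimes> h) \<odot> x12)) \<odot> x13"
  "asc_inv AA X1 X1 \<odot> (x3 \<otimes> I) \<odot> x31 = (x11 \<otimes> x11) \<odot> x22"
  "asc_inv X1 AA X1 \<odot> (((I \<otimes> x11) \<odot> x12) \<otimes> I) \<odot> x31 = (I \<otimes> x3) \<odot> x13"
proof -
  have *: "asc_inv X2 X1 X1 \<odot> (x21 \<otimes> I) \<odot> x31 = (idt X2 \<otimes> x11) \<odot> x22"
    "asc_inv X1 X2 X1 \<odot> (x12 \<otimes> I) \<odot> x31 = (I \<otimes> x21) \<odot> x13"
    "asc_inv X1 X1 X2 \<odot> (x11 \<otimes> idt X2) \<odot> x22 = (I \<otimes> x12) \<odot> x13"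
    by (simp_all add: coassoc flip: cmp_assoc)
  have "ai \<odot> ((((h \<otimes> I) \<odot> x21) \<otimes> I) \<odot> x31) = (ai \<odot> ((h \<otimes> I) \<otimes> I)) \<odot> (x21 \<otimes> I) \<odot> x31"
    by (simp add: cmp_assoc ten_cmp_assoc)
  also have "\<dots> = (h \<otimes> x11) \<odot> x22"
    using asc_inv_natural[of h I I] by (simp add: cmp_assoc * ten_idt ten_cmp_assoc)
  finally show "ai \<odot> ((((h \<otimes> I) \<odot> x21) \<otimes> I) \<odot> x31) = (h \<otimes> x11) \<odot> x22" .
  have "ai \<odot> ((((I \<otimes> h) \<odot> x12) \<otimes> I) \<odot> x31) = (ai \<odot> ((I \<otimes> h) \<otimes> I)) \<odot> (x12 \<otimes> I) \<odot> x31"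
    by (simp add: cmp_assoc ten_cmp_assoc)
  also have "\<dots> = (I \<otimes> ((h \<otimes> I) \<odot> x21)) \<odot> x13"
    using asc_inv_natural[of I h I] by (simp add: cmp_assoc * ten_idt ten_cmp_assoc)
  finally show "ai \<odot> ((((I \<otimes> h) \<odot> x12) \<otimes> I) \<odot> x31) = (I \<otimes> ((h \<otimes> I) \<odot> x21)) \<odot> x13" .
  have "ai \<odot> (x11 \<otimes> h) \<odot> x22 = (ai \<odot> ((I \<otimes> I) \<otimes> h)) \<odot> (x11 \<otimes> idt X2) \<odot> x22"
    by (simp add: cmp_assoc ten_idt ten_cmp_assoc)
  also have "\<dots> = (I \<otimes> ((I \<otimes> h) \<odot> x12)) \<odot> x13"
    using asc_inv_natural[of I I h] by (simp add: cmp_assoc * ten_idt ten_cmp_assoc)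
  finally show "ai \<odot> (x11 \<otimes> h) \<odot> x22 = (I \<otimes> ((I \<otimes> h) \<odot> x12)) \<odot> x13" .
  have "asc_inv AA X1 X1 \<odot> (x3 \<otimes> I) \<odot> x31 = (asc_inv AA X1 X1 \<odot> ((x11 \<otimes> I) \<otimes> I)) \<odot> (x21 \<otimes> I) \<odot> x31"
    by (simp add: cmp_assoc ten_cmp_assoc)
  also have "\<dots> = (x11 \<otimes> x11) \<odot> x22"
    using asc_inv_natural[of x11 I I] by (simp add: cmp_assoc * ten_idt ten_cmp_assoc)
  finally show "asc_inv AA X1 X1 \<odot> (x3 \<otimes> I) \<odot> x31 = (x11 \<otimes> x11) \<odot> x22" .
  have "asc_inv X1 AA X1 \<odot> (((I \<otimes> x11) \<odot> x12) \<otimes> I) \<odot> x31 = (asc_inv X1 AA X1 \<odot> ((I \<otimes> x11) \<otimes> I)) \<odot> (x12 \<otimes> I) \<odot> x31"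
    by (simp add: cmp_assoc ten_cmp_assoc)
  also have "\<dots> = (I \<otimes> x3) \<odot> x13"
    using asc_inv_natural[of I x11 I] by (simp add: cmp_assoc * ten_idt ten_cmp_assoc)
  finally show "asc_inv X1 AA X1 \<odot> (((I \<otimes> x11) \<odot> x12) \<otimes> I) \<odot> x31 = (I \<otimes> x3) \<odot> x13" .
qed

text \<open>The summands with \<open>m3\<close> come from trading \<open>m2 \<odot> x11\<close> for
  \<open>\<mu>\<close> inside the arguments of \<open>m3\<close>; their signs are opposite to those
  in \<open>obstruction\<close>, since \<open>bdry (m3 \<odot> Y)\<close> is
  \<open>defect \<odot> Y\<close> minus \<open>m3 \<odot> bdry Y\<close>. The terms in
  \<open>l\<close> repeat the signs of \<open>obstruction\<close>, because
  \<open>m3 \<odot> x3\<close> contains \<open>bdry l\<close>. Of what remains, four terms over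
  \<open>x22\<close> survive, two from \<open>defect\<close> and two from
  \<open>defect_bound\<close>; as \<open>bdry h\<close> is \<open>m2 \<odot> x11\<close> minus
  \<open>\<mu>\<close>, they form the boundary of
  \<open>m2 \<odot> (h \<otimes> h) \<odot> x22\<close>.\<close>

definition "obstruction_bound = m3 \<odot> (((h \<otimes> I) \<odot> x21) \<otimes> I) \<odot> x31 \<oplus> (- 1) \<star> (m3 \<odot> (((I \<otimes> h) \<odot> x12) \<otimes> I) \<odot> x31)
   \<oplus> m3 \<odot> (x11 \<otimes> h) \<odot> x22 \<oplus> m2 \<odot> (h \<otimes> h) \<odot> x22
   \<oplus> (- 1) \<star> (l \<odot> t0) \<oplus> l \<odot> t1 \<oplus> (- 1) \<star> (l \<odot> t2) \<oplus> m2 \<odot> (l \<otimes> I) \<odot> x31 \<oplus> m2 \<odot> (I \<otimes> l) \<odot> x13"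

lemma obstruction_bound_sel [simp]: "arr obstruction_bound" "src obstruction_bound = X4" "tgt obstruction_bound = X1" "deg obstruction_bound = 2"
  by (simp_all add: obstruction_bound_def)

lemma m3_x3': "arr z \<Longrightarrow> tgt z = X3 \<Longrightarrow> m3 \<odot> (x11 \<otimes> I) \<odot> x21 \<odot> z = defect_bound \<odot> z \<oplus> bdry l \<odot> z"
proof -
  assume z: "arr z" "tgt z = X3"
  have "m3 \<odot> (x11 \<otimes> I) \<odot> x21 \<odot> z = (m3 \<odot> x3) \<odot> z" using z by (simp add: cmp_assoc)
  then show ?thesis using z unfolding m3_x3 by (simp add: dg_linear)
qed

lemma bdry_obstruction_bound: "bdry obstruction_bound = obstruction \<odot> x4"
  unfolding obstruction_bound_def obstruction_def
  \<comment> \<open>\<open>defect\<close> and \<open>defect_bound\<close> stay folded while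
    \<open>m3_x3\<close> eliminates \<open>m3\<close> from its composites with \<open>x3\<close>;
    the next line expands both.\<close>
  apply (simp add: dg_simps natural ai_coassoc m2_x11 m2_x11' m3_x3 m3_x3' split_ten asc_H)
  apply (simp add: dg_simps defect_def defect_bound_def natural ai_coassoc m2_x11 m2_x11' split_ten asc_H simplicial)
  apply (rule hval_unique, simp)
   apply (rule hval_ops | (rule hval_null; simp) | (rule hval_atom; simp))+
  apply (simp add: algebra_simps)
  done

end

section \<open>The relations on generators\<close>

lemma chain_arr_chain_map:
  assumes "chain_arr f A B"
  shows "chain_map A B (app f)"
  unfolding chain_map_def
proof (intro allI conjI ballI)
  note f = chain_arrD[OF assms]
  show lin: "linmap A p B p (app f p)" for p by (rule arr_linmap) (use f in auto)
  fix p x assume x: "x \<in> cset A p"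
  have "app (bdry f) p x = czero B (p - 1)" using f x by (simp add: app_ops)
  then have 1: "cadd B (p - 1) (cd B p (app f p x)) (csmult B (p - 1) (- 1) (app f (p - 1) (cd A p x))) = czero B (p - 1)"
    using app_bdry[of f x p] f x by simp
  have c: "cd B p (app f p x) \<in> cset B (p - 1)" "app f (p - 1) (cd A p x) \<in> cset B (p - 1)"
    using x f linmap_closed[OF lin] by (auto intro!: cd_closed)
  have "cd B p (app f p x) = cadd B (p - 1) (czero B (p - 1)) (app f (p - 1) (cd A p x))"
    unfolding 1[symmetric]
    by (rule fval_unique[OF chain_complex_module[OF f(7), of "p - 1"]], (rule fval_add fval_smult | (rule fval_atom; simp add: c))+) simp
  then show "app f (p - 1) (cd A p x) = cd B p (app f p x)"
    using c f by (simp add: module_add_zero_left chain_complex_module)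
qed

lemma tens_add_left':
  assumes "chain_complex A" "chain_complex B" "a \<in> cset A i" "a' \<in> cset A i" "b \<in> cset B j" "i + j = p"
  shows "tens A B i j (cadd A i a a') b = cadd (tensor A B) p (tens A B i j a b) (tens A B i j a' b)"
  using tens_add_left[of A B a i a' b j] assms by (simp add: chain_complex_modules)

lemma tens_smult_left':
  assumes "chain_complex A" "chain_complex B" "a \<in> cset A i" "b \<in> cset B j" "i + j = p"
  shows "tens A B i j (csmult A i r a) b = csmult (tensor A B) p r (tens A B i j a b)"
  using tens_smult_left[of A B a i b j] assms by (simp add: chain_complex_modules)

lemma cd_tens':
  assumes "chain_complex A" "chain_complex B" "a \<in> cset A i" "b \<in> cset B j" "p = i + j" "q = p - 1" "i' = i - 1" "j' = j - 1"
  shows "cd (tensor A B) p (tens A B i j a b) =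
    cadd (tensor A B) q (tens A B i' j (cd A i a) b) (csmult (tensor A B) q (sgnpow i) (tens A B i j' a (cd B j b)))"
  using cd_tens[OF assms(1-4)] assms(5-8) by simp

text \<open>Degrees such as \<open>i - 1 + j\<close> are left unsimplified on purpose: they arise in
  \<open>A4_algebra\<close> when an index of \<open>t3\<close> is lowered, and the terms have to
  match literally.\<close>

lemma cd_tens3:
  assumes A: "chain_complex A" "chain_complex B" "chain_complex C"
    and *: "a \<in> cset A i" "b \<in> cset B j" "c \<in> cset C k"
  shows "cd (tensor (tensor A B) C) (i + j + k) (tens (tensor A B) C (i + j) k (tens A B i j a b) c) =
    cadd (tensor (tensor A B) C) (i + j + k - 1)
      (cadd (tensor (tensor A B) C) (i + j + k - 1)
        (tens (tensor A B) C (i - 1 + j) k (tens A B (i - 1) j (cd A i a) b) c)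
        (csmult (tensor (tensor A B) C) (i + j + k - 1) (sgnpow i)
          (tens (tensor A B) C (i + (j - 1)) k (tens A B i (j - 1) a (cd B j b)) c)))
      (csmult (tensor (tensor A B) C) (i + j + k - 1) (sgnpow (i + j))
        (tens (tensor A B) C (i + j) (k - 1) (tens A B i j a b) (cd C k c)))"
proof -
  have e: "i - 1 + j = i + j - 1" "i + (j - 1) = i + j - 1" by simp_all
  note d = cd_closed[OF A(1) *(1)] cd_closed[OF A(2) *(2)]
  have t: "tens A B (i - 1) j (cd A i a) b \<in> cset (tensor A B) (i + j - 1)"
    "tens A B i (j - 1) a (cd B j b) \<in> cset (tensor A B) (i + j - 1)"
    "tens A B i j a b \<in> cset (tensor A B) (i + j)"
    using d * by (auto intro!: tens_in_tensor')
  show ?thesis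
    unfolding e using A * t
    by (simp add: cd_tens'[where i' = "i + j - 1" and q = "i + j + k - 1"] cd_tens'[of A B a i b j]
      tens_add_left'[where p = "i + j + k - 1"] tens_smult_left'[where p = "i + j + k - 1"] module_smult[OF chain_complex_module])
qed

lemma cd_tens4:
  assumes A: "chain_complex A" "chain_complex B" "chain_complex C" "chain_complex D"
    and *: "a \<in> cset A i" "b \<in> cset B j" "c \<in> cset C k" "d \<in> cset D m"
  defines "T3 \<equiv> tensor (tensor A B) C" and "T4 \<equiv> tensor (tensor (tensor A B) C) D" and "q \<equiv> i + j + k + m - 1"
  defines "t \<equiv> \<lambda>i j k m a b c d. tens T3 D (i + j + k) m (tens (tensor A B) C (i + j) k (tens A B i j a b) c) d"
  shows "cd T4 (i + j + k + m) (t i j k m a b c d) =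
    cadd T4 q (cadd T4 q (cadd T4 q (t (i - 1) j k m (cd A i a) b c d)
       (csmult T4 q (sgnpow i) (t i (j - 1) k m a (cd B j b) c d)))
       (csmult T4 q (sgnpow (i + j)) (t i j (k - 1) m a b (cd C k c) d)))
       (csmult T4 q (sgnpow (i + j + k)) (t i j k (m - 1) a b c (cd D m d)))"
proof -
  let ?t = "\<lambda>i j k a b c. tens (tensor A B) C (i + j) k (tens A B i j a b) c"
  have e: "i - 1 + j + k = i + j + k - 1" "i + (j - 1) + k = i + j + k - 1" "i + j + (k - 1) = i + j + k - 1" by simp_all
  note dc = cd_closed[OF A(1) *(1)] cd_closed[OF A(2) *(2)] cd_closed[OF A(3) *(3)]
  have T: "chain_complex T3" using A by (simp add: T3_def)
  have T4: "T4 = tensor T3 D" by (simp add: T3_def T4_def)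
  have t: "?t i j k a b c \<in> cset T3 (i + j + k)" "?t (i - 1) j k (cd A i a) b c \<in> cset T3 (i + j + k - 1)"
    "?t i (j - 1) k a (cd B j b) c \<in> cset T3 (i + j + k - 1)" "?t i j (k - 1) a b (cd C k c) \<in> cset T3 (i + j + k - 1)"
    unfolding T3_def using dc * by (auto intro!: tens_in_tensor')
  note c3 = cd_tens3[OF A(1-3) *(1-3), folded T3_def]
  have q: "i + j + k - 1 + m = q" by (simp add: q_def)
  have "cd T4 (i + j + k + m) (t i j k m a b c d) =
    cadd T4 q (tens T3 D (i + j + k - 1) m (cd T3 (i + j + k) (?t i j k a b c)) d)
      (csmult T4 q (sgnpow (i + j + k)) (tens T3 D (i + j + k) (m - 1) (?t i j k a b c) (cd D m d)))"
    unfolding T4 t_def using T A * t(1) by (intro cd_tens') (simp_all add: q_def)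
  then show ?thesis
    unfolding c3 t_def e using t T A * 
    by (simp add: tens_add_left'[OF T A(4) _ _ _ q] tens_smult_left'[OF T A(4) _ _ q]
       module_smult[OF chain_complex_module[OF T]] module_add[OF chain_complex_module[OF T]] flip: T4)
qed

lemma app_ten_idt_right:
  assumes "arr f" "chain_complex C" "a \<in> cset (src f) i" "c \<in> cset C j" "i + j = p" "src f = A" "tgt f = B" "i' = i + deg f"
  shows "app (f \<otimes> idt C) p (tens A C i j a c) = tens B C i' j (app f i a) c"
proof -
  have "tens (tgt f) C (i + deg f) j (app f i a) c \<in> cset (tensor (tgt f) C) (p + deg f)"
    using assms app_closed[OF assms(1,3)] by (auto intro!: tens_in_tensor')
  then show ?thesis
    using app_ten[of f "idt C" a i c j p] assms module_smult_one[OF modulesD[OF modules_tensor]]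
    by (simp add: app_ops)
qed

text \<open>Unlike in the case of \<open>idt\<close> on the right, the map passes the vector
  \<open>c\<close>; for \<open>m3\<close> this yields the sign of the last summand in the relation
  for \<open>m4\<close>.\<close>

lemma app_ten_idt_left:
  assumes "arr f" "chain_complex C" "a \<in> cset (src f) j" "c \<in> cset C i" "i + j = p" "src f = A" "tgt f = B"
    "j' = j + deg f" "q = p + deg f"
  shows "app (idt C \<otimes> f) p (tens C A i j c a) =
    csmult (tensor C B) q (sgnpow (deg f * i)) (tens C B i j' c (app f j a))"
  using app_ten[of "idt C" f c i a j p] assms by (simp add: app_ops)

lemma tensor_smult_one: "X \<in> cset (tensor A B) p \<Longrightarrow> csmult (tensor A B) p 1 X = X"
  by (rule module_smult_one[OF modulesD[OF modules_tensor]])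

text \<open>Both sides of each boundary equation are evaluated at a generator: the Leibniz rule on
  tensor powers gives the left-hand sides of the relations, the Koszul convention the right-hand
  ones. The regrouping into \<open>lcomb\<close> is again done by formal sums.\<close>

lemma A4_algebraI:
  fixes A :: "('r::comm_ring_1, 'a) cx" and m2 m3 m4
  defines "I \<equiv> idt A" and "A2 \<equiv> tensor A A" and "A3 \<equiv> tensor (tensor A A) A" and "A4 \<equiv> tensor (tensor (tensor A A) A) A"
  assumes m2: "chain_arr m2 A2 A"
    and m3: "arr m3" "src m3 = A3" "tgt m3 = A" "deg m3 = 1"
      "bdry m3 = m2 \<odot> (I \<otimes> m2) \<odot> asc_inv A A A \<oplus> (- 1) \<star> (m2 \<odot> (m2 \<otimes> I))"
    and m4: "arr m4" "src m4 = A4" "tgt m4 = A" "deg m4 = 2"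
      "bdry m4 = (- 1) \<star> (m3 \<odot> ((m2 \<otimes> I) \<otimes> I)) \<oplus> m3 \<odot> (((I \<otimes> m2) \<odot> asc_inv A A A) \<otimes> I)
       \<oplus> (- 1) \<star> (m3 \<odot> (idt A2 \<otimes> m2) \<odot> asc_inv A2 A A) \<oplus> m2 \<odot> (m3 \<otimes> I)
       \<oplus> m2 \<odot> (I \<otimes> m3) \<odot> asc_inv A A2 A \<odot> (asc_inv A A A \<otimes> I)"
  shows "A4_algebra A (app m2) (app m3) (app m4)"
proof -
  note m2' = chain_arrD[OF m2]
  have A: "chain_complex A" using m2' by simp
  have A23 [simp]: "chain_complex A2" "chain_complex A3" "chain_complex A4" using A by (simp_all add: A2_def A3_def A4_def)
  note [simp] = A m2'(1-4) m3(1-4) m4(1-4)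
  have [simp]: "src I = A" "tgt I = A" "deg I = 0" by (simp_all add: I_def)
  note mA = chain_complex_module[OF A]
  note lin2 = arr_linmap[OF m2'(1-3)] and lin3 = arr_linmap[OF m3(1-3)] and lin4 = arr_linmap[OF m4(1-3)]
  let ?d = "cd A"
  let ?t2 = "tens A A"
  let ?t3 = "\<lambda>p1 p2 p3 a1 a2 a3. tens A2 A (p1 + p2) p3 (?t2 p1 p2 a1 a2) a3"
  let ?t4 = "\<lambda>p1 p2 p3 p4 a1 a2 a3 a4. tens A3 A (p1 + p2 + p3) p4 (?t3 p1 p2 p3 a1 a2 a3) a4"
  have fold: "tensor A A = A2" "tensor A2 A = A3" "tensor A3 A = A4" by (simp_all add: A2_def A3_def A4_def)
  have t2: "?t2 i j a b \<in> cset A2 p" if "a \<in> cset A i" "b \<in> cset A j" "i + j = p" for i j a b p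
    unfolding A2_def using that by (rule tens_in_tensor')
  have t3: "tens A2 A i j a b \<in> cset A3 p" if "a \<in> cset A2 i" "b \<in> cset A j" "i + j = p" for i j a b p
    using tens_in_tensor'[OF that] by (simp add: fold)
  have t4: "tens A3 A i j a b \<in> cset A4 p" if "a \<in> cset A3 i" "b \<in> cset A j" "i + j = p" for i j a b p
    using tens_in_tensor'[OF that] by (simp add: fold)
  have c2: "app m2 p x \<in> cset A p" if "x \<in> cset A2 p" for p x
    using app_closed[OF m2'(1)] that by force
  have c3: "app m3 p x \<in> cset A (p + 1)" if "x \<in> cset A3 p" for p x
    using app_closed[OF m3(1)] that by force
  have c4: "app m4 p x \<in> cset A (p + 2)" if "x \<in> cset A4 p" for p x
    using app_closed[OF m4(1)] that by force
  show ?thesis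
    unfolding A4_algebra_def Let_def fold
  proof (intro conjI allI impI; (elim conjE)?)
    show "chain_complex A" by fact
    show "chain_map A2 A (app m2)" by (rule chain_arr_chain_map[OF m2])
    show "linmap A3 p A (p + 1) (app m3 p)" for p by (rule lin3) simp
    show "linmap A4 p A (p + 2) (app m4 p)" for p by (rule lin4) simp
  next
    fix p1 p2 p3 a1 a2 a3
    assume a: "a1 \<in> cset A p1" "a2 \<in> cset A p2" "a3 \<in> cset A p3"
    let ?p = "p1 + p2 + p3"
    let ?x = "?t3 p1 p2 p3 a1 a2 a3"
    note da = a[THEN cd_closed[OF A]]
    have x: "?x \<in> cset A3 ?p" using a by (simp add: t2 t3)
    have y: "?t3 (p1 - 1) p2 p3 (?d p1 a1) a2 a3 \<in> cset A3 (?p - 1)"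
      "?t3 p1 (p2 - 1) p3 a1 (?d p2 a2) a3 \<in> cset A3 (?p - 1)"
      "?t3 p1 p2 (p3 - 1) a1 a2 (?d p3 a3) \<in> cset A3 (?p - 1)" using a da by (auto intro!: t2 t3)
    note dx = cd_tens3[OF A A A a, unfolded fold]
    have c3': "app m3 (?p - 1) z \<in> cset A ?p" if "z \<in> cset A3 (?p - 1)" for z
      using c3[OF that] by simp
    have "?d (?p + 1) (app m3 ?p ?x) \<in> cset A ?p"
      using cd_closed[OF A c3[OF x]] by simp
    note w = this y[THEN c3']
    have mA3: "module_at A3 q" for q by (simp add: chain_complex_module)
    have L: "app (bdry m3) ?p ?x = cadd A ?p (?d (?p + 1) (app m3 ?p ?x))
      (cadd A ?p (cadd A ?p (app m3 (?p - 1) (?t3 (p1 - 1) p2 p3 (?d p1 a1) a2 a3))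
        (csmult A ?p (sgnpow p1) (app m3 (?p - 1) (?t3 p1 (p2 - 1) p3 a1 (?d p2 a2) a3))))
        (csmult A ?p (sgnpow (p1 + p2)) (app m3 (?p - 1) (?t3 p1 p2 (p3 - 1) a1 a2 (?d p3 a3)))))"
      using app_bdry[OF m3(1), of ?x ?p] x y c3'
      by (simp add: dx linmap_add[OF lin3[of "?p - 1" ?p]] linmap_smult[OF lin3[of "?p - 1" ?p]]
        module_add[OF mA3] module_smult[OF mA3] module_add[OF mA] module_smult[OF mA] module_smult_one[OF mA])
    have R1: "app (m2 \<odot> (m2 \<otimes> I)) ?p ?x = app m2 ?p (?t2 (p1 + p2) p3 (app m2 (p1 + p2) (?t2 p1 p2 a1 a2)) a3)"
      using a x by (simp add: I_def app_ops fold app_ten_idt_right t2)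
    have R2: "app (m2 \<odot> (I \<otimes> m2) \<odot> asc_inv A A A) ?p ?x = app m2 ?p (?t2 p1 (p2 + p3) a1 (app m2 (p2 + p3) (?t2 p2 p3 a2 a3)))"
      using a x tensor_smult_one[of _ A A ?p] t2 c2
      by (simp add: I_def app_ops fold app_asc_inv[of A A A, unfolded fold] app_ten_idt_left[where q = ?p and j' = "p2 + p3"])
    have z: "app m2 ?p (?t2 (p1 + p2) p3 (app m2 (p1 + p2) (?t2 p1 p2 a1 a2)) a3) \<in> cset A ?p"
      "app m2 ?p (?t2 p1 (p2 + p3) a1 (app m2 (p2 + p3) (?t2 p2 p3 a2 a3))) \<in> cset A ?p"
      using a by (auto intro!: c2 t2)
    have R: "app (bdry m3) ?p ?x = cadd A ?p (app m2 ?p (?t2 p1 (p2 + p3) a1 (app m2 (p2 + p3) (?t2 p2 p3 a2 a3))))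
       (csmult A ?p (- 1) (app m2 ?p (?t2 (p1 + p2) p3 (app m2 (p1 + p2) (?t2 p1 p2 a1 a2)) a3)))"
      unfolding m3(5) using x by (simp add: app_ops(2,3) R1 R2 fold)
    have "lcomb A ?p
             [(1, ?d (?p + 1) (app m3 ?p ?x)),
              (1, app m3 (?p - 1) (?t3 (p1 - 1) p2 p3 (?d p1 a1) a2 a3)),
              (sgnpow p1, app m3 (?p - 1) (?t3 p1 (p2 - 1) p3 a1 (?d p2 a2) a3)),
              (sgnpow (p1 + p2), app m3 (?p - 1) (?t3 p1 p2 (p3 - 1) a1 a2 (?d p3 a3)))] = app (bdry m3) ?p ?x"
      unfolding L lcomb_Cons lcomb_Nil
      by (rule fval_unique[OF mA], (rule fval_add fval_smult fval_zero w[THEN fval_atom])+)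
         (simp add: algebra_simps)
    also have "\<dots> = lcomb A ?p
             [(- 1, app m2 ?p (?t2 (p1 + p2) p3 (app m2 (p1 + p2) (?t2 p1 p2 a1 a2)) a3)),
              (1, app m2 ?p (?t2 p1 (p2 + p3) a1 (app m2 (p2 + p3) (?t2 p2 p3 a2 a3))))]"
      unfolding R lcomb_Cons lcomb_Nil
      by (rule fval_unique[OF mA], (rule fval_add fval_smult fval_zero z[THEN fval_atom])+)
         (simp add: algebra_simps)
    finally show "lcomb A ?p
             [(1, ?d (?p + 1) (app m3 ?p ?x)),
              (1, app m3 (?p - 1) (?t3 (p1 - 1) p2 p3 (?d p1 a1) a2 a3)),
              (sgnpow p1, app m3 (?p - 1) (?t3 p1 (p2 - 1) p3 a1 (?d p2 a2) a3)),
              (sgnpow (p1 + p2), app m3 (?p - 1) (?t3 p1 p2 (p3 - 1) a1 a2 (?d p3 a3)))] = \<dots>" .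
  next
    fix p1 p2 p3 p4 a1 a2 a3 a4
    assume a: "a1 \<in> cset A p1" "a2 \<in> cset A p2" "a3 \<in> cset A p3" "a4 \<in> cset A p4"
    let ?p = "p1 + p2 + p3 + p4"
    let ?x = "?t4 p1 p2 p3 p4 a1 a2 a3 a4"
    note da = a[THEN cd_closed[OF A]]
    have x: "?x \<in> cset A4 ?p" using a by (simp add: t2 t3 t4)
    have y: "?t4 (p1 - 1) p2 p3 p4 (?d p1 a1) a2 a3 a4 \<in> cset A4 (?p - 1)"
      "?t4 p1 (p2 - 1) p3 p4 a1 (?d p2 a2) a3 a4 \<in> cset A4 (?p - 1)"
      "?t4 p1 p2 (p3 - 1) p4 a1 a2 (?d p3 a3) a4 \<in> cset A4 (?p - 1)"
      "?t4 p1 p2 p3 (p4 - 1) a1 a2 a3 (?d p4 a4) \<in> cset A4 (?p - 1)" using a da by (auto intro!: t2 t3 t4)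
    note dx = cd_tens4[OF A A A A a, unfolded fold]
    have e: "?p - 1 + 2 = ?p + 1" and e': "?p + 2 - 1 = ?p + 1" by simp_all
    have c4': "app m4 (?p - 1) z \<in> cset A (?p + 1)" if "z \<in> cset A4 (?p - 1)" for z
      using c4[OF that] unfolding e .
    have "?d (?p + 2) (app m4 ?p ?x) \<in> cset A (?p + 1)"
      using cd_closed[OF A c4[OF x]] unfolding e' .
    note w = this y[THEN c4']
    have mA4: "module_at A4 q" for q by (simp add: chain_complex_module)
    \<comment> \<open>For degree 2 the factor \<open>- sgnpow (deg m4)\<close> is -1, whence the
      common minus sign of the four terms with an inner differential; for \<open>m3\<close> it is
      1.\<close>
    have L: "app (bdry m4) ?p ?x = cadd A (?p + 1) (?d (?p + 2) (app m4 ?p ?x))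
      (csmult A (?p + 1) (- 1) (cadd A (?p + 1) (cadd A (?p + 1) (cadd A (?p + 1)
        (app m4 (?p - 1) (?t4 (p1 - 1) p2 p3 p4 (?d p1 a1) a2 a3 a4))
        (csmult A (?p + 1) (sgnpow p1) (app m4 (?p - 1) (?t4 p1 (p2 - 1) p3 p4 a1 (?d p2 a2) a3 a4))))
        (csmult A (?p + 1) (sgnpow (p1 + p2)) (app m4 (?p - 1) (?t4 p1 p2 (p3 - 1) p4 a1 a2 (?d p3 a3) a4))))
        (csmult A (?p + 1) (sgnpow (p1 + p2 + p3)) (app m4 (?p - 1) (?t4 p1 p2 p3 (p4 - 1) a1 a2 a3 (?d p4 a4))))))"
      using app_bdry[OF m4(1), of ?x ?p, unfolded m4(4) e'] x y c4'
      by (simp add: dx linmap_add[OF lin4[of "?p - 1" "?p + 1"]] linmap_smult[OF lin4[of "?p - 1" "?p + 1"]]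
        module_add[OF mA4] module_smult[OF mA4])
    define r1 where "r1 = app m3 ?p (?t3 (p1 + p2) p3 p4 (app m2 (p1 + p2) (?t2 p1 p2 a1 a2)) a3 a4)"
    define r2 where "r2 = app m3 ?p (?t3 p1 (p2 + p3) p4 a1 (app m2 (p2 + p3) (?t2 p2 p3 a2 a3)) a4)"
    define r3 where "r3 = app m3 ?p (?t3 p1 p2 (p3 + p4) a1 a2 (app m2 (p3 + p4) (?t2 p3 p4 a3 a4)))"
    define r4 where "r4 = app m2 (?p + 1) (?t2 (p1 + p2 + p3 + 1) p4 (app m3 (p1 + p2 + p3) (?t3 p1 p2 p3 a1 a2 a3)) a4)"
    define r5 where "r5 = app m2 (?p + 1) (?t2 p1 (p2 + p3 + p4 + 1) a1 (app m3 (p2 + p3 + p4) (?t3 p2 p3 p4 a2 a3 a4)))"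
    have r: "r1 \<in> cset A (?p + 1)" "r2 \<in> cset A (?p + 1)" "r3 \<in> cset A (?p + 1)" "r4 \<in> cset A (?p + 1)" "r5 \<in> cset A (?p + 1)"
      unfolding r1_def r2_def r3_def r4_def r5_def using a by (auto intro!: c2 c3 t2 t3)
    have R1: "app (m3 \<odot> ((m2 \<otimes> I) \<otimes> I)) ?p ?x = r1"
      using a x t2 t3 c2 by (simp add: r1_def I_def app_ops fold app_ten_idt_right)
    have i2: "app ((I \<otimes> m2) \<odot> asc_inv A A A) (p1 + p2 + p3) (?t3 p1 p2 p3 a1 a2 a3) =
      ?t2 p1 (p2 + p3) a1 (app m2 (p2 + p3) (?t2 p2 p3 a2 a3))"
      using a tensor_smult_one[of _ A A "p1 + p2 + p3"] t2 t3 c2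
      by (simp add: I_def app_ops fold app_asc_inv[of A A A, unfolded fold] app_ten_idt_left[where q = "p1 + p2 + p3" and j' = "p2 + p3"])
    have R2: "app (m3 \<odot> (((I \<otimes> m2) \<odot> asc_inv A A A) \<otimes> I)) ?p ?x = r2"
      using a x t2 t3 i2 unfolding r2_def
      by (simp add: I_def app_ops(1) fold app_ten_idt_right add.assoc)
    have R3: "app (m3 \<odot> (idt A2 \<otimes> m2) \<odot> asc_inv A2 A A) ?p ?x = r3"
      using a x t2 t3 c2 tensor_smult_one[of _ A2 A ?p] unfolding r3_def
      by (simp add: app_ops fold app_asc_inv[of A2 A A, unfolded fold] app_ten_idt_left[where q = ?p and j' = "p3 + p4"])
    have R4: "app (m2 \<odot> (m3 \<otimes> I)) ?p ?x = r4"
      using a x t2 t3 unfolding r4_def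
      by (simp add: I_def app_ops fold app_ten_idt_right[where i' = "p1 + p2 + p3 + 1"])
    have m: "app m3 (p2 + p3 + p4) (?t3 p2 p3 p4 a2 a3 a4) \<in> cset A (p2 + p3 + p4 + 1)"
      using a by (auto intro!: c3 t2 t3)
    \<comment> \<open>The one Koszul sign on the right-hand side: \<open>m3\<close> has degree 1 and
      passes \<open>a1\<close> of degree \<open>p1\<close>.\<close>
    have R5: "app (m2 \<odot> (I \<otimes> m3) \<odot> asc_inv A A2 A \<odot> (asc_inv A A A \<otimes> I)) ?p ?x = csmult A (?p + 1) (sgnpow p1) r5"
      using a x t2 t3 m linmap_smult[OF lin2[of "?p + 1" "?p + 1"]] unfolding r5_def
      by (simp add: I_def app_ops fold app_ten_idt_right[where i' = "p1 + p2 + p3"] app_asc_inv[of A A A, unfolded fold]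
          app_asc_inv[of A A2 A, unfolded fold] tens_in_tensor'
          app_ten_idt_left[where q = "?p + 1" and j' = "p2 + p3 + p4 + 1"] add.assoc)
    have R: "app (bdry m4) ?p ?x = cadd A (?p + 1) (cadd A (?p + 1) (cadd A (?p + 1) (cadd A (?p + 1) (csmult A (?p + 1) (- 1) r1) r2)
      (csmult A (?p + 1) (- 1) r3)) r4) (csmult A (?p + 1) (sgnpow p1) r5)"
      unfolding m4(5) using x by (simp add: app_ops(2,3) R1 R2 R3 R4 R5 fold)
    have "lcomb A (?p + 1)
             [(1, ?d (?p + 2) (app m4 ?p ?x)),
              (- 1, app m4 (?p - 1) (?t4 (p1 - 1) p2 p3 p4 (?d p1 a1) a2 a3 a4)),
              (- sgnpow p1, app m4 (?p - 1) (?t4 p1 (p2 - 1) p3 p4 a1 (?d p2 a2) a3 a4)),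
              (- sgnpow (p1 + p2), app m4 (?p - 1) (?t4 p1 p2 (p3 - 1) p4 a1 a2 (?d p3 a3) a4)),
              (- sgnpow (p1 + p2 + p3), app m4 (?p - 1) (?t4 p1 p2 p3 (p4 - 1) a1 a2 a3 (?d p4 a4)))]
       = app (bdry m4) ?p ?x"
      unfolding L lcomb_Cons lcomb_Nil
      by (rule fval_unique[OF mA], (rule fval_add fval_smult fval_zero w[THEN fval_atom])+)
         (simp add: algebra_simps)
    also have "\<dots> = lcomb A (?p + 1) [(- 1, r1), (1, r2), (- 1, r3), (1, r4), (sgnpow p1, r5)]"
      unfolding R lcomb_Cons lcomb_Nil
      by (rule fval_unique[OF mA], (rule fval_add fval_smult fval_zero r[THEN fval_atom])+)
         (simp add: algebra_simps)
    finally show "lcomb A (?p + 1)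
             [(1, ?d (?p + 2) (app m4 ?p ?x)),
              (- 1, app m4 (?p - 1) (?t4 (p1 - 1) p2 p3 p4 (?d p1 a1) a2 a3 a4)),
              (- sgnpow p1, app m4 (?p - 1) (?t4 p1 (p2 - 1) p3 p4 a1 (?d p2 a2) a3 a4)),
              (- sgnpow (p1 + p2), app m4 (?p - 1) (?t4 p1 p2 (p3 - 1) p4 a1 a2 (?d p3 a3) a4)),
              (- sgnpow (p1 + p2 + p3), app m4 (?p - 1) (?t4 p1 p2 p3 (p4 - 1) a1 a2 a3 (?d p4 a4)))]
           = lcomb A (?p + 1)
             [(- 1, app m3 ?p (?t3 (p1 + p2) p3 p4 (app m2 (p1 + p2) (?t2 p1 p2 a1 a2)) a3 a4)),
              (1, app m3 ?p (?t3 p1 (p2 + p3) p4 a1 (app m2 (p2 + p3) (?t2 p2 p3 a2 a3)) a4)),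
              (- 1, app m3 ?p (?t3 p1 p2 (p3 + p4) a1 a2 (app m2 (p3 + p4) (?t2 p3 p4 a3 a4)))),
              (1, app m2 (?p + 1) (?t2 (p1 + p2 + p3 + 1) p4 (app m3 (p1 + p2 + p3) (?t3 p1 p2 p3 a1 a2 a3)) a4)),
              (sgnpow p1, app m2 (?p + 1) (?t2 p1 (p2 + p3 + p4 + 1) a1 (app m3 (p2 + p3 + p4) (?t3 p2 p3 p4 a2 a3 a4))))]"
      unfolding r1_def r2_def r3_def r4_def r5_def .
  qed
qed

section \<open>From homotopy semigroups to graded maps\<close>

lemma chain_mapD: "chain_map A B f \<Longrightarrow> linmap A p B p (f p)"
  "chain_map A B f \<Longrightarrow> x \<in> cset A p \<Longrightarrow> f (p - 1) (cd A p x) = cd B p (f p x)"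
  by (simp_all add: chain_map_def)

lemma chain_arr_mk:
  assumes A: "chain_complex A" and B: "chain_complex B" and f: "chain_map A B f"
  shows "chain_arr (mk A B 0 f) A B"
proof -
  have arr: "arr (mk A B 0 f)" by (rule arr_mk) (use assms in \<open>simp_all add: chain_mapD(1)\<close>)
  moreover have "bdry (mk A B 0 f) = null A B (- 1)"
  proof (rule arrow_eqI)
    fix p x assume "x \<in> cset (src (null A B (- 1))) p"
    then have x: "x \<in> cset A p" by simp
    have c: "cd B p (f p x) \<in> cset B (p - 1)"
      using cd_closed[OF B linmap_closed[OF chain_mapD(1)[OF f] x]] .
    have "app (bdry (mk A B 0 f)) p x = cadd B (p - 1) (cd B p (f p x)) (csmult B (p - 1) (- 1) (cd B p (f p x)))"
      using app_bdry[OF arr, of x p] x chain_mapD(2)[OF f x] cd_closed[OF A x] by (simp add: app_mk)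
    also have "\<dots> = czero B (p - 1)"
      by (rule fval_unique[OF chain_complex_module[OF B]], (rule fval_add fval_smult fval_zero fval_atom[OF c])+) simp
    finally show "app (bdry (mk A B 0 f)) p x = app (null A B (- 1)) p x"
      using x by (simp add: app_ops)
  qed (use arr A B in auto)
  ultimately show ?thesis using A B by (simp add: chain_arr_def)
qed

lemma mk_cmp: "chain_map A B f \<Longrightarrow> mk B C 0 g \<odot> mk A B 0 f = mk A C 0 (\<lambda>p x. g p (f p x))"
  by (auto simp: cmp_def mk_def fun_eq_iff dest: linmap_closed[OF chain_mapD(1)])

lemma chain_htpic_bdry:
  assumes A: "chain_complex A" and B: "chain_complex B" and f: "arr (mk A B 0 f)" and g: "arr (mk A B 0 g)"
    and "chain_htpic A B f g"
  obtains t where "arr t" "src t = A" "tgt t = B" "deg t = 1" "mk A B 0 f = mk A B 0 g \<oplus> bdry t"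
proof -
  obtain t where t: "\<And>p. linmap A p B (p + 1) (t p)"
    and eq: "\<And>p x. x \<in> cset A p \<Longrightarrow>
      f p x = cadd B p (cadd B p (g p x) (cd B (p + 1) (t p x))) (t (p - 1) (cd A p x))"
    using assms(5) unfolding chain_htpic_def by blast
  have arr: "arr (mk A B 1 t)" by (rule arr_mk) (use A B t in simp_all)
  have "mk A B 0 f = mk A B 0 g \<oplus> bdry (mk A B 1 t)"
  proof (rule arrow_eqI)
    fix p x assume "x \<in> cset (src (mk A B 0 g \<oplus> bdry (mk A B 1 t))) p"
    then have x: "x \<in> cset A p" by simp
    have c: "g p x \<in> cset B p" "cd B (p + 1) (t p x) \<in> cset B p" "t (p - 1) (cd A p x) \<in> cset B p"
      using app_closed[OF g, of x p] x linmap_closed[OF t x] cd_closed[OF B, of "t p x" "p + 1"]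
        linmap_closed[OF t[of "p - 1"] cd_closed[OF A x]] by (simp_all add: app_mk)
    show "app (mk A B 0 f) p x = app (mk A B 0 g \<oplus> bdry (mk A B 1 t)) p x"
      using x app_bdry[OF arr, of x p] cd_closed[OF A x] c
      by (simp add: app_ops app_mk eq module_smult_one module_add_assoc chain_complex_module[OF B])
  qed (use f g arr in auto)
  then show thesis using arr by (intro that[of "mk A B 1 t"]) auto
qed

text \<open>The inverse \<open>g\<close> stays explicit instead of being hidden in
  \<open>heq\<close>, because the theorem compares \<open>m2\<close> with the map built from a named
  homotopy inverse.\<close>

lemma htpy_inverse_arrows:
  assumes A: "chain_complex A" and B: "chain_complex B" and "htpy_inverse A B f g"
  obtains s t where "chain_arr (mk A B 0 f) A B" "chain_arr (mk B A 0 g) B A"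
    "arr t" "src t = A" "tgt t = A" "deg t = 1" "mk B A 0 g \<odot> mk A B 0 f = idt A \<oplus> bdry t"
    "arr s" "src s = B" "tgt s = B" "deg s = 1" "mk A B 0 f \<odot> mk B A 0 g = idt B \<oplus> bdry s"
proof -
  have f: "chain_map A B f" and g: "chain_map B A g"
    and gf: "chain_htpic A A (\<lambda>p x. g p (f p x)) (\<lambda>p x. x)"
    and fg: "chain_htpic B B (\<lambda>p x. f p (g p x)) (\<lambda>p x. x)"
    using assms(3) by (auto simp: htpy_inverse_def)
  note f' = chain_arr_mk[OF A B f] and g' = chain_arr_mk[OF B A g]
  have "arr (mk A A 0 (\<lambda>p x. g p (f p x)))" "arr (mk A A 0 (\<lambda>p x. x))"
    using chain_arrD(1)[OF chain_arr_cmp[OF f' g']] A arr_idt[OF A] by (simp_all add: mk_cmp[OF f] idt_def)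
  from chain_htpic_bdry[OF A A this gf] obtain t where
    t: "arr t" "src t = A" "tgt t = A" "deg t = 1" "mk B A 0 g \<odot> mk A B 0 f = idt A \<oplus> bdry t"
    by (auto simp: mk_cmp[OF f] idt_def)
  have "arr (mk B B 0 (\<lambda>p x. f p (g p x)))" "arr (mk B B 0 (\<lambda>p x. x))"
    using chain_arrD(1)[OF chain_arr_cmp[OF g' f']] B arr_idt[OF B] by (simp_all add: mk_cmp[OF g] idt_def)
  from chain_htpic_bdry[OF B B this fg] obtain s where
    s: "arr s" "src s = B" "tgt s = B" "deg s = 1" "mk A B 0 f \<odot> mk B A 0 g = idt B \<oplus> bdry s"
    by (auto simp: mk_cmp[OF g] idt_def)
  show thesis by (rule that[OF f' g' t s])
qed

lemma heq_mk:
  assumes "chain_complex A" "chain_complex B" "chain_htpy_equiv A B f"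
  shows "heq (mk A B 0 f) A B"
proof -
  obtain g where "htpy_inverse A B f g" using assms(3) by (auto simp: chain_htpy_equiv_def)
  then show ?thesis
    by (rule htpy_inverse_arrows[OF assms(1,2)]) (auto simp: heq_def)
qed

lemma lext_cong: "(\<And>x. x \<in> supp h \<Longrightarrow> F x = G x) \<Longrightarrow> lext F h = lext G h"
  by (auto simp: lext_def intro!: sum.cong)

text \<open>\<open>tmap\<close> has no sign, and the maps here have degree 0, so the Koszul sign is
  trivial. Only generators in the support of \<open>rep Y\<close> matter; their components lie in
  the carriers, where the normalisation in \<open>mk\<close> is invisible.\<close>

lemma tmap_eq_ten:
  assumes Y: "Y \<in> cset (tensor A B) p"
  shows "tmap A' B' f g p Y = app (mk A A' 0 f \<otimes> mk B B' 0 g) p Y"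
proof -
  let ?f = "mk A A' 0 f" and ?g = "mk B B' 0 g"
  have "lext (\<lambda>(i, a, b). delta (i, f i a, g (p - i) b)) (rep Y) = lext (tenF ?f ?g p) (rep Y)"
  proof (rule lext_cong)
    fix x assume "x \<in> supp (rep Y)"
    then obtain i a b where "x = (i, a, b)" "a \<in> cset A i" "b \<in> cset B (p - i)"
      using tclass_rep(1)[OF Y] by (auto simp: tfree_def tgens_def)
    then show "(case x of (i, a, b) \<Rightarrow> delta (i, f i a, g (p - i) b)) = tenF ?f ?g p x"
      by (simp add: tenF_def app_mk)
  qed
  then show ?thesis
    using Y by (simp add: tmap_def ten_def app_mk tlift_def)
qed

lemma app_asc_tassoc: "Y \<in> cset (tensor A (tensor B C)) p \<Longrightarrow> app (asc A B C) p Y = tassoc A B C p Y"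
  by (simp add: asc_def app_mk)

locale homotopy_semigroup =
  fixes X :: "nat \<Rightarrow> ('r::comm_ring_1, 'a) cx" and Xm xi xi0
  assumes hsemigroup: "hsemigroup X Xm xi xi0"
begin

definition "G m n f = mk (X m) (X n) 0 (Xm m n f)"
definition "Xi m n = mk (X (m + n)) (tensor (X m) (X n)) 0 (xi m n)"

lemma complex [simp]: "chain_complex (X n)"
  using hsemigroup by (simp add: hsemigroup_def)

lemmas map_G = hsemigroup[unfolded hsemigroup_def, THEN conjunct2, THEN conjunct1, rule_format]
lemmas map_Xi = hsemigroup[unfolded hsemigroup_def, THEN conjunct2, THEN conjunct2, THEN conjunct2, THEN conjunct2, THEN conjunct2, THEN conjunct1, rule_format]
lemmas xi_natural = hsemigroup[unfolded hsemigroup_def, THEN conjunct2, THEN conjunct2, THEN conjunct2, THEN conjunct2, THEN conjunct2, THEN conjunct2, THEN conjunct2, THEN conjunct1, rule_format]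
lemmas xi_coassoc = hsemigroup[unfolded hsemigroup_def, THEN conjunct2, THEN conjunct2, THEN conjunct2, THEN conjunct2, THEN conjunct2, THEN conjunct2, THEN conjunct2, THEN conjunct2, THEN conjunct1, rule_format]
lemmas xi_equiv = hsemigroup[unfolded hsemigroup_def, THEN conjunct2, THEN conjunct2, THEN conjunct2, THEN conjunct2, THEN conjunct2, THEN conjunct2, THEN conjunct2, THEN conjunct2, THEN conjunct2, THEN conjunct2, THEN conjunct1, rule_format]

lemma chain_arr_G: "surjmono m n f \<Longrightarrow> chain_arr (G m n f) (X m) (X n)"
  unfolding G_def by (intro chain_arr_mk map_G) simp_all

lemma chain_arr_Xi: "N = m + n \<Longrightarrow> chain_arr (Xi m n) (X N) (tensor (X m) (X n))"
  unfolding Xi_def by (simp add: chain_arr_mk map_Xi)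

lemma heq_Xi: "N = m + n \<Longrightarrow> heq (Xi m n) (X N) (tensor (X m) (X n))"
  unfolding Xi_def by (simp add: heq_mk xi_equiv)

lemma G_cong:
  assumes "surjmono m n f" "\<forall>i<m. f i = g i"
  shows "G m n f = G m n g"
  using assms hsemigroup unfolding G_def mk_def hsemigroup_def cmap_eq_def by (auto simp: fun_eq_iff)

lemma G_id: "G n n id = idt (X n)"
  using hsemigroup unfolding G_def mk_def idt_def hsemigroup_def cmap_eq_def by (auto simp: fun_eq_iff)

lemma G_cmp:
  assumes "surjmono m n f" "surjmono n k g"
  shows "G n k g \<odot> G m n f = G m k (g \<circ> f)"
  using assms hsemigroup unfolding G_def mk_cmp[OF map_G[OF assms(1)]]
  unfolding mk_def hsemigroup_def cmap_eq_def by (auto simp: fun_eq_iff)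

text \<open>Agreement with the ordinal sum is asked only below \<open>N\<close>, and the index sums
  are premises, so that maps like \<open>merge i\<close> and objects like \<open>X 3\<close> can be
  inserted directly.\<close>

lemma Xi_natural:
  assumes f: "surjmono m m' f" and g: "surjmono n n' g" and \<phi>: "surjmono N N' \<phi>"
    and N: "N = m + n" "N' = m' + n'" and eq: "\<forall>i<N. \<phi> i = osum m m' f g i"
  shows "(G m m' f \<otimes> G n n' g) \<odot> Xi m n = Xi m' n' \<odot> G N N' \<phi>"
proof -
  note s = chain_arrD[OF chain_arr_G[OF f]] chain_arrD[OF chain_arr_G[OF g]] chain_arrD[OF chain_arr_G[OF \<phi>]]
    chain_arrD[OF chain_arr_Xi[OF N(1)]] chain_arrD[OF chain_arr_Xi[OF N(2)]]
  have G: "G N N' \<phi> = G N N' (osum m m' f g)" by (rule G_cong[OF \<phi> eq])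
  show ?thesis
  proof (rule arrow_eqI)
    fix p x assume "x \<in> cset (src (Xi m' n' \<odot> G N N' \<phi>)) p"
    then have x: "x \<in> cset (X (m + n)) p" using s N by simp
    have xi: "xi m n p x \<in> cset (tensor (X m) (X n)) p"
      by (rule linmap_closed[OF chain_mapD(1)[OF map_Xi] x])
    have "app (G N N' \<phi>) p x \<in> cset (X N') p" using app_closed[OF s(15), of x p] x s N by simp
    then have "app (Xi m' n' \<odot> G N N' \<phi>) p x = xi m' n' p (Xm (m + n) (m' + n') (osum m m' f g) p x)"
      using s N x unfolding G by (simp add: app_ops) (simp add: Xi_def G_def app_mk)
    also have "\<dots> = tmap (X m') (X n') (Xm m m' f) (Xm n n' g) p (xi m n p x)"
      by (rule xi_natural) (use f g x in auto)
    also have "\<dots> = app ((G m m' f \<otimes> G n n' g) \<odot> Xi m n) p x"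
      using s N x xi by (simp add: app_ops) (simp add: Xi_def G_def app_mk tmap_eq_ten)
    finally show "app ((G m m' f \<otimes> G n n' g) \<odot> Xi m n) p x = app (Xi m' n' \<odot> G N N' \<phi>) p x" ..
  qed (use s N in auto)
qed

lemma Xi_coassoc:
  assumes N: "N = l + m" "K = m + n"
  shows "(Xi l m \<otimes> idt (X n)) \<odot> Xi N n = asc (X l) (X m) (X n) \<odot> (idt (X l) \<otimes> Xi m n) \<odot> Xi l K"
proof (rule arrow_eqI)
  note s = chain_arrD[OF chain_arr_Xi[OF N(1)]] chain_arrD[OF chain_arr_Xi[OF N(2)]]
    chain_arrD[OF chain_arr_Xi[of "l + m + n" "l + m" n]]
    chain_arrD[OF chain_arr_Xi[of "l + m + n" l "m + n"]]
  note [simp] = s[simplified N, simplified] N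
  show "arr ((Xi l m \<otimes> idt (X n)) \<odot> Xi N n)" "arr (asc (X l) (X m) (X n) \<odot> (idt (X l) \<otimes> Xi m n) \<odot> Xi l K)"
    "src ((Xi l m \<otimes> idt (X n)) \<odot> Xi N n) = src (asc (X l) (X m) (X n) \<odot> (idt (X l) \<otimes> Xi m n) \<odot> Xi l K)"
    "tgt ((Xi l m \<otimes> idt (X n)) \<odot> Xi N n) = tgt (asc (X l) (X m) (X n) \<odot> (idt (X l) \<otimes> Xi m n) \<odot> Xi l K)"
    "deg ((Xi l m \<otimes> idt (X n)) \<odot> Xi N n) = deg (asc (X l) (X m) (X n) \<odot> (idt (X l) \<otimes> Xi m n) \<odot> Xi l K)"
    by (simp_all add: add.assoc)
  fix p x assume "x \<in> cset (src (asc (X l) (X m) (X n) \<odot> (idt (X l) \<otimes> Xi m n) \<odot> Xi l K)) p"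
  then have x: "x \<in> cset (X (l + m + n)) p" by (simp add: add.assoc)
  have x1: "xi (l + m) n p x \<in> cset (tensor (X (l + m)) (X n)) p"
    by (rule linmap_closed[OF chain_mapD(1)[OF map_Xi] x])
  have x2: "xi l (m + n) p x \<in> cset (tensor (X l) (X (m + n))) p"
    using linmap_closed[OF chain_mapD(1)[OF map_Xi[of l "m + n"]], of x p] x by (simp add: add.assoc)
  have x3: "app (idt (X l) \<otimes> Xi m n) p (xi l (m + n) p x) \<in> cset (tensor (X l) (tensor (X m) (X n))) p"
    using app_closed[of "idt (X l) \<otimes> Xi m n" "xi l (m + n) p x" p] x2 by simp
  have Xi1: "app (Xi (l + m) n) p x = xi (l + m) n p x" "app (Xi l (m + n)) p x = xi l (m + n) p x"
    using x by (simp_all add: Xi_def app_mk add.assoc)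
  have "app ((Xi l m \<otimes> idt (X n)) \<odot> Xi N n) p x = app (Xi l m \<otimes> idt (X n)) p (xi (l + m) n p x)"
    using x by (simp add: app_ops Xi1)
  also have "\<dots> = tmap (tensor (X l) (X m)) (X n) (xi l m) (\<lambda>q y. y) p (xi (l + m) n p x)"
    using tmap_eq_ten[OF x1, of "tensor (X l) (X m)" "X n" "xi l m" "\<lambda>q y. y"] by (simp add: Xi_def idt_def)
  also have "\<dots> = tassoc (X l) (X m) (X n) p (tmap (X l) (tensor (X m) (X n)) (\<lambda>q y. y) (xi m n) p (xi l (m + n) p x))"
    by (rule xi_coassoc[OF x])
  also have "tmap (X l) (tensor (X m) (X n)) (\<lambda>q y. y) (xi m n) p (xi l (m + n) p x) = app (idt (X l) \<otimes> Xi m n) p (xi l (m + n) p x)"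
    using tmap_eq_ten[OF x2, of "X l" "tensor (X m) (X n)" "\<lambda>q y. y" "xi m n"] by (simp add: Xi_def idt_def)
  also have "tassoc (X l) (X m) (X n) p (app (idt (X l) \<otimes> Xi m n) p (xi l (m + n) p x)) =
    app (asc (X l) (X m) (X n) \<odot> (idt (X l) \<otimes> Xi m n) \<odot> Xi l K) p x"
    using x x[unfolded add.assoc] x3 by (simp add: app_ops Xi1 app_asc_tassoc)
  finally show "app ((Xi l m \<otimes> idt (X n)) \<odot> Xi N n) p x = app (asc (X l) (X m) (X n) \<odot> (idt (X l) \<otimes> Xi m n) \<odot> Xi l K) p x" .
qed

end

section \<open>The codegeneracies and the passage to the objects 1 to 4\<close>

definition merge :: "nat \<Rightarrow> nat \<Rightarrow> nat" where
  "merge i j = (if j \<le> i then j else j - 1)"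

lemma surjmono_merge: "i < n \<Longrightarrow> N = n + 1 \<Longrightarrow> surjmono N n (merge i)"
  unfolding surjmono_def merge_def
proof (intro conjI allI impI)
  fix k assume "i < n" "N = n + 1" "k < n"
  then show "\<exists>j<N. (if j \<le> i then j else j - 1) = k"
    \<comment> \<open>Beyond the merged pair \<open>i\<close>, \<open>i + 1\<close> every value is
      attained one place later.\<close>
    by (intro exI[of _ "if k \<le> i then k else k + 1"]) auto
qed auto

lemma surjmono_id: "surjmono n n id"
  by (auto simp: surjmono_def)

lemma surjmono_const: "surjmono 2 1 (\<lambda>_. 0)"
  by (auto simp: surjmono_def intro: exI[of _ 0])

lemma surjmono_comp: "surjmono m n f \<Longrightarrow> surjmono n k g \<Longrightarrow> surjmono m k (g \<circ> f)"
  unfolding surjmono_def comp_def by (metis order.strict_trans1)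

context homotopy_semigroup
begin

sublocale low_semigroup "X 1" "X 2" "X 3" "X 4" "G 2 1 (\<lambda>_. 0)" "G 3 2 (merge 0)" "G 3 2 (merge 1)"
  "G 4 3 (merge 0)" "G 4 3 (merge 1)" "G 4 3 (merge 2)" "Xi 1 1" "Xi 2 1" "Xi 1 2" "Xi 3 1" "Xi 2 2" "Xi 1 3"
proof
  have m: "surjmono 3 2 (merge 0)" "surjmono 3 2 (merge 1)"
    "surjmono 4 3 (merge 0)" "surjmono 4 3 (merge 1)" "surjmono 4 3 (merge 2)"
    by (simp_all add: surjmono_merge)
  note c = surjmono_const and i = surjmono_id
  show "chain_arr (G 2 1 (\<lambda>_. 0)) (X 2) (X 1)" "chain_arr (G 3 2 (merge 0)) (X 3) (X 2)"
    "chain_arr (G 3 2 (merge 1)) (X 3) (X 2)" "chain_arr (G 4 3 (merge 0)) (X 4) (X 3)"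
    "chain_arr (G 4 3 (merge 1)) (X 4) (X 3)" "chain_arr (G 4 3 (merge 2)) (X 4) (X 3)"
    by (intro chain_arr_G m c)+
  show "chain_arr (Xi 1 1) (X 2) (tensor (X 1) (X 1))" "chain_arr (Xi 2 1) (X 3) (tensor (X 2) (X 1))"
    "chain_arr (Xi 1 2) (X 3) (tensor (X 1) (X 2))" "chain_arr (Xi 3 1) (X 4) (tensor (X 3) (X 1))"
    "chain_arr (Xi 2 2) (X 4) (tensor (X 2) (X 2))" "chain_arr (Xi 1 3) (X 4) (tensor (X 1) (X 3))"
    by (rule chain_arr_Xi; simp)+
  show "heq (Xi 1 1) (X 2) (tensor (X 1) (X 1))" "heq (Xi 2 1) (X 3) (tensor (X 2) (X 1))"
    "heq (Xi 3 1) (X 4) (tensor (X 3) (X 1))"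
    by (rule heq_Xi; simp)+
  show "(Xi 1 1 \<otimes> idt (X 1)) \<odot> Xi 2 1 = asc (X 1) (X 1) (X 1) \<odot> (idt (X 1) \<otimes> Xi 1 1) \<odot> Xi 1 2"
    "(Xi 2 1 \<otimes> idt (X 1)) \<odot> Xi 3 1 = asc (X 2) (X 1) (X 1) \<odot> (idt (X 2) \<otimes> Xi 1 1) \<odot> Xi 2 2"
    "(Xi 1 2 \<otimes> idt (X 1)) \<odot> Xi 3 1 = asc (X 1) (X 2) (X 1) \<odot> (idt (X 1) \<otimes> Xi 2 1) \<odot> Xi 1 3"
    "(Xi 1 1 \<otimes> idt (X 2)) \<odot> Xi 2 2 = asc (X 1) (X 1) (X 2) \<odot> (idt (X 1) \<otimes> Xi 1 2) \<odot> Xi 1 3"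
    by (rule Xi_coassoc; simp)+
  \<comment> \<open>Maps out of 3 and 4 only need to be compared at finitely many arguments, so each
    simplicial identity becomes a computation with \<open>merge\<close> and
    \<open>osum\<close>.\<close>
  have lt3: "(\<forall>j<3. Q j) \<longleftrightarrow> Q 0 \<and> Q 1 \<and> Q 2" and lt4: "(\<forall>j<4. Q j) \<longleftrightarrow> Q 0 \<and> Q 1 \<and> Q 2 \<and> Q 3" for Q :: "nat \<Rightarrow> bool"
    by (auto simp: numeral_eq_Suc less_Suc_eq)
  note calc = lt3 lt4 merge_def osum_def
  show "G 2 1 (\<lambda>_. 0) \<odot> G 3 2 (merge 1) = G 2 1 (\<lambda>_. 0) \<odot> G 3 2 (merge 0)"
    by (simp only: G_cmp m c) (simp add: comp_def)
  show "G 3 2 (merge 0) \<odot> G 4 3 (merge 1) = G 3 2 (merge 0) \<odot> G 4 3 (merge 0)"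
    "G 3 2 (merge 1) \<odot> G 4 3 (merge 0) = G 3 2 (merge 0) \<odot> G 4 3 (merge 2)"
    "G 3 2 (merge 1) \<odot> G 4 3 (merge 2) = G 3 2 (merge 1) \<odot> G 4 3 (merge 1)"
    by (simp only: G_cmp m; rule G_cong[OF surjmono_comp]; (rule m)?; simp add: calc)+
  show "(G 2 1 (\<lambda>_. 0) \<otimes> idt (X 1)) \<odot> Xi 2 1 = Xi 1 1 \<odot> G 3 2 (merge 0)"
    "(idt (X 1) \<otimes> G 2 1 (\<lambda>_. 0)) \<odot> Xi 1 2 = Xi 1 1 \<odot> G 3 2 (merge 1)"
    "(G 3 2 (merge 0) \<otimes> idt (X 1)) \<odot> Xi 3 1 = Xi 2 1 \<odot> G 4 3 (merge 0)"
    "(G 3 2 (merge 1) \<otimes> idt (X 1)) \<odot> Xi 3 1 = Xi 2 1 \<odot> G 4 3 (merge 1)"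
    "(idt (X 2) \<otimes> G 2 1 (\<lambda>_. 0)) \<odot> Xi 2 2 = Xi 2 1 \<odot> G 4 3 (merge 2)"
    "(G 2 1 (\<lambda>_. 0) \<otimes> idt (X 2)) \<odot> Xi 2 2 = Xi 1 2 \<odot> G 4 3 (merge 0)"
    "(idt (X 1) \<otimes> G 3 2 (merge 0)) \<odot> Xi 1 3 = Xi 1 2 \<odot> G 4 3 (merge 1)"
    "(idt (X 1) \<otimes> G 3 2 (merge 1)) \<odot> Xi 1 3 = Xi 1 2 \<odot> G 4 3 (merge 2)"
    \<comment> \<open>Identities are written as values of \<open>G\<close>, which makes every square
      an instance of \<open>Xi_natural\<close>.\<close>
    unfolding G_id[symmetric]
    by (rule Xi_natural; (rule m c i)?; simp add: calc)+
qed

end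

theorem theorem3p5p1:
  fixes X :: "nat \<Rightarrow> ('r::comm_ring_1, 'a) cx"
    and Xm :: "nat \<Rightarrow> nat \<Rightarrow> (nat \<Rightarrow> nat) \<Rightarrow> int \<Rightarrow> 'a \<Rightarrow> 'a"
    and xi :: "nat \<Rightarrow> nat \<Rightarrow> int \<Rightarrow> 'a \<Rightarrow> (int \<times> 'a \<times> 'a \<Rightarrow> 'r) set"
    and xi0 :: "int \<Rightarrow> 'a \<Rightarrow> 'r"
  assumes "hsemigroup X Xm xi xi0"
  shows "\<exists>m2 m3 m4. A4_algebra (X 1) m2 m3 m4 \<and>
           (\<exists>psi. htpy_inverse (X (1 + 1)) (tensor (X 1) (X 1)) (xi 1 1) psi \<and>
                  chain_htpic (tensor (X 1) (X 1)) (X 1) m2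
                    (\<lambda>p y. Xm (1 + 1) 1 (\<lambda>_. 0) p (psi p y)))"
proof -
  interpret homotopy_semigroup X Xm xi xi0 by unfold_locales fact
  let ?A = "X 1" and ?AA = "tensor (X 1) (X 1)" and ?\<mu> = "G 2 1 (\<lambda>_. 0)"
  have two: "1 + 1 = (2 :: nat)" by simp
  obtain psi where psi: "htpy_inverse (X (1 + 1)) ?AA (xi 1 1) psi"
    using xi_equiv[of 1 1] unfolding chain_htpy_equiv_def by blast
  then obtain t where \<psi>: "chain_arr (mk ?AA (X 2) 0 psi) ?AA (X 2)"
    and t: "arr t" "src t = X 2" "tgt t = X 2" "deg t = 1" "mk ?AA (X 2) 0 psi \<odot> Xi 1 1 = idt (X 2) \<oplus> bdry t"
    unfolding two Xi_def by (rule htpy_inverse_arrows[rotated 2]) (simp_all add: two)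
  define m2 where "m2 = ?\<mu> \<odot> mk ?AA (X 2) 0 psi"
  \<comment> \<open>Because \<open>\<mu>\<close> is a chain map, \<open>\<mu> \<odot> bdry t\<close>
    is the boundary of this map, so it measures the difference between
    \<open>m2 \<odot> Xi 1 1\<close> and \<open>\<mu>\<close>.\<close>
  define h where "h = ?\<mu> \<odot> t"
  note [simp] = chain_arrD(1-4)[OF \<psi>] t(1-4)
  interpret low_semigroup_product "X 1" "X 2" "X 3" "X 4" "G 2 1 (\<lambda>_. 0)" "G 3 2 (merge 0)" "G 3 2 (merge 1)"
    "G 4 3 (merge 0)" "G 4 3 (merge 1)" "G 4 3 (merge 2)" "Xi 1 1" "Xi 2 1" "Xi 1 2" "Xi 3 1" "Xi 2 2" "Xi 1 3" m2 h
  proof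
    show "chain_arr m2 ?AA ?A" unfolding m2_def by (rule chain_arr_cmp[OF \<psi> maps(1)])
    show "m2 \<odot> Xi 1 1 = ?\<mu> \<oplus> bdry h"
      \<comment> \<open>\<open>One_nat_def\<close> is disabled so that \<open>X 1\<close> keeps the
        form under which the facts of the locale mention it.\<close>
      unfolding m2_def h_def by (simp add: cmp_assoc t(5) dg_linear bdry_cmp del: One_nat_def)
  qed (simp_all add: h_def del: One_nat_def)
  obtain m3 l where m3: "arr m3" "src m3 = tensor ?AA ?A" "tgt m3 = ?A" "deg m3 = 1" "bdry m3 = defect"
    "arr l" "src l = X 3" "tgt l = ?A" "deg l = 2" "m3 \<odot> x3 = defect_bound \<oplus> bdry l"
    by (rule heq_lift[OF heq_x3, of defect ?A defect_bound]) (simp_all add: bdry_defect bdry_defect_bound del: One_nat_def)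
  interpret low_semigroup_A3 "X 1" "X 2" "X 3" "X 4" "G 2 1 (\<lambda>_. 0)" "G 3 2 (merge 0)" "G 3 2 (merge 1)"
    "G 4 3 (merge 0)" "G 4 3 (merge 1)" "G 4 3 (merge 2)" "Xi 1 1" "Xi 2 1" "Xi 1 2" "Xi 3 1" "Xi 2 2" "Xi 1 3" m2 h m3 l
    by unfold_locales fact+
  obtain m4 where m4: "arr m4" "src m4 = tensor (tensor ?AA ?A) ?A" "tgt m4 = ?A" "deg m4 = 2" "bdry m4 = obstruction"
    by (rule heq_lift[OF heq_x4, of obstruction ?A obstruction_bound]) (simp_all add: bdry_obstruction bdry_obstruction_bound del: One_nat_def)
  have "A4_algebra ?A (app m2) (app m3) (app m4)"
    by (rule A4_algebraI[OF m2 m3(1-5)[unfolded defect_def] m4[unfolded obstruction_def]])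
  moreover have "chain_htpic ?AA ?A (app m2) (\<lambda>p y. Xm (1 + 1) 1 (\<lambda>_. 0) p (psi p y))"
    unfolding chain_htpic_def
  \<comment> \<open>On the carriers \<open>m2\<close> equals the composite of \<open>\<mu>\<close>
    with \<open>psi\<close>, so the zero homotopy suffices.\<close>
  proof (intro exI[of _ "\<lambda>p _. czero ?A (p + 1)"] conjI allI ballI)
    have AA: "chain_complex ?AA" by simp
    note mA = chain_complex_module[OF complex] and mAA = chain_complex_module[OF AA]
    show "linmap ?AA p ?A (p + 1) (\<lambda>_. czero ?A (p + 1))" for p
      by (rule linmap_const_zero[OF mAA mA])
    fix p y assume y: "y \<in> cset ?AA p"
    have \<psi>y: "psi p y \<in> cset (X 2) p"
      using app_closed[OF chain_arrD(1)[OF \<psi>], of y p] y by (simp add: app_mk)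
    have eq: "app m2 p y = Xm (1 + 1) 1 (\<lambda>_. 0) p (psi p y)"
      using y \<psi>y by (simp add: m2_def app_ops app_mk del: One_nat_def) (simp add: G_def app_mk two del: One_nat_def)
    have "app m2 p y \<in> cset ?A p" using app_closed[of m2 y p] y by simp
    then show "app m2 p y = cadd ?A p (cadd ?A p (Xm (1 + 1) 1 (\<lambda>_. 0) p (psi p y))
        (cd ?A (p + 1) (czero ?A (p + 1)))) (czero ?A (p - 1 + 1))"
      using linmap_zero[OF mA mA chain_complex_linmap[OF complex], of 1 "p + 1"]
      unfolding eq[symmetric] by (simp add: module_add_zero_right[OF mA])
  qed
  ultimately show ?thesis using psi by blast
qed

end
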